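(* Let $\Omega$ be an open bounded Lipschitz subset of $\mathbb{R}^N$ and $p\in(1,\infty)$. Then $$\lambda^1_{L,p}(\Omega)=\frac{d}{ds}\bigg|_{s=0}\lambda^1_{s,p}(\Omega).$$ Moreover, if $\varphi_s$ denotes the $L^p$-normalized unique positive extremal for $\lambda^1_{s,p}(\Omega)$, then, as $s\to0^+$, $$\varphi_s\to u_1\quad\text{in }L^p(\Omega),$$ where $u_1$ is the $L^p$-normalized unique positive extremal for $\lambda^1_{L,p}(\Omega)$.
   Context: $\Omega\neq\emptyset$, $\Gamma$ is the Gamma function, $\psi=\Gamma'/\Gamma$, $\gamma=-\Gamma'(1)$. **Fractional eigenvalue.** For $s\in(0,1)$, $$C_{N,s,p}=\frac{sp\,2^{2s-1}\Gamma(\frac{N+sp}{2})}{\pi^{N/2}\Gamma(1-s)}\ \text{ if } s\le\tfrac12,\qquad C_{N,s,p}=\frac{sp\,2^{2s-2}\Gamma(\frac{N+sp}{2})}{\pi^{(N-1)/2}\Gamma(1-s)\Gamma(\frac{p+1}{2})}\ \text{ if } s>\tfrac12,$$ $\mathcal{W}^{s,p}_0(\Omega)=\{u\in W^{s,p}(\mathbb{R}^N): u=0\text{ a.e. on }\mathbb{R}^N\setminus\Omega\}$, and $$\lambda^1_{s,p}(\Omega)=\inf_{\substack{u\in\mathcal{W}^{s,p}_0(\Omega)\\ \|u\|_{L^p(\Omega)}=1}}\frac{C_{N,s,p}}{2}\iint_{\mathbb{R}^N\times\mathbb{R}^N}\frac{|u(x)-u(y)|^p}{|x-y|^{N+sp}}\,dx\,dy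 .$$ It is known that the infimum is attained by a minimizer (extremal) unique up to sign, which can be chosen positive in $\Omega$. **Logarithmic eigenvalue.** $C_{N,p}=\frac{p\,\Gamma(N/2)}{2\pi^{N/2}}$, $\rho_N(p)=2\ln2-\gamma+\frac p2\psi(\frac N2)$, $$X^p_0(\Omega)=\Big\{u\in L^p(\mathbb{R}^N): u=0\text{ a.e. on }\mathbb{R}^N\setminus\Omega,\ \int_{\mathbb{R}^N}\int_{B_1(x)}\frac{|u(x)-u(y)|^p}{|x-y|^N}\,dy\,dx<\infty\Big\},$$ $$\lambda^1_{L,p}(\Omega)=\inf\{\mathcal{E}_{L,p}(u,u):u\in X^p_0(\Omega),\ \|u\|_{L^p(\Omega)}=1\},$$ $$\begin{aligned}\mathcal{E}_{L,p}(u,u)&=\frac{C_{N,p}}{2}\iint_{|x-y|<1}\frac{|u(x)-u(y)|^p}{|x-y|^N}\,dx\,dy+\rho_N(p)\int_{\mathbb{R}^N}|u|^p\,dx\\&\quad+\frac{C_{N,p}}{2}\iint_{|x-y|\ge1}\frac{|u(x)-u(y)|^p-|u(x)|^p-|u(y)|^p}{|x-y|^N}\,dx\,dy.\end{aligned}$$ The infimum is attained by an extremal that is unique up to sign and can be chosen positive in $\Omega$. **Derivative at $0$.** One has $\lambda^1_{s,p}(\Omega)\to1$ as $s\to0^+$, and $\frac{d}{ds}\big|_{s=0}\lambda^1_{s,p}(\Omega)$ denotes $\lim_{s\to0^+}\frac{\lambda^1_{s,p}(\Omega)-1}{s}$. *)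

theory Defs
  imports "HOL-Analysis.Analysis"
begin

text \<open>
  Here \<open>DIM('a)\<close> is the dimension \<open>N\<close>.  Elements of \<open>L\<^sup>p\<close> are represented by Borel
  functions: every class of Lebesgue measurable functions modulo a.e. equality has a Borel
  representative, and all notions below are invariant under a.e. changes.
\<close>

definition lipschitz_boundary :: "'a::euclidean_space set \<Rightarrow> bool" where
  "lipschitz_boundary \<Omega> \<longleftrightarrow>
    (\<forall>z \<in> frontier \<Omega>. \<exists>r > 0. \<exists>e g L. norm e = 1 \<and> L-lipschitz_on {y. y \<bullet> e = 0} g \<and>
       \<Omega> \<inter> ball z r = {x \<in> ball z r. x \<bullet> e > (g (x - (x \<bullet> e) *\<^sub>R e) :: real)})"

definition Lp_fun :: "real \<Rightarrow> ('a::euclidean_space \<Rightarrow> real) \<Rightarrow> bool" where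
  "Lp_fun p u \<longleftrightarrow> u \<in> borel_measurable borel \<and> integrable lborel (\<lambda>x. \<bar>u x\<bar> powr p)"

definition Lp_norm :: "real \<Rightarrow> 'a::euclidean_space set \<Rightarrow> ('a \<Rightarrow> real) \<Rightarrow> real" where
  "Lp_norm p \<Omega> u = (LINT x:\<Omega>|lborel. \<bar>u x\<bar> powr p) powr (1 / p)"

definition vanishes_outside :: "'a::euclidean_space set \<Rightarrow> ('a \<Rightarrow> real) \<Rightarrow> bool" where
  "vanishes_outside \<Omega> u \<longleftrightarrow> (AE x in lborel. x \<notin> \<Omega> \<longrightarrow> u x = 0)"

definition positive_in :: "'a::euclidean_space set \<Rightarrow> ('a \<Rightarrow> real) \<Rightarrow> bool" where
  "positive_in \<Omega> u \<longleftrightarrow> (AE x in lborel. x \<in> \<Omega> \<longrightarrow> u x > 0)"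


subsection \<open>The fractional eigenvalue\<close>

definition C_frac :: "nat \<Rightarrow> real \<Rightarrow> real \<Rightarrow> real" where
  "C_frac N s p =
    (if s \<le> 1 / 2
     then s * p * 2 powr (2 * s - 1) * Gamma ((real N + s * p) / 2)
          / (pi powr (real N / 2) * Gamma (1 - s))
     else s * p * 2 powr (2 * s - 2) * Gamma ((real N + s * p) / 2)
          / (pi powr ((real N - 1) / 2) * Gamma (1 - s) * Gamma ((p + 1) / 2)))"

text \<open>On the (null) diagonal the difference quotients below take the value \<open>0\<close>.\<close>

definition gagliardo_quotient ::
    "real \<Rightarrow> real \<Rightarrow> ('a::euclidean_space \<Rightarrow> real) \<Rightarrow> 'a \<Rightarrow> 'a \<Rightarrow> real" where
  "gagliardo_quotient s p u x y =
     \<bar>u x - u y\<bar> powr p / norm (x - y) powr (real DIM('a) + s * p)"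

definition W_frac :: "real \<Rightarrow> real \<Rightarrow> ('a::euclidean_space \<Rightarrow> real) set" where
  "W_frac s p = {u. Lp_fun p u \<and>
     (\<integral>\<^sup>+ (x, y). ennreal (gagliardo_quotient s p u x y) \<partial>(lborel \<Otimes>\<^sub>M lborel)) < \<infinity>}"

definition W0_frac :: "real \<Rightarrow> real \<Rightarrow> 'a::euclidean_space set \<Rightarrow> ('a \<Rightarrow> real) set" where
  "W0_frac s p \<Omega> = {u \<in> W_frac s p. vanishes_outside \<Omega> u}"

definition E_frac :: "real \<Rightarrow> real \<Rightarrow> ('a::euclidean_space \<Rightarrow> real) \<Rightarrow> real" where
  "E_frac s p u = C_frac DIM('a) s p / 2 *
     integral\<^sup>L (lborel \<Otimes>\<^sub>M lborel) (\<lambda>(x, y). gagliardo_quotient s p u x y)"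

definition lambda_frac :: "real \<Rightarrow> real \<Rightarrow> 'a::euclidean_space set \<Rightarrow> real" where
  "lambda_frac s p \<Omega> = (INF u \<in> {u \<in> W0_frac s p \<Omega>. Lp_norm p \<Omega> u = 1}. E_frac s p u)"

definition extremal_frac ::
    "real \<Rightarrow> real \<Rightarrow> 'a::euclidean_space set \<Rightarrow> ('a \<Rightarrow> real) \<Rightarrow> bool" where
  "extremal_frac s p \<Omega> u \<longleftrightarrow>
     u \<in> W0_frac s p \<Omega> \<and> Lp_norm p \<Omega> u = 1 \<and> E_frac s p u = lambda_frac s p \<Omega>"


subsection \<open>The logarithmic eigenvalue\<close>

text \<open>The library constants used in \<open>rho_log\<close> below satisfy
  \<open>\<psi> = \<Gamma>' / \<Gamma>\<close> and \<open>\<gamma> = - \<Gamma>'(1)\<close>.\<close>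

lemma Digamma_eq_deriv_Gamma:
  fixes x :: real
  assumes "x > 0"
  shows "Digamma x = deriv Gamma x / Gamma x"
proof -
  have x: "x \<notin> \<int>\<^sub>\<le>\<^sub>0" using assms by (auto elim!: nonpos_Ints_cases)
  have "(Gamma has_field_derivative Gamma x * Digamma x) (at x)"
    by (rule has_field_derivative_Gamma[OF x])
  then have "deriv Gamma x = Gamma x * Digamma x" by (rule DERIV_imp_deriv)
  moreover have "Gamma x > 0" using assms by (rule Gamma_real_pos)
  ultimately show ?thesis by simp
qed

lemma euler_mascheroni_eq_deriv_Gamma: "euler_mascheroni = - deriv Gamma (1 :: real)"
  using Digamma_eq_deriv_Gamma[of 1] by (simp add: Digamma_1)

definition C_log :: "nat \<Rightarrow> real \<Rightarrow> real" where
  "C_log N p = p * Gamma (real N / 2) / (2 * pi powr (real N / 2))"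

definition rho_log :: "nat \<Rightarrow> real \<Rightarrow> real" where
  "rho_log N p = 2 * ln 2 - euler_mascheroni + p / 2 * Digamma (real N / 2)"

definition X0_log :: "real \<Rightarrow> 'a::euclidean_space set \<Rightarrow> ('a \<Rightarrow> real) set" where
  "X0_log p \<Omega> = {u. Lp_fun p u \<and> vanishes_outside \<Omega> u \<and>
     (\<integral>\<^sup>+ x. (\<integral>\<^sup>+ y \<in> ball x 1.
        ennreal (\<bar>u x - u y\<bar> powr p / norm (x - y) ^ DIM('a)) \<partial>lborel) \<partial>lborel) < \<infinity>}"

text \<open>For \<open>u\<close> in \<open>X0_log p \<Omega>\<close> with \<open>\<Omega>\<close> bounded all three integrands are integrable; the last
  one vanishes a.e. outside \<open>\<Omega> \<times> \<Omega>\<close>.\<close>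

definition E_log :: "real \<Rightarrow> ('a::euclidean_space \<Rightarrow> real) \<Rightarrow> real" where
  "E_log p u =
     C_log DIM('a) p / 2 *
       (LINT z:{(x, y). norm (x - y) < 1}|lborel \<Otimes>\<^sub>M lborel. case z of (x, y) \<Rightarrow>
          \<bar>u x - u y\<bar> powr p / norm (x - y) ^ DIM('a))
     + rho_log DIM('a) p * (LINT x|lborel. \<bar>u x\<bar> powr p)
     + C_log DIM('a) p / 2 *
       (LINT z:{(x, y). norm (x - y) \<ge> 1}|lborel \<Otimes>\<^sub>M lborel. case z of (x, y) \<Rightarrow>
          (\<bar>u x - u y\<bar> powr p - \<bar>u x\<bar> powr p - \<bar>u y\<bar> powr p) / norm (x - y) ^ DIM('a))"

definition lambda_log :: "real \<Rightarrow> 'a::euclidean_space set \<Rightarrow> real" where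
  "lambda_log p \<Omega> = (INF u \<in> {u \<in> X0_log p \<Omega>. Lp_norm p \<Omega> u = 1}. E_log p u)"

definition extremal_log ::
    "real \<Rightarrow> 'a::euclidean_space set \<Rightarrow> ('a \<Rightarrow> real) \<Rightarrow> bool" where
  "extremal_log p \<Omega> u \<longleftrightarrow>
     u \<in> X0_log p \<Omega> \<and> Lp_norm p \<Omega> u = 1 \<and> E_log p u = lambda_log p \<Omega>"

end

theory Submission
  imports Defs "HOL-Probability.Probability"
begin

text \<open>
  Write \<open>N\<close> for the dimension, \<open>m(u)\<close> for the integral of \<open>\<bar>u\<bar>\<^sup>p\<close>, fix \<open>D \<ge> 1\<close> larger than the distance
  of any two points of \<open>\<Omega>\<close>, and let \<open>G s u\<close> (\<open>near_energy\<close>) be the double integral of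
  \<open>\<bar>u x - u y\<bar>\<^sup>p / \<bar>x - y\<bar>\<^bsup>N+sp\<^esup>\<close> over \<open>\<bar>x - y\<bar> < D\<close>.  For \<open>u\<close> vanishing outside \<open>\<Omega>\<close> two points at
  distance at least \<open>D\<close> never both carry mass, so the part of either energy over \<open>\<bar>x - y\<bar> \<ge> D\<close> is an
  explicit multiple of \<open>m(u)\<close>.  Therefore, on functions with \<open>m(u) = 1\<close>, both \<open>(E_frac s p u - 1) / s\<close>
  and \<open>E_log p u\<close> are affine functions of \<open>G s u\<close> and \<open>G 0 u\<close>, and the coefficients of the former
  converge to those of the latter as \<open>s \<rightarrow> 0\<close>; the additive one is a difference quotient of a product
  of Gamma factors, whose derivative at \<open>0\<close> produces \<open>rho_log\<close>.

  Lower bound for the eigenvalue quotient: on \<open>\<bar>w\<bar> < D\<close> one has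
  \<open>\<bar>w\<bar>\<^bsup>-N-sp\<^esup> \<ge> D\<^bsup>-sp\<^esup> \<bar>w\<bar>\<^bsup>-N\<^esup>\<close>, hence \<open>G s u \<ge> D\<^bsup>-sp\<^esup> G 0 u\<close> for every \<open>u\<close>.  The comparison
  \<open>E_frac_ge_E_log\<close> is uniform in \<open>u\<close> and passes to the infima.

  Upper bound: for a fixed Lipschitz function vanishing outside \<open>\<Omega>\<close>, dominated convergence gives
  \<open>G s v \<rightarrow> G 0 v\<close>.  It remains to approximate an arbitrary competitor of the logarithmic problem by
  Lipschitz ones without raising \<open>G 0\<close> (\<open>lipschitz_core_dense\<close>).  This is where the regularity of the
  boundary enters: outside \<open>\<Omega>\<close> there are balls of comparable size at every boundary point and every
  small scale, each dyadic scale contributes a fixed amount to the energy, and so a function of finite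
  energy satisfies a Hardy inequality with weight \<open>ln (1 / dist(x, \<partial>\<Omega>))\<close> (\<open>log_hardy\<close>).
  With that weight, cutting off near the boundary is a dominated limit.  Afterwards one mollifies:
  by Jensen's inequality and translation invariance this does not increase \<open>G 0\<close>, and the distance to
  the original function is bounded by the energy carried by pairs of nearby points, which tends to \<open>0\<close>.

  Convergence of the extremals: the uniform comparison shows that \<open>\<phi>\<^sub>s\<close> is a minimizing
  sequence for \<open>E_log\<close>.  Given a positive minimizer \<open>u\<close>, replace the pair \<open>(\<phi>\<^sub>s, u)\<close> by
  \<open>(min \<phi>\<^sub>s u, max \<phi>\<^sub>s u)\<close>.  The total mass is unchanged, while the energy drops by an amount that
  controls the measure of the pairs \<open>(x, y)\<close> with \<open>\<phi>\<^sub>s\<close> above \<open>u + \<epsilon>\<close> at \<open>x\<close> and below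
  \<open>u - \<epsilon>\<close> at \<open>y\<close>, because \<open>t \<mapsto> \<bar>t\<bar>\<^sup>p\<close> is strictly convex (\<open>crossing_energy_le\<close>).  As
  both energies tend to the minimum, that amount tends to \<open>0\<close>: asymptotically \<open>\<phi>\<^sub>s - u\<close> has one sign.  Both functions
  have the same norm and bounded energy excludes concentration of mass (\<open>uniformly_integrable\<close>), so the
  difference tends to \<open>0\<close> in \<open>L\<^sup>p\<close> (\<open>minimizer_stability\<close>).  In particular positive minimizers are unique.
\<close>

section \<open>Integrals of radial functions\<close>

lemma emeasure_ball_real:
  "0 \<le> r \<Longrightarrow> emeasure lborel (ball (c::'a::euclidean_space) r)
    = ennreal (unit_ball_vol (real DIM('a)) * r ^ DIM('a))"
  using emeasure_ball[of r c] by simp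

text \<open>
  The law of \<open>- norm z\<close> is used instead of that of \<open>norm z\<close>: its half-lines \<open>{x<..}\<close> pull back to balls,
  which have finite measure, so that the measure is determined by their volumes.
\<close>
lemma nn_integral_radial:
  fixes f :: "real \<Rightarrow> ennreal"
  assumes [measurable]: "f \<in> borel_measurable borel"
  shows "(\<integral>\<^sup>+ (z::'a::euclidean_space). f (norm z) \<partial>lborel)
    = (\<integral>\<^sup>+ r. f r * ennreal (if 0 < r then real DIM('a) * unit_ball_vol (real DIM('a)) * r ^ (DIM('a) - 1) else 0) \<partial>lborel)"
proof -
  let ?N = "DIM('a)" and ?w = "unit_ball_vol (real DIM('a))"
  define g where "g t = (if t < 0 then real ?N * ?w * (- t) ^ (?N - 1) else 0)" for t :: real
  have [measurable]: "g \<in> borel_measurable borel" unfolding g_def by measurable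
  have w: "?w \<ge> 0" by simp
  have g0: "g t \<ge> 0" for t unfolding g_def using w by auto
  have *: "distr (lborel::'a measure) borel (\<lambda>z. - norm z) = density lborel (\<lambda>t. ennreal (g t))"
  proof (rule measure_eqI_lessThan)
    have A: "emeasure (distr (lborel::'a measure) borel (\<lambda>z. - norm z)) {x<..}
        = ennreal (if x < 0 then ?w * (- x) ^ ?N else 0)" for x :: real
    proof -
      have "emeasure (distr (lborel::'a measure) borel (\<lambda>z. - norm z)) {x<..}
          = emeasure lborel ((\<lambda>z::'a. - norm z) -` {x<..} \<inter> space lborel)"
        by (subst emeasure_distr) auto
      also have "(\<lambda>z::'a. - norm z) -` {x<..} \<inter> space lborel = ball 0 (- x)" by auto
      finally show ?thesis
        by (cases "x < 0") (auto simp: emeasure_ball_real ball_empty)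
    qed
    show "emeasure (distr (lborel::'a measure) borel (\<lambda>z. - norm z)) {x<..} < \<infinity>" for x
      unfolding A by simp
    show "emeasure (distr (lborel::'a measure) borel (\<lambda>z. - norm z)) {x<..}
        = emeasure (density lborel (\<lambda>t. ennreal (g t))) {x<..}" for x
    proof -
      have "emeasure (density lborel (\<lambda>t. ennreal (g t))) {x<..}
         = (\<integral>\<^sup>+ t. ennreal (g t) * indicator {x<..} t \<partial>lborel)"
        by (subst emeasure_density) auto
      also have "\<dots> = ennreal (if x < 0 then ?w * (- x) ^ ?N else 0)"
      proof (cases "x < 0")
        case True
        have "(\<integral>\<^sup>+ t. ennreal (g t) * indicator {x<..} t \<partial>lborel)
          = (\<integral>\<^sup>+ t. ennreal (real ?N * ?w * (- t) ^ (?N - 1)) * indicator {x..0} t \<partial>lborel)"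
          using AE_lborel_singleton[of 0] AE_lborel_singleton[of x]
          by (intro nn_integral_cong_AE) (auto simp: g_def split: split_indicator)
        also have "\<dots> = ennreal ((- ?w * (- 0) ^ ?N) - (- ?w * (- x) ^ ?N))"
          using True w
          by (intro nn_integral_FTC_Icc)
            (auto intro!: derivative_eq_intros mult_nonneg_nonneg simp: has_real_derivative_iff_has_vector_derivative[symmetric])
        finally show ?thesis using True by simp
      next
        case False
        then have "ennreal (g t) * indicator {x<..} t = 0" for t
          by (auto simp: g_def split: split_indicator)
        then show ?thesis using False by (simp only: nn_integral_const) simp
      qed
      finally show ?thesis unfolding A by simp
    qed
  qed auto
  have "(\<integral>\<^sup>+ (z::'a). f (norm z) \<partial>lborel) = (\<integral>\<^sup>+ t. f (- t) \<partial>distr (lborel::'a measure) borel (\<lambda>z. - norm z))"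
    by (subst nn_integral_distr) auto
  also have "\<dots> = (\<integral>\<^sup>+ t. ennreal (g t) * f (- t) \<partial>lborel)"
    unfolding * by (subst nn_integral_density) auto
  also have "\<dots> = (\<integral>\<^sup>+ r. ennreal (g (- r)) * f r \<partial>lborel)"
    by (subst nn_integral_real_affine[of _ "-1" 0]) auto
  finally show ?thesis by (simp add: g_def mult.commute cong: if_cong)
qed

text \<open>
  The derivative at \<open>r = 1\<close> of the volume of the ball of radius \<open>r\<close>.
\<close>
definition sphere_area :: "'a::euclidean_space itself \<Rightarrow> real" where
  "sphere_area _ = real DIM('a) * unit_ball_vol (real DIM('a))"

lemma sphere_area_pos: "sphere_area TYPE('a::euclidean_space) > 0"
  by (simp add: sphere_area_def)

lemma nn_integral_radial_power:
  fixes q :: real and S :: "real set"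
  assumes [measurable]: "S \<in> sets borel" and S: "S \<subseteq> {0<..}"
  shows "(\<integral>\<^sup>+ (z::'a::euclidean_space). ennreal (norm z powr (q - real DIM('a))) * indicator S (norm z) \<partial>lborel)
    = ennreal (sphere_area TYPE('a)) * (\<integral>\<^sup>+ r. ennreal (r powr (q - 1)) * indicator S r \<partial>lborel)"
proof -
  have "ennreal (r powr (q - real DIM('a))) * indicator S r *
      ennreal (if 0 < r then real DIM('a) * unit_ball_vol (real DIM('a)) * r ^ (DIM('a) - 1) else 0)
    = ennreal (sphere_area TYPE('a)) * (ennreal (r powr (q - 1)) * indicator S r)" for r
  proof (cases "r \<in> S")
    case True
    then have r: "r > 0" using S by auto
    have "r powr (q - real DIM('a)) * r ^ (DIM('a) - 1) = r powr (q - 1)"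
      using r DIM_positive[where 'a='a]
      by (simp add: powr_realpow[symmetric] powr_add[symmetric] of_nat_diff)
    then show ?thesis using r True
      by (simp add: sphere_area_def ennreal_mult'[symmetric] mult_ac)
  qed simp
  then show ?thesis
    by (subst nn_integral_radial) (auto simp: nn_integral_cmult)
qed

lemma nn_integral_radial_ball:
  assumes "0 < q" "0 \<le> D"
  shows "(\<integral>\<^sup>+ (z::'a::euclidean_space). ennreal (norm z powr (q - real DIM('a))) * indicator {0<..<D} (norm z) \<partial>lborel)
    = ennreal (sphere_area TYPE('a) * D powr q / q)"
proof -
  have "(\<integral>\<^sup>+ r. ennreal (r powr (q - 1)) * indicator {0<..<D} r \<partial>lborel) = ennreal (D powr q / q)"
  proof -
    have "((\<lambda>r. r powr (q - 1)) has_integral (D powr ((q - 1) + 1) / ((q - 1) + 1))) {0..D}"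
      using assms by (intro has_integral_powr_from_0) auto
    then have "(\<integral>\<^sup>+ r. ennreal (r powr (q - 1)) * indicator {0..D} r \<partial>lborel) = ennreal (D powr q / q)"
      using nn_integral_has_integral_lebesgue'[of "{0..D}" "\<lambda>r. r powr (q - 1)" "D powr q / q"] by simp
    moreover have "(\<integral>\<^sup>+ r. ennreal (r powr (q - 1)) * indicator {0<..<D} r \<partial>lborel)
       = (\<integral>\<^sup>+ r. ennreal (r powr (q - 1)) * indicator {0..D} r \<partial>lborel)"
      using AE_lborel_singleton[of 0] AE_lborel_singleton[of D]
      by (intro nn_integral_cong_AE) (auto split: split_indicator)
    ultimately show ?thesis by simp
  qed
  then show ?thesis
    using assms sphere_area_pos[where 'a='a]
    by (subst nn_integral_radial_power) (auto simp: ennreal_mult'[symmetric])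
qed

lemma nn_integral_radial_annulus:
  assumes "0 < a" "a \<le> D"
  shows "(\<integral>\<^sup>+ (z::'a::euclidean_space). ennreal (norm z powr - real DIM('a)) * indicator {a..<D} (norm z) \<partial>lborel)
    = ennreal (sphere_area TYPE('a) * ln (D / a))"
proof -
  have "(\<integral>\<^sup>+ r. ennreal (r powr (0 - 1)) * indicator {a..<D} r \<partial>lborel)
     = (\<integral>\<^sup>+ r. ennreal (1 / r) * indicator {a..D} r \<partial>lborel)"
    using AE_lborel_singleton[of D] assms
    by (intro nn_integral_cong_AE) (auto simp: powr_minus_divide split: split_indicator)
  also have "\<dots> = ennreal (ln D - ln a)"
    using assms by (intro nn_integral_FTC_Icc)
      (auto intro!: derivative_eq_intros simp: has_real_derivative_iff_has_vector_derivative[symmetric])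
  finally show ?thesis
    using assms sphere_area_pos[where 'a='a]
    by (subst nn_integral_radial_power[of _ 0, simplified]) (auto simp: ennreal_mult'[symmetric] ln_div)
qed

lemma nn_integral_radial_exterior:
  assumes "0 < q" "0 < D"
  shows "(\<integral>\<^sup>+ (z::'a::euclidean_space). ennreal (norm z powr (- q - real DIM('a))) * indicator {D..} (norm z) \<partial>lborel)
    = ennreal (sphere_area TYPE('a) * D powr - q / q)"
proof -
  have "(\<integral>\<^sup>+ r. ennreal (r powr (- q - 1)) * indicator {D..} r \<partial>lborel) = ennreal (0 - (- (D powr - q) / q))"
  proof (rule nn_integral_FTC_atLeast)
    show "((\<lambda>x. - (x powr - q) / q) has_real_derivative x powr (- q - 1)) (at x)" if "D \<le> x" for x
      using that assms by (auto intro!: derivative_eq_intros)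
    have "((\<lambda>x. x powr - q) \<longlongrightarrow> 0) at_top"
      using assms by (intro tendsto_neg_powr filterlim_ident) auto
    from tendsto_divide[OF tendsto_minus[OF this] tendsto_const[of q]]
    show "((\<lambda>x. - (x powr - q) / q) \<longlongrightarrow> 0) at_top" using assms by simp
  qed auto
  then show ?thesis
    using assms sphere_area_pos[where 'a='a]
    by (subst nn_integral_radial_power) (auto simp: ennreal_mult'[symmetric])
qed

text \<open>
  A layer cake estimate: since \<open>\<bar>x - y\<bar>\<^bsup>-N\<^esup>\<close> is the integral of \<open>N r\<^bsup>-N-1\<^esup>\<close> over \<open>r > \<bar>x - y\<bar>\<close>,
  exchanging integrals turns the left-hand side into an integral of \<open>N r\<^bsup>-N-1\<^esup>\<close> against the measure of
  \<open>E \<inter> ball y r\<close>, at least \<open>N c / r\<close> for \<open>a \<le> r \<le> b\<close>.  It is applied to the exterior of \<open>\<Omega>\<close>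
  (Hardy inequality) and to sublevel sets (uniform integrability).
\<close>
lemma density_log_lower_bound:
  fixes y :: "'a::euclidean_space"
  assumes [measurable]: "E \<in> sets borel" and "0 < a" "a \<le> b" "0 \<le> c"
    and dens: "\<And>r. a \<le> r \<Longrightarrow> r \<le> b \<Longrightarrow> emeasure lborel (E \<inter> ball y r) \<ge> ennreal (c * r ^ DIM('a))"
  shows "(\<integral>\<^sup>+ x. indicator (E \<inter> ball y b) x * ennreal (norm (x - y) powr - real DIM('a)) \<partial>lborel)
     \<ge> ennreal (real DIM('a) * c * ln (b / a))"
proof -
  let ?N = "real DIM('a)"
  have N: "?N > 0" by simp
  have key: "(\<integral>\<^sup>+ r. ennreal (?N * r powr (- ?N - 1)) * indicator {a..b} r * indicator {d<..} r \<partial>lborel)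
      \<le> indicator {..<b} d * ennreal (d powr - ?N)" if d: "d > 0" for d :: real
  proof (cases "d < b")
    case True
    have "(\<integral>\<^sup>+ r. ennreal (?N * r powr (- ?N - 1)) * indicator {a..b} r * indicator {d<..} r \<partial>lborel)
      \<le> (\<integral>\<^sup>+ r. ennreal (?N * r powr (- ?N - 1)) * indicator {d..} r \<partial>lborel)"
      by (intro nn_integral_mono) (auto split: split_indicator)
    also have "\<dots> = ennreal (0 - (- (d powr - ?N)))"
    proof (rule nn_integral_FTC_atLeast)
      show "((\<lambda>x. - (x powr - ?N)) has_real_derivative ?N * x powr (- ?N - 1)) (at x)" if "d \<le> x" for x
        using that d by (auto intro!: derivative_eq_intros)
      have "((\<lambda>x. x powr - ?N) \<longlongrightarrow> 0) at_top"
        using N by (intro tendsto_neg_powr filterlim_ident) auto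
      from tendsto_minus[OF this]
      show "((\<lambda>x. - (x powr - ?N)) \<longlongrightarrow> 0) at_top" by simp
    qed auto
    finally show ?thesis using True by simp
  next
    case False
    then have "ennreal (?N * r powr (- ?N - 1)) * indicator {a..b} r * indicator {d<..} r = 0" for r
      by (auto split: split_indicator)
    then show ?thesis by (simp only: nn_integral_const) simp
  qed
  have "ennreal (?N * c * ln (b / a)) = ennreal (?N * c * ln b - ?N * c * ln a)"
    using assms by (simp add: ln_div algebra_simps)
  also have "\<dots> = (\<integral>\<^sup>+ r. ennreal (?N * c / r) * indicator {a..b} r \<partial>lborel)"
    using assms by (intro nn_integral_FTC_Icc[symmetric])
      (auto intro!: derivative_eq_intros simp: has_real_derivative_iff_has_vector_derivative[symmetric])
  also have "\<dots> \<le> (\<integral>\<^sup>+ r. ennreal (?N * r powr (- ?N - 1)) * indicator {a..b} r * emeasure lborel (E \<inter> ball y r) \<partial>lborel)"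
  proof (intro nn_integral_mono)
    fix r :: real
    show "ennreal (?N * c / r) * indicator {a..b} r
      \<le> ennreal (?N * r powr (- ?N - 1)) * indicator {a..b} r * emeasure lborel (E \<inter> ball y r)"
    proof (cases "r \<in> {a..b}")
      case True
      then have r: "r > 0" "a \<le> r" "r \<le> b" using assms by auto
      have "?N * c / r = (?N * r powr (- ?N - 1)) * (c * r ^ DIM('a))"
        using r by (simp add: powr_diff powr_minus powr_realpow field_simps)
      then have "ennreal (?N * c / r) = ennreal (?N * r powr (- ?N - 1)) * ennreal (c * r ^ DIM('a))"
        using assms r by (subst ennreal_mult[symmetric]) auto
      also have "\<dots> \<le> ennreal (?N * r powr (- ?N - 1)) * emeasure lborel (E \<inter> ball y r)"
        by (intro mult_left_mono dens r) auto
      finally show ?thesis using True by simp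
    qed simp
  qed
  also have "\<dots> = (\<integral>\<^sup>+ r. \<integral>\<^sup>+ x. ennreal (?N * r powr (- ?N - 1)) * indicator {a..b} r
        * (indicator E x * indicator {norm (x - y)<..} r) \<partial>lborel \<partial>lborel)"
  proof (intro nn_integral_cong)
    fix r :: real
    have "emeasure lborel (E \<inter> ball y r) = (\<integral>\<^sup>+ x. indicator (E \<inter> ball y r) x \<partial>lborel)"
      by (subst nn_integral_indicator) auto
    also have "\<dots> = (\<integral>\<^sup>+ x. indicator E x * indicator {norm (x - y)<..} r \<partial>lborel)"
      by (intro nn_integral_cong) (auto simp: dist_norm norm_minus_commute split: split_indicator)
    finally show "ennreal (?N * r powr (- ?N - 1)) * indicator {a..b} r * emeasure lborel (E \<inter> ball y r)
      = (\<integral>\<^sup>+ x. ennreal (?N * r powr (- ?N - 1)) * indicator {a..b} r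
        * (indicator E x * indicator {norm (x - y)<..} r) \<partial>lborel)"
      by (subst nn_integral_cmult) (auto simp: indicator_def)
  qed
  also have "\<dots> = (\<integral>\<^sup>+ x. \<integral>\<^sup>+ r. ennreal (?N * r powr (- ?N - 1)) * indicator {a..b} r
        * (indicator E x * indicator {norm (x - y)<..} r) \<partial>lborel \<partial>lborel)"
    by (rule lborel_pair.Fubini') (simp add: indicator_def, measurable)
  also have "\<dots> \<le> (\<integral>\<^sup>+ x. indicator (E \<inter> ball y b) x * ennreal (norm (x - y) powr - ?N) \<partial>lborel)"
  proof (rule nn_integral_mono_AE)
    show "AE x in lborel. (\<integral>\<^sup>+ r. ennreal (?N * r powr (- ?N - 1)) * indicator {a..b} r
        * (indicator E x * indicator {norm (x - y)<..} r) \<partial>lborel)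
        \<le> indicator (E \<inter> ball y b) x * ennreal (norm (x - y) powr - ?N)"
      using AE_lborel_singleton[of y]
    proof eventually_elim
      case (elim x)
      then have d: "norm (x - y) > 0" by simp
      have "(\<integral>\<^sup>+ r. ennreal (?N * r powr (- ?N - 1)) * indicator {a..b} r
        * (indicator E x * indicator {norm (x - y)<..} r) \<partial>lborel)
        = indicator E x * (\<integral>\<^sup>+ r. ennreal (?N * r powr (- ?N - 1)) * indicator {a..b} r
        * indicator {norm (x - y)<..} r \<partial>lborel)"
        by (subst nn_integral_cmult[symmetric]) (auto simp: mult_ac)
      also have "\<dots> \<le> indicator E x * (indicator {..<b} (norm (x - y)) * ennreal (norm (x - y) powr - ?N))"
        by (intro mult_left_mono key d) auto
      also have "\<dots> = indicator (E \<inter> ball y b) x * ennreal (norm (x - y) powr - ?N)"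
        by (auto simp: dist_norm norm_minus_commute split: split_indicator)
      finally show ?case .
    qed
  qed
  finally show ?thesis .
qed

section \<open>Nonlocal energies as interactions with Riesz kernels\<close>

definition interaction :: "('a::euclidean_space \<Rightarrow> ennreal) \<Rightarrow> real \<Rightarrow> ('a \<Rightarrow> real) \<Rightarrow> ennreal" where
  "interaction k p u =
     (\<integral>\<^sup>+ x. \<integral>\<^sup>+ y. k (x - y) * ennreal (\<bar>u x - u y\<bar> powr p) \<partial>lborel \<partial>lborel)"

definition mass :: "real \<Rightarrow> ('a::euclidean_space \<Rightarrow> real) \<Rightarrow> ennreal" where
  "mass p u = (\<integral>\<^sup>+ x. ennreal (\<bar>u x\<bar> powr p) \<partial>lborel)"

definition riesz :: "real set \<Rightarrow> real \<Rightarrow> 'a::euclidean_space \<Rightarrow> ennreal" where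
  "riesz S a w = indicator S (norm w) * ennreal (norm w powr (- real DIM('a) - a))"

lemma measurable_riesz [measurable]:
  assumes [measurable]: "S \<in> sets borel"
  shows "riesz S a \<in> borel_measurable borel"
  unfolding riesz_def[abs_def] by measurable

lemma interaction_pair:
  assumes [measurable]: "k \<in> borel_measurable borel" "u \<in> borel_measurable borel"
  shows "interaction k p u =
    (\<integral>\<^sup>+ z. k (fst z - snd z) * ennreal (\<bar>u (fst z) - u (snd z)\<bar> powr p) \<partial>(lborel \<Otimes>\<^sub>M lborel))"
  unfolding interaction_def by (subst lborel.nn_integral_fst[symmetric]) auto

lemma interaction_add:
  assumes [measurable]: "k \<in> borel_measurable borel" "l \<in> borel_measurable borel" "u \<in> borel_measurable borel"
  shows "interaction (\<lambda>w. k w + l w) p u = interaction k p u + interaction l p u"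
  unfolding interaction_def
  by (simp add: distrib_right nn_integral_add)

lemma interaction_cmult:
  assumes [measurable]: "k \<in> borel_measurable borel" "u \<in> borel_measurable borel"
  shows "interaction (\<lambda>w. c * k w) p u = c * interaction k p u"
  unfolding interaction_def
  by (simp add: mult.assoc nn_integral_cmult)

lemma interaction_mono: "(\<And>w. k w \<le> l w) \<Longrightarrow> interaction k p u \<le> interaction l p u"
  unfolding interaction_def by (intro nn_integral_mono mult_right_mono) auto

lemma lborel_distr_reflect: "distr lborel borel (\<lambda>y. x - y) = (lborel :: 'a::euclidean_space measure)"
  using lborel_affine[of "-1" x] by (simp add: density_1)

lemma nn_integral_reflect_translate:
  fixes k :: "'a::euclidean_space \<Rightarrow> ennreal"
  assumes "k \<in> borel_measurable borel"
  shows "(\<integral>\<^sup>+ y. k (x - y) \<partial>lborel) = integral\<^sup>N lborel k"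
  using nn_integral_distr[of "\<lambda>y. x - y" lborel borel k] assms by (simp add: lborel_distr_reflect)

lemma integrable_reflect_translate:
  fixes f :: "'a::euclidean_space \<Rightarrow> real"
  assumes "integrable lborel f"
  shows "integrable lborel (\<lambda>y. f (x - y))"
  using integrable_distr_eq[of "\<lambda>y. x - y" lborel borel f] assms
  by (auto simp: lborel_distr_reflect)

lemma integral_reflect_translate:
  fixes f :: "'a::euclidean_space \<Rightarrow> real"
  assumes "f \<in> borel_measurable borel"
  shows "(\<integral>y. f (x - y) \<partial>lborel) = (\<integral>y. f y \<partial>lborel)"
  using integral_distr[of "\<lambda>y. x - y" lborel borel f] assms by (simp add: lborel_distr_reflect)

lemma nn_integral_translate:
  fixes k :: "'a::euclidean_space \<Rightarrow> ennreal"
  assumes [measurable]: "k \<in> borel_measurable borel"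
  shows "(\<integral>\<^sup>+ y. k (y - x) \<partial>lborel) = integral\<^sup>N lborel k"
proof -
  have "integral\<^sup>N lborel k = integral\<^sup>N (distr lborel borel ((+) (- x))) k"
    by (subst lborel_distr_plus) auto
  also have "\<dots> = (\<integral>\<^sup>+ y. k (y - x) \<partial>lborel)"
    by (simp add: nn_integral_distr)
  finally show ?thesis by simp
qed

lemma nn_integral_convolution_fst:
  fixes k f :: "'a::euclidean_space \<Rightarrow> ennreal"
  assumes [measurable]: "k \<in> borel_measurable borel" "f \<in> borel_measurable borel"
  shows "(\<integral>\<^sup>+ x. \<integral>\<^sup>+ y. k (x - y) * f x \<partial>lborel \<partial>lborel) = integral\<^sup>N lborel k * integral\<^sup>N lborel f"
  by (simp add: nn_integral_multc nn_integral_cmult nn_integral_reflect_translate)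

lemma nn_integral_convolution_snd:
  fixes k f :: "'a::euclidean_space \<Rightarrow> ennreal"
  assumes [measurable]: "k \<in> borel_measurable borel" "f \<in> borel_measurable borel"
  shows "(\<integral>\<^sup>+ x. \<integral>\<^sup>+ y. k (x - y) * f y \<partial>lborel \<partial>lborel) = integral\<^sup>N lborel k * integral\<^sup>N lborel f"
proof -
  have "(\<integral>\<^sup>+ x. \<integral>\<^sup>+ y. k (x - y) * f y \<partial>lborel \<partial>lborel) = (\<integral>\<^sup>+ y. \<integral>\<^sup>+ x. k (x - y) * f y \<partial>lborel \<partial>lborel)"
    by (rule lborel_pair.Fubini') measurable
  then show ?thesis
    by (simp add: nn_integral_multc nn_integral_cmult nn_integral_translate)
qed

lemma powr_abs_diff_le:
  fixes a b :: real
  assumes "0 \<le> p"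
  shows "\<bar>a - b\<bar> powr p \<le> 2 powr p * (\<bar>a\<bar> powr p + \<bar>b\<bar> powr p)"
proof -
  have "\<bar>a - b\<bar> powr p \<le> (2 * max \<bar>a\<bar> \<bar>b\<bar>) powr p"
    using assms by (intro powr_mono2) auto
  also have "\<dots> = 2 powr p * max \<bar>a\<bar> \<bar>b\<bar> powr p" by (simp add: powr_mult)
  also have "\<dots> \<le> 2 powr p * (\<bar>a\<bar> powr p + \<bar>b\<bar> powr p)"
    by (intro mult_left_mono) (auto simp: max_def)
  finally show ?thesis .
qed

lemma interaction_le_mass:
  assumes [measurable]: "k \<in> borel_measurable borel" "u \<in> borel_measurable borel" and "0 \<le> p"
  shows "interaction k p u \<le> ennreal (2 * 2 powr p) * (integral\<^sup>N lborel k * mass p u)"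
proof -
  have "interaction k p u \<le> (\<integral>\<^sup>+ x. \<integral>\<^sup>+ y. ennreal (2 powr p) * (k (x - y) * ennreal (\<bar>u x\<bar> powr p))
      + ennreal (2 powr p) * (k (x - y) * ennreal (\<bar>u y\<bar> powr p)) \<partial>lborel \<partial>lborel)"
    unfolding interaction_def
  proof (intro nn_integral_mono)
    fix x y :: 'a
    have "ennreal (\<bar>u x - u y\<bar> powr p) \<le> ennreal (2 powr p) * (ennreal (\<bar>u x\<bar> powr p) + ennreal (\<bar>u y\<bar> powr p))"
      using powr_abs_diff_le[OF \<open>0 \<le> p\<close>, of "u x" "u y"]
      by (simp add: ennreal_mult'[symmetric] ennreal_plus[symmetric] del: ennreal_plus)
    from mult_left_mono[OF this, of "k (x - y)"]
    show "k (x - y) * ennreal (\<bar>u x - u y\<bar> powr p) \<le> ennreal (2 powr p) * (k (x - y) * ennreal (\<bar>u x\<bar> powr p))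
      + ennreal (2 powr p) * (k (x - y) * ennreal (\<bar>u y\<bar> powr p))"
      by (simp add: distrib_left mult_ac)
  qed
  also have "\<dots> = ennreal (2 powr p) * (\<integral>\<^sup>+ x. \<integral>\<^sup>+ y. k (x - y) * ennreal (\<bar>u x\<bar> powr p) \<partial>lborel \<partial>lborel)
      + ennreal (2 powr p) * (\<integral>\<^sup>+ x. \<integral>\<^sup>+ y. k (x - y) * ennreal (\<bar>u y\<bar> powr p) \<partial>lborel \<partial>lborel)"
    by (simp add: nn_integral_add nn_integral_cmult)
  also have "\<dots> = ennreal (2 powr p) * (integral\<^sup>N lborel k * mass p u) + ennreal (2 powr p) * (integral\<^sup>N lborel k * mass p u)"
    unfolding mass_def
    by (intro arg_cong2[where f="(+)"] arg_cong2[where f="(*)"] refl nn_integral_convolution_fst nn_integral_convolution_snd) auto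
  also have "\<dots> = ennreal (2 * 2 powr p) * (integral\<^sup>N lborel k * mass p u)"
    by (subst mult_2, subst ennreal_plus) (simp_all add: distrib_right)
  finally show ?thesis .
qed

text \<open>
  Where \<open>k (x - y) \<noteq> 0\<close> one of \<open>u x\<close>, \<open>u y\<close> vanishes, so \<open>\<bar>u x - u y\<bar>\<^sup>p\<close> splits into
  \<open>\<bar>u x\<bar>\<^sup>p + \<bar>u y\<bar>\<^sup>p\<close> and each summand is integrated against a translate of \<open>k\<close>.
\<close>
lemma interaction_far:
  assumes [measurable]: "k \<in> borel_measurable borel" "u \<in> borel_measurable borel"
    and van: "vanishes_outside \<Omega> u" and diam: "\<And>x y. x \<in> \<Omega> \<Longrightarrow> y \<in> \<Omega> \<Longrightarrow> norm (x - y) < D"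
    and far: "\<And>w. norm w < D \<Longrightarrow> k w = 0"
  shows "interaction k p u = 2 * (integral\<^sup>N lborel k * mass p u)"
proof -
  have "interaction k p u = (\<integral>\<^sup>+ x. \<integral>\<^sup>+ y. k (x - y) * ennreal (\<bar>u x\<bar> powr p)
      + k (x - y) * ennreal (\<bar>u y\<bar> powr p) \<partial>lborel \<partial>lborel)"
    unfolding interaction_def
  proof (intro nn_integral_cong_AE, use van[unfolded vanishes_outside_def] in eventually_elim,
      intro nn_integral_cong_AE, use van[unfolded vanishes_outside_def] in eventually_elim)
    fix x y assume "x \<notin> \<Omega> \<longrightarrow> u x = 0" "y \<notin> \<Omega> \<longrightarrow> u y = 0"
    then show "k (x - y) * ennreal (\<bar>u x - u y\<bar> powr p)
      = k (x - y) * ennreal (\<bar>u x\<bar> powr p) + k (x - y) * ennreal (\<bar>u y\<bar> powr p)"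
      using diam far[of "x - y"] by (cases "x \<in> \<Omega>"; cases "y \<in> \<Omega>") auto
  qed
  also have "\<dots> = (\<integral>\<^sup>+ x. \<integral>\<^sup>+ y. k (x - y) * ennreal (\<bar>u x\<bar> powr p) \<partial>lborel \<partial>lborel)
      + (\<integral>\<^sup>+ x. \<integral>\<^sup>+ y. k (x - y) * ennreal (\<bar>u y\<bar> powr p) \<partial>lborel \<partial>lborel)"
    by (simp add: nn_integral_add)
  also have "\<dots> = 2 * (integral\<^sup>N lborel k * mass p u)"
    unfolding mult_2 mass_def
    by (intro arg_cong2[where f="(+)"] nn_integral_convolution_fst nn_integral_convolution_snd) auto
  finally show ?thesis .
qed

lemma nn_integral_riesz_exterior:
  assumes "0 < a" "0 < D"
  shows "integral\<^sup>N lborel (riesz {D..} a :: 'a::euclidean_space \<Rightarrow> _) = ennreal (sphere_area TYPE('a) * D powr - a / a)"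
  using nn_integral_radial_exterior[OF assms, where 'a='a]
  unfolding riesz_def[abs_def] diff_conv_add_uminus by (simp only: mult.commute add.commute)

lemma nn_integral_riesz_annulus:
  assumes "0 < b" "b \<le> D"
  shows "integral\<^sup>N lborel (riesz {b..<D} 0 :: 'a::euclidean_space \<Rightarrow> _) = ennreal (sphere_area TYPE('a) * ln (D / b))"
  using nn_integral_radial_annulus[OF assms, where 'a='a]
  unfolding riesz_def[abs_def] by (simp add: mult.commute)

lemma riesz_Un:
  "S \<inter> T = {} \<Longrightarrow> riesz (S \<union> T) a w = riesz S a w + riesz T a w"
  by (auto simp: riesz_def split: split_indicator)

lemma gagliardo_eq_riesz:
  fixes u :: "'a::euclidean_space \<Rightarrow> real"
  shows "ennreal (gagliardo_quotient s p u x y)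
    = riesz UNIV (s * p) (x - y) * ennreal (\<bar>u x - u y\<bar> powr p)"
proof -
  have "gagliardo_quotient s p u x y
      = norm (x - y) powr (- (real DIM('a) + s * p)) * \<bar>u x - u y\<bar> powr p"
    unfolding gagliardo_quotient_def powr_minus by (simp add: divide_inverse mult.commute)
  also have "- (real DIM('a) + s * p) = - real DIM('a) - s * p" by simp
  finally have "gagliardo_quotient s p u x y
      = norm (x - y) powr (- real DIM('a) - s * p) * \<bar>u x - u y\<bar> powr p" .
  then show ?thesis
    by (simp add: riesz_def ennreal_mult')
qed

lemma nn_integral_gagliardo:
  fixes u :: "'a::euclidean_space \<Rightarrow> real"
  assumes [measurable]: "u \<in> borel_measurable borel"
  shows "(\<integral>\<^sup>+ (x, y). ennreal (gagliardo_quotient s p u x y) \<partial>(lborel \<Otimes>\<^sub>M lborel))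
      = interaction (riesz UNIV (s * p)) p u"
  unfolding gagliardo_eq_riesz by (subst interaction_pair) (auto simp: case_prod_unfold)

lemma interaction_riesz_split:
  assumes [measurable]: "u \<in> borel_measurable borel"
    and "vanishes_outside \<Omega> (u::'a::euclidean_space \<Rightarrow> real)" and "\<And>x y. x \<in> \<Omega> \<Longrightarrow> y \<in> \<Omega> \<Longrightarrow> norm (x - y) < D"
    and "0 < a" "0 < D"
  shows "interaction (riesz UNIV a) p u = interaction (riesz {..<D} a) p u
     + ennreal (2 * (sphere_area TYPE('a) * D powr - a / a)) * mass p u"
proof -
  have *: "riesz UNIV a = (\<lambda>w::'a. riesz {..<D} a w + riesz {D..} a w)"
    by (subst riesz_Un[symmetric]) (auto intro!: ext arg_cong2[where f="\<lambda>S w. riesz S a w"])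
  have "interaction (riesz {D..} a) p u = 2 * (integral\<^sup>N lborel (riesz {D..} a :: 'a \<Rightarrow> _) * mass p u)"
    by (rule interaction_far[OF _ _ assms(2,3)]) (auto simp: riesz_def[abs_def])
  also have "\<dots> = ennreal (2 * (sphere_area TYPE('a) * D powr - a / a)) * mass p u"
    by (simp only: nn_integral_riesz_exterior[OF assms(4,5)] ennreal_mult'[of 2] ennreal_numeral mult.assoc)
  finally have "interaction (riesz {D..} a) p u = \<dots>" .
  then show ?thesis unfolding * by (subst interaction_add) auto
qed

lemma interaction_riesz_annulus:
  assumes [measurable]: "u \<in> borel_measurable borel" and "0 < b" "b \<le> D" "0 \<le> p" "mass p (u::'a::euclidean_space \<Rightarrow> real) < \<infinity>"
  shows "interaction (riesz {b..<D} 0) p u < \<infinity>"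
proof -
  have "interaction (riesz {b..<D} 0) p u \<le> ennreal (2 * 2 powr p) * (integral\<^sup>N lborel (riesz {b..<D} 0::'a \<Rightarrow> _) * mass p u)"
    by (rule interaction_le_mass) (use assms in auto)
  moreover have "ennreal (2 * 2 powr p) * (integral\<^sup>N lborel (riesz {b..<D} 0::'a \<Rightarrow> _) * mass p u) < \<infinity>"
    unfolding nn_integral_riesz_annulus[OF assms(2,3)] infinity_ennreal_def ennreal_mult_less_top
    using assms(5) by (metis ennreal_less_top infinity_ennreal_def)
  ultimately show ?thesis by (rule le_less_trans)
qed

lemma interaction_riesz_extend:
  assumes [measurable]: "u \<in> borel_measurable borel" and "0 < b" "b \<le> D"
  shows "interaction (riesz {..<D} 0) p u = interaction (riesz {..<b} 0) p u + interaction (riesz {b..<D} 0) p u"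
proof -
  have *: "riesz {..<D} 0 = (\<lambda>w::'a. riesz {..<b} 0 w + riesz {b..<D} 0 w)"
    using assms by (subst riesz_Un[symmetric]) (auto intro!: ext arg_cong2[where f="\<lambda>S w. riesz S 0 w"])
  show ?thesis unfolding * by (subst interaction_add) auto
qed

lemma Lp_fun_iff: "Lp_fun p u \<longleftrightarrow> u \<in> borel_measurable borel \<and> mass p u < \<infinity>"
  unfolding Lp_fun_def mass_def by (auto simp: integrable_iff_bounded)

lemma mass_eq_integral:
  "Lp_fun p u \<Longrightarrow> (LINT x|lborel. \<bar>u x\<bar> powr p) = enn2real (mass p u)"
  unfolding mass_def Lp_fun_def by (subst integral_eq_nn_integral) auto

lemma W0_frac_iff:
  fixes u :: "'a::euclidean_space \<Rightarrow> real"
  assumes "\<And>x y. x \<in> \<Omega> \<Longrightarrow> y \<in> \<Omega> \<Longrightarrow> norm (x - y) < D" and "0 < s" "1 < p" "0 < D"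
  shows "u \<in> W0_frac s p \<Omega> \<longleftrightarrow> Lp_fun p u \<and> vanishes_outside \<Omega> u \<and> interaction (riesz {..<D} (s * p)) p u < \<infinity>"
  unfolding W0_frac_def W_frac_def
  using assms interaction_riesz_split[of u \<Omega> D "s * p" p]
  by (auto simp: Lp_fun_iff nn_integral_gagliardo ennreal_mult_less_top)

lemma E_frac_eq:
  fixes u :: "'a::euclidean_space \<Rightarrow> real"
  assumes diam: "\<And>x y. x \<in> \<Omega> \<Longrightarrow> y \<in> \<Omega> \<Longrightarrow> norm (x - y) < D" and "0 < s" "1 < p" "0 < D"
    and u: "u \<in> W0_frac s p \<Omega>"
  shows "E_frac s p u = C_frac DIM('a) s p / 2 * enn2real (interaction (riesz {..<D} (s * p)) p u)
     + C_frac DIM('a) s p * (sphere_area TYPE('a) * D powr - (s * p) / (s * p)) * enn2real (mass p u)"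
proof -
  have L: "Lp_fun p u" and v: "vanishes_outside \<Omega> u" and fin: "interaction (riesz {..<D} (s * p)) p u < \<infinity>"
    using u W0_frac_iff[of \<Omega> D s p u] assms by auto
  have [measurable]: "u \<in> borel_measurable borel" and m: "mass p u < \<infinity>"
    using L by (auto simp: Lp_fun_iff)
  have "integral\<^sup>L (lborel \<Otimes>\<^sub>M lborel) (\<lambda>(x, y). gagliardo_quotient s p u x y)
     = enn2real (\<integral>\<^sup>+ z. ennreal (case z of (x, y) \<Rightarrow> gagliardo_quotient s p u x y) \<partial>(lborel \<Otimes>\<^sub>M lborel))"
    by (rule integral_eq_nn_integral) (auto simp: gagliardo_quotient_def)
  also have "(\<integral>\<^sup>+ z. ennreal (case z of (x, y) \<Rightarrow> gagliardo_quotient s p u x y) \<partial>(lborel \<Otimes>\<^sub>M lborel))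
     = interaction (riesz UNIV (s * p)) p u"
    by (subst nn_integral_gagliardo[symmetric]) (auto simp: case_prod_unfold)
  also have "\<dots> = interaction (riesz {..<D} (s * p)) p u
     + ennreal (2 * (sphere_area TYPE('a) * D powr - (s * p) / (s * p))) * mass p u"
    using assms by (intro interaction_riesz_split[OF _ v diam]) auto
  also have "enn2real \<dots> = enn2real (interaction (riesz {..<D} (s * p)) p u)
     + 2 * (sphere_area TYPE('a) * D powr - (s * p) / (s * p)) * enn2real (mass p u)"
    using fin m assms sphere_area_pos[where 'a='a]
    by (subst enn2real_plus) (auto simp: ennreal_mult_less_top enn2real_mult)
  finally show ?thesis unfolding E_frac_def by (simp add: algebra_simps)
qed

lemma X0_log_iff:
  fixes u :: "'a::euclidean_space \<Rightarrow> real"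
  assumes "1 < p" "1 \<le> D"
  shows "u \<in> X0_log p \<Omega> \<longleftrightarrow> Lp_fun p u \<and> vanishes_outside \<Omega> u \<and> interaction (riesz {..<D} 0) p u < \<infinity>"
proof -
  have "(\<integral>\<^sup>+ x. (\<integral>\<^sup>+ y \<in> ball x 1. ennreal (\<bar>u x - u y\<bar> powr p / norm (x - y) ^ DIM('a)) \<partial>lborel) \<partial>lborel)
      = interaction (riesz {..<1} 0) p u"
    unfolding interaction_def
  proof (intro nn_integral_cong)
    fix x y :: 'a
    show "ennreal (\<bar>u x - u y\<bar> powr p / norm (x - y) ^ DIM('a)) * indicator (ball x 1) y
      = riesz {..<1} 0 (x - y) * ennreal (\<bar>u x - u y\<bar> powr p)"
      by (cases "x = y") (auto simp: riesz_def dist_norm powr_minus powr_realpow divide_inverse ennreal_mult' mult_ac split: split_indicator)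
  qed
  then show ?thesis
    using interaction_riesz_extend[of u 1 D p] interaction_riesz_annulus[of u 1 D p] assms
    by (auto simp: X0_log_def Lp_fun_iff)
qed

text \<open>
  Passing from the radius \<open>1\<close> in the definition of \<open>E_log\<close> to the radius \<open>D\<close> moves the mass terms
  \<open>\<bar>u x\<bar>\<^sup>p + \<bar>u y\<bar>\<^sup>p\<close> over the annulus \<open>1 \<le> \<bar>x - y\<bar> < D\<close> into the coefficient of \<open>m(u)\<close>, and leaves nothing
  beyond \<open>D\<close>.  What remains is a nonnegative interaction and a multiple of \<open>m(u)\<close>.
\<close>
lemma E_log_eq:
  fixes u :: "'a::euclidean_space \<Rightarrow> real"
  assumes [measurable]: "\<Omega> \<in> sets borel"
    and diam: "\<And>x y. x \<in> \<Omega> \<Longrightarrow> y \<in> \<Omega> \<Longrightarrow> norm (x - y) < D" and p: "1 < p" and D: "1 \<le> D"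
    and u: "u \<in> X0_log p \<Omega>"
  shows "E_log p u = C_log DIM('a) p / 2 * enn2real (interaction (riesz {..<D} 0) p u)
     + (rho_log DIM('a) p - C_log DIM('a) p * sphere_area TYPE('a) * ln D) * enn2real (mass p u)"
proof -
  have L: "Lp_fun p u" and v: "vanishes_outside \<Omega> u" and fin: "interaction (riesz {..<D} 0) p u < \<infinity>"
    using u X0_log_iff[of p D u \<Omega>] assms by auto
  have [measurable]: "u \<in> borel_measurable borel" and m: "mass p u < \<infinity>"
    using L by (auto simp: Lp_fun_iff)
  let ?P = "lborel \<Otimes>\<^sub>M lborel :: ('a \<times> 'a) measure"
  have split: "interaction (riesz {..<D} 0) p u = interaction (riesz {..<1} 0) p u + interaction (riesz {1..<D} 0) p u"
    using D by (intro interaction_riesz_extend) auto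
  have fin1: "interaction (riesz {..<1} 0) p u < \<infinity>" and fin2: "interaction (riesz {1..<D} 0) p u < \<infinity>"
    using fin unfolding split by auto
  have near: "(LINT z:{(x, y). norm (x - y) < 1}|?P. case z of (x, y) \<Rightarrow>
          \<bar>u x - u y\<bar> powr p / norm (x - y) ^ DIM('a)) = enn2real (interaction (riesz {..<1} 0) p u)"
  proof -
    have "(LINT z:{(x, y). norm (x - y) < 1}|?P. case z of (x, y) \<Rightarrow>
          \<bar>u x - u y\<bar> powr p / norm (x - y) ^ DIM('a))
       = enn2real (\<integral>\<^sup>+ z. ennreal (indicator {(x, y). norm (x - y) < 1} z *\<^sub>R (case z of (x, y) \<Rightarrow>
          \<bar>u x - u y\<bar> powr p / norm (x - y) ^ DIM('a))) \<partial>?P)"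
      unfolding set_lebesgue_integral_def
      by (rule integral_eq_nn_integral) (auto simp: indicator_def)
    also have "(\<integral>\<^sup>+ z. ennreal (indicator {(x, y). norm (x - y) < 1} z *\<^sub>R (case z of (x, y) \<Rightarrow>
          \<bar>u x - u y\<bar> powr p / norm (x - y) ^ DIM('a))) \<partial>?P) = interaction (riesz {..<1} 0) p u"
      apply (subst interaction_pair, measurable)
      apply (intro nn_integral_cong)
      subgoal for z
        by (cases z; cases "fst z = snd z")
          (auto simp: riesz_def powr_minus powr_realpow divide_inverse ennreal_mult' mult_ac split: split_indicator)
      done
    finally show ?thesis .
  qed
  define h where "h w = indicator {1..<D} (norm w) * norm w powr - real DIM('a)" for w :: 'a
  have [measurable]: "h \<in> borel_measurable borel" unfolding h_def by measurable
  have h0: "h w \<ge> 0" for w by (simp add: h_def)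
  have riesz_h: "riesz {1..<D} 0 w = ennreal (h w)" for w :: 'a
    by (simp add: riesz_def h_def split: split_indicator)
  have int_h: "integral\<^sup>N lborel (\<lambda>w::'a. ennreal (h w)) = ennreal (sphere_area TYPE('a) * ln D)"
    using nn_integral_riesz_annulus[of 1 D, where 'a='a] D unfolding riesz_h[abs_def] by simp
  define f1 f2 f3 where "f1 z = h (fst z - snd z) * \<bar>u (fst z) - u (snd z)\<bar> powr p"
    and "f2 z = h (fst z - snd z) * \<bar>u (fst z)\<bar> powr p"
    and "f3 z = h (fst z - snd z) * \<bar>u (snd z)\<bar> powr p" for z
  have [measurable]: "f1 \<in> borel_measurable ?P" "f2 \<in> borel_measurable ?P" "f3 \<in> borel_measurable ?P"
    unfolding f1_def f2_def f3_def by measurable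
  have nn1: "(\<integral>\<^sup>+ z. ennreal (f1 z) \<partial>?P) = interaction (riesz {1..<D} 0) p u"
    by (subst interaction_pair) (auto simp: f1_def riesz_h ennreal_mult' h0)
  have nn2: "(\<integral>\<^sup>+ z. ennreal (f2 z) \<partial>?P) = ennreal (sphere_area TYPE('a) * ln D) * mass p u"
    using nn_integral_convolution_fst[of "\<lambda>w. ennreal (h w)" "\<lambda>x. ennreal (\<bar>u x\<bar> powr p)"]
    by (subst lborel.nn_integral_fst[symmetric]) (auto simp: f2_def ennreal_mult' h0 int_h mass_def)
  have nn3: "(\<integral>\<^sup>+ z. ennreal (f3 z) \<partial>?P) = ennreal (sphere_area TYPE('a) * ln D) * mass p u"
    using nn_integral_convolution_snd[of "\<lambda>w. ennreal (h w)" "\<lambda>x. ennreal (\<bar>u x\<bar> powr p)"]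
    by (subst lborel.nn_integral_fst[symmetric]) (auto simp: f3_def ennreal_mult' h0 int_h mass_def)
  have i1: "has_bochner_integral ?P f1 (enn2real (interaction (riesz {1..<D} 0) p u))"
    using fin2 nn1 by (intro has_bochner_integral_nn_integral) (auto simp: f1_def h0)
  have area: "sphere_area TYPE('a) * ln D \<ge> 0"
    using D sphere_area_pos[where 'a='a] by simp
  have mm: "ennreal (sphere_area TYPE('a) * ln D) * mass p u = ennreal (sphere_area TYPE('a) * ln D * enn2real (mass p u))"
    using m area by (simp add: ennreal_mult)
  have i2: "has_bochner_integral ?P f2 (sphere_area TYPE('a) * ln D * enn2real (mass p u))"
    using nn2 area unfolding mm by (intro has_bochner_integral_nn_integral) (auto simp: f2_def h0)
  have i3: "has_bochner_integral ?P f3 (sphere_area TYPE('a) * ln D * enn2real (mass p u))"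
    using nn3 area unfolding mm by (intro has_bochner_integral_nn_integral) (auto simp: f3_def h0)
  have AE0: "AE z in ?P. (fst z \<notin> \<Omega> \<longrightarrow> u (fst z) = 0) \<and> (snd z \<notin> \<Omega> \<longrightarrow> u (snd z) = 0)"
  proof -
    have *: "AE x in lborel. x \<notin> \<Omega> \<longrightarrow> u x = 0" using v by (simp add: vanishes_outside_def)
    have "AE z in ?P. fst z \<notin> \<Omega> \<longrightarrow> u (fst z) = 0"
    proof (rule lborel_pair.AE_pair_measure)
      show "{z \<in> space ?P. fst z \<notin> \<Omega> \<longrightarrow> u (fst z) = 0} \<in> sets ?P" by measurable
    qed (use * in auto)
    moreover have "AE z in ?P. snd z \<notin> \<Omega> \<longrightarrow> u (snd z) = 0"
    proof (rule lborel_pair.AE_pair_measure)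
      show "{z \<in> space ?P. snd z \<notin> \<Omega> \<longrightarrow> u (snd z) = 0} \<in> sets ?P" by measurable
    qed (use * in auto)
    ultimately show ?thesis by auto
  qed
  have "(LINT z:{(x, y). norm (x - y) \<ge> 1}|?P. case z of (x, y) \<Rightarrow>
          (\<bar>u x - u y\<bar> powr p - \<bar>u x\<bar> powr p - \<bar>u y\<bar> powr p) / norm (x - y) ^ DIM('a))
     = (LINT z|?P. f1 z - f2 z - f3 z)"
    unfolding set_lebesgue_integral_def
  proof (intro integral_cong_AE)
    show "AE z in ?P. indicator {(x, y). norm (x - y) \<ge> 1} z *\<^sub>R (case z of (x, y) \<Rightarrow>
          (\<bar>u x - u y\<bar> powr p - \<bar>u x\<bar> powr p - \<bar>u y\<bar> powr p) / norm (x - y) ^ DIM('a)) = f1 z - f2 z - f3 z"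
      using AE0
    proof eventually_elim
      case (elim z)
      obtain x y where z: "z = (x, y)" by (cases z)
      show ?case
      proof (cases "norm (x - y) < D")
        case True
        then show ?thesis unfolding z f1_def f2_def f3_def h_def
          by (cases "x = y") (auto simp: powr_minus powr_realpow field_simps split: split_indicator)
      next
        case False
        then have "u x = 0 \<or> u y = 0" using elim diam[of x y] by (auto simp: z)
        then show ?thesis using False unfolding z f1_def f2_def f3_def h_def by auto
      qed
    qed
  qed auto
  also have "\<dots> = enn2real (interaction (riesz {1..<D} 0) p u) - sphere_area TYPE('a) * ln D * enn2real (mass p u)
       - sphere_area TYPE('a) * ln D * enn2real (mass p u)"
    by (intro has_bochner_integral_integral_eq has_bochner_integral_diff i1 i2 i3)
  finally have far: "(LINT z:{(x, y). norm (x - y) \<ge> 1}|?P. case z of (x, y) \<Rightarrow>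
          (\<bar>u x - u y\<bar> powr p - \<bar>u x\<bar> powr p - \<bar>u y\<bar> powr p) / norm (x - y) ^ DIM('a))
     = enn2real (interaction (riesz {1..<D} 0) p u) - 2 * sphere_area TYPE('a) * ln D * enn2real (mass p u)"
    by simp
  have "enn2real (interaction (riesz {..<D} 0) p u) = enn2real (interaction (riesz {..<1} 0) p u)
     + enn2real (interaction (riesz {1..<D} 0) p u)"
    unfolding split using fin1 fin2 by (intro enn2real_plus) auto
  then show ?thesis
    unfolding E_log_def near far mass_eq_integral[OF L] by (simp add: algebra_simps)
qed

section \<open>Reduction of both eigenvalues to the near energy\<close>

lemma half_DIM_not_nonpos_Int: "real DIM('a::euclidean_space) / 2 \<notin> \<int>\<^sub>\<le>\<^sub>0"
  by (auto dest: nonpos_Ints_nonpos)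

lemma sphere_area_eq: "sphere_area TYPE('a::euclidean_space) = 2 * pi powr (real DIM('a) / 2) / Gamma (real DIM('a) / 2)"
proof -
  have *: "Gamma (real DIM('a) / 2 + 1) = real DIM('a) / 2 * Gamma (real DIM('a) / 2)"
    by (intro Gamma_plus1 half_DIM_not_nonpos_Int)
  have "Gamma (real DIM('a) / 2) > 0" by (intro Gamma_real_pos) auto
  then show ?thesis
    unfolding sphere_area_def unit_ball_vol_def * by (simp add: field_simps)
qed

lemma C_log_pos: "1 < p \<Longrightarrow> 0 < N \<Longrightarrow> C_log N p > 0"
  unfolding C_log_def by (intro divide_pos_pos mult_pos_pos Gamma_real_pos) auto

lemma C_log_sphere_area: "C_log DIM('a::euclidean_space) p * sphere_area TYPE('a) = p"
proof -
  have "Gamma (real DIM('a) / 2) > 0" by (intro Gamma_real_pos) auto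
  then have "Gamma (real DIM('a) / 2) \<noteq> 0" by linarith
  then show ?thesis by (simp add: C_log_def sphere_area_eq)
qed

lemma C_frac_nonneg:
  assumes "0 < s" "s < 1" "1 < p" shows "0 \<le> C_frac N s p"
proof -
  have g: "0 < s * p" using assms by simp
  have 1: "Gamma ((real N + s * p) / 2) > 0" using g by (intro Gamma_real_pos) (simp add: add_nonneg_pos)
  have 2: "Gamma (1 - s) > 0" "Gamma ((p + 1) / 2) > 0" using assms by (auto intro!: Gamma_real_pos)
  show ?thesis unfolding C_frac_def using 1 2 assms by auto
qed

lemma tendsto_C_frac:
  assumes "1 < p" "0 < N"
  shows "((\<lambda>s. C_frac N s p / s) \<longlongrightarrow> C_log N p) (at_right 0)"
proof -
  let ?f = "\<lambda>s. p * 2 powr (2 * s - 1) * Gamma ((real N + s * p) / 2) / (pi powr (real N / 2) * Gamma (1 - s))"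
  have "(?f \<longlongrightarrow> p * 2 powr (2 * 0 - 1) * Gamma ((real N + 0 * p) / 2) / (pi powr (real N / 2) * Gamma (1 - 0))) (at_right 0)"
    using assms by (intro tendsto_intros) (auto elim!: nonpos_Ints_cases)
  also have "p * 2 powr (2 * 0 - 1) * Gamma ((real N + 0 * p) / 2) / (pi powr (real N / 2) * Gamma (1 - 0)) = C_log N p"
    by (simp add: C_log_def powr_minus field_simps)
  finally have "(?f \<longlongrightarrow> C_log N p) (at_right 0)" .
  moreover have "eventually (\<lambda>s::real. s \<in> {0<..<1/2}) (at_right 0)"
    by (rule eventually_at_right_real) simp
  then have "eventually (\<lambda>s. ?f s = C_frac N s p / s) (at_right 0)"
    by eventually_elim (auto simp: C_frac_def)
  ultimately show ?thesis by (rule Lim_transform_eventually)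
qed

text \<open>
  By the values of \<open>C_frac\<close> and of the sphere area, the expression is the difference quotient at \<open>0\<close> of
  \<open>R s = 4\<^sup>s \<Gamma>((N + sp) / 2) / (\<Gamma>(N / 2) \<Gamma>(1 - s)) D\<^bsup>-sp\<^esup>\<close>, for which \<open>R 0 = 1\<close>.
\<close>
lemma tendsto_far_coefficient:
  assumes "1 < p" "1 \<le> D"
  shows "((\<lambda>s. (C_frac DIM('a) s p * (sphere_area TYPE('a::euclidean_space) * D powr - (s * p) / (s * p)) - 1) / s)
     \<longlongrightarrow> rho_log DIM('a) p - p * ln D) (at_right 0)"
proof -
  let ?N = "real DIM('a)"
  define R where "R s = 2 powr (2 * s) * Gamma ((?N + s * p) / 2) / (Gamma (?N / 2) * Gamma (1 - s)) * D powr - (s * p)" for s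
  have g: "Gamma (?N / 2) > 0" by (intro Gamma_real_pos) auto
  then have g0: "Gamma (?N / 2) \<noteq> 0" by linarith
  have np: "?N / 2 \<notin> \<int>\<^sub>\<le>\<^sub>0" "(1::real) \<notin> \<int>\<^sub>\<le>\<^sub>0"
    using half_DIM_not_nonpos_Int by (auto dest: nonpos_Ints_nonpos)
  have "(R has_field_derivative rho_log DIM('a) p - p * ln D) (at 0)"
  proof -
    have 2: "((\<lambda>s. Gamma ((?N + s * p) / 2)) has_field_derivative Gamma (?N / 2) * Digamma (?N / 2) * (p / 2)) (at 0)"
      using np by (auto intro!: derivative_eq_intros)
    have 3: "((\<lambda>s. Gamma (?N / 2) * Gamma (1 - s)) has_field_derivative Gamma (?N / 2) * euler_mascheroni) (at 0)"
      using np by (auto intro!: derivative_eq_intros simp: Digamma_1)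
    have 1: "((\<lambda>s. 2 powr (2 * s)) has_field_derivative 2 * ln 2) (at (0::real))"
      by (auto intro!: derivative_eq_intros)
    have 4: "((\<lambda>s. D powr - (s * p)) has_field_derivative - (p * ln D)) (at 0)"
      using assms by (auto intro!: derivative_eq_intros)
    show ?thesis unfolding R_def[abs_def] rho_log_def
      by (intro DERIV_cong[OF DERIV_mult[OF DERIV_divide[OF DERIV_mult[OF 1 2] 3] 4]])
         (use g0 assms in \<open>simp_all add: field_simps\<close>)
  qed
  then have "((\<lambda>s. (R s - R 0) / (s - 0)) \<longlongrightarrow> rho_log DIM('a) p - p * ln D) (at 0)"
    by (simp only: has_field_derivative_iff diff_0_right)
  then have "((\<lambda>s. (R s - R 0) / (s - 0)) \<longlongrightarrow> rho_log DIM('a) p - p * ln D) (at_right 0)"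
    by (rule filterlim_mono) (auto simp: at_le)
  moreover have "eventually (\<lambda>s::real. s \<in> {0<..<1/2}) (at_right 0)"
    by (rule eventually_at_right_real) simp
  then have "eventually (\<lambda>s. (R s - R 0) / (s - 0)
      = (C_frac DIM('a) s p * (sphere_area TYPE('a) * D powr - (s * p) / (s * p)) - 1) / s) (at_right 0)"
  proof eventually_elim
    case (elim s)
    have "R 0 = 1" using g0 assms by (simp add: R_def)
    moreover have "R s = C_frac DIM('a) s p * (sphere_area TYPE('a) * D powr - (s * p) / (s * p))"
      using elim g0 assms
      by (simp add: R_def C_frac_def sphere_area_eq powr_diff field_simps)
    ultimately show ?case by simp
  qed
  ultimately show ?thesis by (rule Lim_transform_eventually)
qed

lemma riesz_ge:
  assumes "0 \<le> a" "0 < D"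
  shows "ennreal (D powr - a) * riesz {..<D} 0 w \<le> riesz {..<D} a (w::'a::euclidean_space)"
proof (cases "w = 0 \<or> norm w \<ge> D")
  case False
  then have w: "0 < norm w" "norm w < D" by auto
  have "D powr - a \<le> norm w powr - a"
    using w assms by (intro powr_mono2') auto
  then have "D powr - a * norm w powr - real DIM('a) \<le> norm w powr - a * norm w powr - real DIM('a)"
    by (rule mult_right_mono) auto
  also have "\<dots> = norm w powr (- real DIM('a) - a)" by (simp add: powr_add[symmetric] minus_diff_commute)
  finally show ?thesis using w by (simp add: riesz_def ennreal_mult'[symmetric])
qed (auto simp: riesz_def)

lemma interaction_scale:
  assumes [measurable]: "k \<in> borel_measurable borel" "u \<in> borel_measurable borel" and "0 < c"
  shows "interaction k p (\<lambda>x. c * u x) = ennreal (c powr p) * interaction k p u"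
proof -
  have "\<bar>c * u x - c * u y\<bar> powr p = c powr p * \<bar>u x - u y\<bar> powr p" for x y
    using assms by (simp add: right_diff_distrib[symmetric] abs_mult powr_mult)
  then show ?thesis unfolding interaction_def
    by (simp add: ennreal_mult' mult.left_commute nn_integral_cmult)
qed

lemma mass_scale:
  assumes [measurable]: "u \<in> borel_measurable borel" and "0 < c"
  shows "mass p (\<lambda>x. c * u x) = ennreal (c powr p) * mass p u"
  using assms(2) unfolding mass_def
  by (simp add: ennreal_mult' nn_integral_cmult abs_mult powr_mult)

text \<open>
  The auxiliary radius \<open>D\<close> separates the pairs of points that may both lie in \<open>\<Omega>\<close> from those that cannot; it
  enters the energies below, but neither of the two eigenvalues.
\<close>
locale bounded_domain =
  fixes \<Omega> :: "'a::euclidean_space set" and p D :: real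
  assumes open_domain: "open \<Omega>" and nonempty: "\<Omega> \<noteq> {}" and p_gt_1: "1 < p" and D_ge_1: "1 \<le> D"
    and diam: "\<And>x y. x \<in> \<Omega> \<Longrightarrow> y \<in> \<Omega> \<Longrightarrow> norm (x - y) < D"
begin

definition near_energy :: "real \<Rightarrow> ('a \<Rightarrow> real) \<Rightarrow> ennreal" where
  "near_energy s u = interaction (riesz {..<D} (s * p)) p u"

lemma domain_measurable [measurable]: "\<Omega> \<in> sets borel"
  using open_domain by auto

lemma domain_bounded: "bounded \<Omega>"
proof -
  obtain x where "x \<in> \<Omega>" using nonempty by auto
  then have "\<Omega> \<subseteq> ball x D" using diam by (auto simp: dist_norm)
  then show ?thesis using bounded_subset[OF bounded_ball] by blast
qed

lemma emeasure_domain: "emeasure lborel \<Omega> < \<infinity>"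
  using domain_bounded emeasure_bounded_finite by blast

lemma Lp_norm_eq:
  assumes "Lp_fun p u" "vanishes_outside \<Omega> u"
  shows "Lp_norm p \<Omega> u = enn2real (mass p u) powr (1 / p)"
proof -
  have [measurable]: "u \<in> borel_measurable borel" using assms by (auto simp: Lp_fun_iff)
  have "(LINT x:\<Omega>|lborel. \<bar>u x\<bar> powr p) = (LINT x|lborel. \<bar>u x\<bar> powr p)"
    unfolding set_lebesgue_integral_def
    by (intro integral_cong_AE, measurable, use assms(2)[unfolded vanishes_outside_def] in eventually_elim)
       (auto split: split_indicator)
  then show ?thesis unfolding Lp_norm_def mass_eq_integral[OF assms(1)] by simp
qed

lemma Lp_norm_eq_1_iff:
  assumes "Lp_fun p u" "vanishes_outside \<Omega> u"
  shows "Lp_norm p \<Omega> u = 1 \<longleftrightarrow> mass p u = 1"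
proof -
  have fin: "mass p u < \<infinity>" using assms by (auto simp: Lp_fun_iff)
  note * = Lp_norm_eq[OF assms]
  have "Lp_norm p \<Omega> u = 1 \<longleftrightarrow> enn2real (mass p u) = 1"
  proof
    assume "Lp_norm p \<Omega> u = 1"
    then have "(enn2real (mass p u) powr (1 / p)) powr p = 1" using * by simp
    then show "enn2real (mass p u) = 1" using p_gt_1 by (simp add: powr_powr)
  qed (simp add: *)
  also have "\<dots> \<longleftrightarrow> mass p u = 1"
    using fin by (cases "mass p u") (auto simp: ennreal_eq_1)
  finally show ?thesis .
qed

definition unit_X0 :: "('a \<Rightarrow> real) set" where
  "unit_X0 = {u \<in> X0_log p \<Omega>. Lp_norm p \<Omega> u = 1}"

definition unit_W0 :: "real \<Rightarrow> ('a \<Rightarrow> real) set" where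
  "unit_W0 s = {u \<in> W0_frac s p \<Omega>. Lp_norm p \<Omega> u = 1}"

lemma unit_X0_iff:
  "u \<in> unit_X0 \<longleftrightarrow> u \<in> borel_measurable borel \<and> vanishes_outside \<Omega> u \<and> mass p u = 1 \<and> near_energy 0 u < \<infinity>"
  unfolding unit_X0_def using X0_log_iff[of p D u \<Omega>] p_gt_1 D_ge_1 Lp_norm_eq_1_iff[of u]
  by (auto simp: near_energy_def Lp_fun_iff)

lemma unit_W0_iff:
  assumes "0 < s"
  shows "u \<in> unit_W0 s \<longleftrightarrow> u \<in> borel_measurable borel \<and> vanishes_outside \<Omega> u \<and> mass p u = 1 \<and> near_energy s u < \<infinity>"
  unfolding unit_W0_def using W0_frac_iff[of \<Omega> D s p u] diam assms p_gt_1 D_ge_1 Lp_norm_eq_1_iff[of u]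
  by (auto simp: near_energy_def Lp_fun_iff)

definition rho_D :: real where
  "rho_D = rho_log DIM('a) p - p * ln D"

text \<open>
  The coefficient of \<open>m(u)\<close> in \<open>(E_frac s p u - 1) / s\<close> for \<open>m(u) = 1\<close>, where the \<open>-1\<close> is attributed to the mass.
\<close>
definition far_rate :: "real \<Rightarrow> real" where
  "far_rate s = (C_frac DIM('a) s p * (sphere_area TYPE('a) * D powr - (s * p) / (s * p)) - 1) / s"

lemma E_log_unit:
  assumes "u \<in> unit_X0"
  shows "E_log p u = C_log DIM('a) p / 2 * enn2real (near_energy 0 u) + rho_D"
  using E_log_eq[of \<Omega> D p u] diam p_gt_1 D_ge_1 assms C_log_sphere_area[where 'a='a, of p] unit_X0_iff[of u]
  by (auto simp: unit_X0_def near_energy_def rho_D_def)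

lemma E_frac_unit:
  assumes "u \<in> unit_W0 s" "0 < s"
  shows "(E_frac s p u - 1) / s = C_frac DIM('a) s p / s / 2 * enn2real (near_energy s u) + far_rate s"
  using E_frac_eq[of \<Omega> D s p u] diam p_gt_1 D_ge_1 assms unit_W0_iff[of s u]
  by (auto simp: unit_W0_def near_energy_def far_rate_def field_simps)

lemma near_energy_ge:
  assumes [measurable]: "u \<in> borel_measurable borel" and "0 \<le> s"
  shows "ennreal (D powr - (s * p)) * near_energy 0 u \<le> near_energy s u"
proof -
  have "ennreal (D powr - (s * p)) * near_energy 0 u
     = interaction (\<lambda>w. ennreal (D powr - (s * p)) * riesz {..<D} 0 w) p u"
    unfolding near_energy_def by (subst interaction_cmult) auto
  also have "\<dots> \<le> near_energy s u"
    unfolding near_energy_def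
    by (intro interaction_mono riesz_ge) (use assms p_gt_1 D_ge_1 in auto)
  finally show ?thesis .
qed

lemma unit_W0_subset: "0 < s \<Longrightarrow> unit_W0 s \<subseteq> unit_X0"
proof
  fix u assume s: "0 < s" and u: "u \<in> unit_W0 s"
  then have [measurable]: "u \<in> borel_measurable borel" and fin: "near_energy s u < \<infinity>"
    by (auto simp: unit_W0_iff)
  have "ennreal (D powr - (s * p)) * near_energy 0 u < \<infinity>"
    using near_energy_ge[of u s] s fin by (auto intro: le_less_trans)
  then have "near_energy 0 u < \<infinity>"
    using D_ge_1 by (auto simp: ennreal_mult_less_top)
  then show "u \<in> unit_X0" using u s by (auto simp: unit_X0_iff unit_W0_iff)
qed

text \<open>
  The factor by which \<open>(E_frac s p u - 1) / s\<close> dominates \<open>E_log p u\<close> up to additive constants; it tends to \<open>1\<close>.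
\<close>
definition compare :: "real \<Rightarrow> real" where
  "compare s = C_frac DIM('a) s p / s / C_log DIM('a) p * D powr - (s * p)"

lemma compare_nonneg: "0 < s \<Longrightarrow> s < 1 \<Longrightarrow> 0 \<le> compare s"
  using C_frac_nonneg[of s p "DIM('a)"] C_log_pos[of p "DIM('a)"] p_gt_1 by (simp add: compare_def)

lemma tendsto_compare: "(compare \<longlongrightarrow> 1) (at_right 0)"
proof -
  have "((\<lambda>s. C_frac DIM('a) s p / s / C_log DIM('a) p * D powr - (s * p)) \<longlongrightarrow> C_log DIM('a) p / C_log DIM('a) p * D powr - (0 * p)) (at_right 0)"
    using p_gt_1 C_log_pos[of p "DIM('a)"] D_ge_1 by (intro tendsto_intros tendsto_C_frac) auto
  then show ?thesis
    using D_ge_1 C_log_pos[of p "DIM('a)"] p_gt_1 by (simp add: compare_def[abs_def])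
qed

lemma tendsto_far_rate: "(far_rate \<longlongrightarrow> rho_D) (at_right 0)"
  unfolding far_rate_def[abs_def] rho_D_def by (rule tendsto_far_coefficient[OF p_gt_1 D_ge_1])

lemma E_frac_ge_E_log:
  assumes "0 < s" "s < 1" and u: "u \<in> unit_W0 s"
  shows "compare s * (E_log p u - rho_D) + far_rate s \<le> (E_frac s p u - 1) / s"
proof -
  have uX: "u \<in> unit_X0" using unit_W0_subset assms by auto
  have [measurable]: "u \<in> borel_measurable borel" and fin: "near_energy s u < \<infinity>"
    using u assms by (auto simp: unit_W0_iff)
  have "D powr - (s * p) * enn2real (near_energy 0 u) \<le> enn2real (near_energy s u)"
    using enn2real_mono[OF near_energy_ge[of u s]] fin assms by (simp add: enn2real_mult)
  moreover have "0 \<le> C_frac DIM('a) s p / s / 2" using C_frac_nonneg[of s p "DIM('a)"] assms p_gt_1 by simp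
  ultimately have "C_frac DIM('a) s p / s / 2 * (D powr - (s * p) * enn2real (near_energy 0 u))
     \<le> C_frac DIM('a) s p / s / 2 * enn2real (near_energy s u)"
    by (rule mult_left_mono)
  moreover have "compare s * (E_log p u - rho_D) = C_frac DIM('a) s p / s / 2 * (D powr - (s * p) * enn2real (near_energy 0 u))"
    using C_log_pos[of p "DIM('a)"] p_gt_1 by (simp add: E_log_unit[OF uX] compare_def field_simps)
  ultimately show ?thesis using E_frac_unit[OF u] assms by simp
qed

lemma bdd_below_E_log: "bdd_below (E_log p ` unit_X0)"
  using C_log_pos[of p "DIM('a)"] p_gt_1 by (intro bdd_belowI2[of _ rho_D]) (simp add: E_log_unit)

lemma lambda_log_le: "u \<in> unit_X0 \<Longrightarrow> lambda_log p \<Omega> \<le> E_log p u"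
  unfolding lambda_log_def unit_X0_def[symmetric] by (intro cINF_lower bdd_below_E_log)

lemma bdd_below_E_frac: "0 < s \<Longrightarrow> s < 1 \<Longrightarrow> bdd_below (E_frac s p ` unit_W0 s)"
  using C_frac_nonneg[of s p "DIM('a)"] p_gt_1
  by (intro bdd_belowI2[of _ 0]) (auto simp: E_frac_def gagliardo_quotient_def intro!: mult_nonneg_nonneg integral_nonneg_AE)

lemma lambda_frac_le: "u \<in> unit_W0 s \<Longrightarrow> 0 < s \<Longrightarrow> s < 1 \<Longrightarrow> lambda_frac s p \<Omega> \<le> E_frac s p u"
  unfolding lambda_frac_def unit_W0_def[symmetric] by (intro cINF_lower bdd_below_E_frac)

text \<open>
  The comparison of the energies is uniform in \<open>u\<close> and hence passes to the infima.
\<close>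
lemma lambda_frac_ge:
  assumes "0 < s" "s < 1" "unit_W0 s \<noteq> {}"
  shows "compare s * (lambda_log p \<Omega> - rho_D) + far_rate s \<le> (lambda_frac s p \<Omega> - 1) / s"
proof -
  have "s * (compare s * (lambda_log p \<Omega> - rho_D) + far_rate s) + 1 \<le> lambda_frac s p \<Omega>"
    unfolding lambda_frac_def unit_W0_def[symmetric]
  proof (rule cINF_greatest[OF assms(3)])
    fix u assume u: "u \<in> unit_W0 s"
    then have "lambda_log p \<Omega> \<le> E_log p u" using unit_W0_subset assms by (intro lambda_log_le) auto
    then have "compare s * (lambda_log p \<Omega> - rho_D) + far_rate s \<le> compare s * (E_log p u - rho_D) + far_rate s"
      using compare_nonneg[of s] assms by (intro add_right_mono mult_left_mono) auto
    also have "\<dots> \<le> (E_frac s p u - 1) / s" by (rule E_frac_ge_E_log[OF assms(1,2) u])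
    finally show "s * (compare s * (lambda_log p \<Omega> - rho_D) + far_rate s) + 1 \<le> E_frac s p u"
      using assms by (simp add: field_simps)
  qed
  then show ?thesis using assms by (simp add: field_simps)
qed

end

section \<open>Lipschitz competitors\<close>

context bounded_domain
begin

definition lipschitz_core :: "('a \<Rightarrow> real) set" where
  "lipschitz_core = {v. (\<forall>x. x \<notin> \<Omega> \<longrightarrow> v x = 0) \<and> (\<exists>L \<ge> 0. \<forall>x y. \<bar>v x - v y\<bar> \<le> L * norm (x - y))}"

lemma lipschitz_core_measurable:
  assumes "v \<in> lipschitz_core" shows "v \<in> borel_measurable borel"
proof -
  obtain L where "L \<ge> 0" "\<And>x y. \<bar>v x - v y\<bar> \<le> L * norm (x - y)"
    using assms by (auto simp: lipschitz_core_def)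
  then have "L-lipschitz_on UNIV v" by (auto simp: lipschitz_on_def dist_norm)
  then show ?thesis
    by (intro borel_measurable_continuous_onI lipschitz_on_continuous_on)
qed

lemma lipschitz_core_mass:
  assumes "v \<in> lipschitz_core" shows "mass p v < \<infinity>"
proof -
  obtain L where L: "L \<ge> 0" "\<And>x y. \<bar>v x - v y\<bar> \<le> L * norm (x - y)" and v0: "\<And>x. x \<notin> \<Omega> \<Longrightarrow> v x = 0"
    using assms by (auto simp: lipschitz_core_def)
  obtain y where y: "y \<in> \<Omega>" using nonempty by auto
  define B where "B = (\<bar>v y\<bar> + L * D) powr p"
  have "mass p v \<le> (\<integral>\<^sup>+ x. ennreal B * indicator \<Omega> x \<partial>lborel)"
    unfolding mass_def
  proof (intro nn_integral_mono)
    fix x :: 'a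
    show "ennreal (\<bar>v x\<bar> powr p) \<le> ennreal B * indicator \<Omega> x"
    proof (cases "x \<in> \<Omega>")
      case True
      have "L * norm (x - y) \<le> L * D" using diam[OF True y] L by (intro mult_left_mono) auto
      then have "\<bar>v x\<bar> \<le> \<bar>v y\<bar> + L * D" using L(2)[of x y] by linarith
      then have "\<bar>v x\<bar> powr p \<le> B" unfolding B_def using p_gt_1 by (intro powr_mono2) auto
      then show ?thesis using True by (simp add: ennreal_leI)
    qed (use v0 in auto)
  qed
  also have "\<dots> < \<infinity>" using emeasure_domain by (simp add: nn_integral_cmult ennreal_mult_less_top)
  finally show ?thesis .
qed

text \<open>
  For \<open>s \<le> 1/2\<close> the integrand is at most a multiple of \<open>\<bar>x - y\<bar>\<^bsup>p/2-N\<^esup>\<close> on pairs that meet \<open>\<Omega>\<close>, because a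
  Lipschitz function gains the factor \<open>\<bar>x - y\<bar>\<^sup>p\<close> and the kernel loses at most \<open>\<bar>x - y\<bar>\<^bsup>-p/2\<^esup>\<close>.
\<close>
lemma near_energy_lipschitz:
  assumes v: "v \<in> lipschitz_core"
  shows "0 \<le> s \<Longrightarrow> s \<le> 1/2 \<Longrightarrow> near_energy s v < \<infinity>"
    and "((\<lambda>s. near_energy s v) \<longlongrightarrow> near_energy 0 v) (at_right 0)"
proof -
  have [measurable]: "v \<in> borel_measurable borel" using v by (rule lipschitz_core_measurable)
  obtain L where L: "L \<ge> 0" "\<And>x y. \<bar>v x - v y\<bar> \<le> L * norm (x - y)" and v0: "\<And>x. x \<notin> \<Omega> \<Longrightarrow> v x = 0"
    using v by (auto simp: lipschitz_core_def)
  define K where "K = L powr p * D powr (p / 2)"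
  define \<kappa> where "\<kappa> w = ennreal (norm w powr (p / 2 - real DIM('a))) * indicator {0<..<D} (norm w)" for w :: 'a
  have [measurable]: "\<kappa> \<in> borel_measurable borel" unfolding \<kappa>_def by measurable
  define h where "h z = ennreal K * (\<kappa> (fst z - snd z) * indicator \<Omega> (fst z) + \<kappa> (fst z - snd z) * indicator \<Omega> (snd z))" for z
  have [measurable]: "h \<in> borel_measurable (lborel \<Otimes>\<^sub>M lborel)" unfolding h_def by measurable
  have int_\<kappa>: "integral\<^sup>N lborel \<kappa> < \<infinity>"
    unfolding \<kappa>_def using nn_integral_radial_ball[of "p / 2" D, where 'a='a] p_gt_1 D_ge_1 by simp
  have "(\<integral>\<^sup>+ z. h z \<partial>(lborel \<Otimes>\<^sub>M lborel)) = ennreal K *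
      ((\<integral>\<^sup>+ x. \<integral>\<^sup>+ y. \<kappa> (x - y) * indicator \<Omega> x \<partial>lborel \<partial>lborel) + (\<integral>\<^sup>+ x. \<integral>\<^sup>+ y. \<kappa> (x - y) * indicator \<Omega> y \<partial>lborel \<partial>lborel))"
    by (subst lborel.nn_integral_fst[symmetric]) (auto simp: h_def nn_integral_cmult nn_integral_add)
  also have "\<dots> = ennreal K * (integral\<^sup>N lborel \<kappa> * emeasure lborel \<Omega> + integral\<^sup>N lborel \<kappa> * emeasure lborel \<Omega>)"
    by (subst nn_integral_convolution_fst, measurable, subst nn_integral_convolution_snd, measurable)
  also have "\<dots> < \<infinity>" using int_\<kappa> emeasure_domain by (simp add: ennreal_mult_less_top)
  finally have int_h: "(\<integral>\<^sup>+ z. h z \<partial>(lborel \<Otimes>\<^sub>M lborel)) < \<infinity>" .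
  have dom: "riesz {..<D} (s * p) (fst z - snd z) * ennreal (\<bar>v (fst z) - v (snd z)\<bar> powr p) \<le> h z"
    if s: "0 \<le> s" "s \<le> 1/2" for s z
  proof -
    obtain x y where z: "z = (x, y)" by (cases z)
    define r where "r = norm (x - y)"
    show ?thesis
    proof (cases "(x \<in> \<Omega> \<or> y \<in> \<Omega>) \<and> 0 < r \<and> r < D")
      case False
      then show ?thesis using v0 by (auto simp: z r_def riesz_def)
    next
      case True
      then have r: "0 < r" "r < D" by auto
      have sp: "s * p \<le> p / 2" using s p_gt_1 by (simp add: mult_right_mono[of s "1/2" p, simplified])
      have "r powr (p / 2 - s * p) \<le> D powr (p / 2 - s * p)"
        using r sp by (intro powr_mono2) auto
      also have "\<dots> \<le> D powr (p / 2)"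
        using D_ge_1 s p_gt_1 by (intro powr_mono) auto
      finally have 1: "r powr (p / 2 - s * p) \<le> D powr (p / 2)" .
      have "\<bar>v x - v y\<bar> powr p \<le> (L * r) powr p"
        using L p_gt_1 by (intro powr_mono2) (auto simp: r_def)
      then have "r powr (- real DIM('a) - s * p) * \<bar>v x - v y\<bar> powr p
         \<le> r powr (- real DIM('a) - s * p) * (L powr p * r powr p)"
        using L r by (intro mult_left_mono) (auto simp: powr_mult)
      also have "\<dots> = L powr p * (r powr (p / 2 - s * p) * r powr (p / 2 - real DIM('a)))"
        by (simp add: powr_add[symmetric] algebra_simps)
      also have "\<dots> \<le> L powr p * (D powr (p / 2) * r powr (p / 2 - real DIM('a)))"
        by (intro mult_left_mono mult_right_mono 1) auto
      finally have "ennreal (r powr (- real DIM('a) - s * p)) * ennreal (\<bar>v x - v y\<bar> powr p)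
         \<le> ennreal K * ennreal (r powr (p / 2 - real DIM('a)))"
        by (simp add: K_def ennreal_mult'[symmetric] mult.assoc ennreal_leI)
      also have "\<dots> \<le> h z"
        using True r by (auto simp: z h_def \<kappa>_def r_def[symmetric] intro!: mult_left_mono)
      finally show ?thesis using r by (simp add: z riesz_def r_def)
    qed
  qed
  show fin: "near_energy s v < \<infinity>" if "0 \<le> s" "s \<le> 1/2" for s
  proof -
    have "near_energy s v \<le> (\<integral>\<^sup>+ z. h z \<partial>(lborel \<Otimes>\<^sub>M lborel))"
      unfolding near_energy_def
      by (subst interaction_pair, measurable) (intro nn_integral_mono dom that)
    then show ?thesis using int_h by (rule le_less_trans)
  qed
  have "((\<lambda>s. near_energy s v) \<longlongrightarrow> near_energy 0 v) (at 0 within {0<..1/2})"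
    unfolding tendsto_at_iff_sequentially
  proof (intro allI impI)
    fix X :: "nat \<Rightarrow> real" assume X: "\<forall>i. X i \<in> {0<..1/2} - {0}" and lim: "X \<longlonglongrightarrow> 0"
    show "((\<lambda>s. near_energy s v) \<circ> X) \<longlonglongrightarrow> near_energy 0 v"
      unfolding near_energy_def comp_def
    proof (subst (1 2) interaction_pair; (measurable; fail)?)
      show "(\<lambda>i. \<integral>\<^sup>+ z. riesz {..<D} (X i * p) (fst z - snd z) * ennreal (\<bar>v (fst z) - v (snd z)\<bar> powr p) \<partial>(lborel \<Otimes>\<^sub>M lborel))
        \<longlonglongrightarrow> (\<integral>\<^sup>+ z. riesz {..<D} (0 * p) (fst z - snd z) * ennreal (\<bar>v (fst z) - v (snd z)\<bar> powr p) \<partial>(lborel \<Otimes>\<^sub>M lborel))"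
      proof (rule nn_integral_dominated_convergence[where w=h])
        show "AE z in lborel \<Otimes>\<^sub>M lborel. riesz {..<D} (X i * p) (fst z - snd z) * ennreal (\<bar>v (fst z) - v (snd z)\<bar> powr p) \<le> h z" for i
          using X[rule_format, of i] by (intro AE_I2 dom) auto
        show "AE z in lborel \<Otimes>\<^sub>M lborel. (\<lambda>i. riesz {..<D} (X i * p) (fst z - snd z) * ennreal (\<bar>v (fst z) - v (snd z)\<bar> powr p))
          \<longlonglongrightarrow> riesz {..<D} (0 * p) (fst z - snd z) * ennreal (\<bar>v (fst z) - v (snd z)\<bar> powr p)"
        proof (intro AE_I2)
          fix z :: "'a \<times> 'a"
          have "(\<lambda>i. norm (fst z - snd z) powr (- real DIM('a) - X i * p)) \<longlonglongrightarrow> norm (fst z - snd z) powr (- real DIM('a) - 0 * p)"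
            by (cases "fst z = snd z") (simp, intro tendsto_intros lim, auto)
          then have "(\<lambda>i. indicator {..<D} (norm (fst z - snd z)) * (ennreal (norm (fst z - snd z) powr (- real DIM('a) - X i * p)) * ennreal (\<bar>v (fst z) - v (snd z)\<bar> powr p)))
            \<longlonglongrightarrow> indicator {..<D} (norm (fst z - snd z)) * (ennreal (norm (fst z - snd z) powr (- real DIM('a) - 0 * p)) * ennreal (\<bar>v (fst z) - v (snd z)\<bar> powr p))"
            by (cases "norm (fst z - snd z) < D") (auto intro!: tendsto_intros simp: ennreal_mult'[symmetric])
          then show "(\<lambda>i. riesz {..<D} (X i * p) (fst z - snd z) * ennreal (\<bar>v (fst z) - v (snd z)\<bar> powr p))
            \<longlonglongrightarrow> riesz {..<D} (0 * p) (fst z - snd z) * ennreal (\<bar>v (fst z) - v (snd z)\<bar> powr p)"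
            by (simp add: riesz_def mult.assoc)
        qed
      qed (use int_h in \<open>auto\<close>)
    qed
  qed
  moreover have "at 0 within {0<..1/2} = at_right (0::real)"
    by (rule at_within_nhd[of _ "{..<1/2}"]) auto
  ultimately show "((\<lambda>s. near_energy s v) \<longlongrightarrow> near_energy 0 v) (at_right 0)" by simp
qed

lemma lipschitz_core_bump: "\<exists>v \<in> lipschitz_core. 0 < mass p v"
proof -
  obtain x0 where "x0 \<in> \<Omega>" using nonempty by auto
  then obtain r where r: "r > 0" "ball x0 r \<subseteq> \<Omega>" using open_domain openE by blast
  define v where "v x = max 0 (r - norm (x - x0))" for x
  have "v \<in> lipschitz_core"
  proof -
    have "v x = 0" if "x \<notin> \<Omega>" for x
      using that r by (force simp: v_def dist_norm norm_minus_commute)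
    moreover have "\<bar>v x - v y\<bar> \<le> 1 * norm (x - y)" for x y
      using norm_triangle_ineq3[of "x - x0" "y - x0"] by (auto simp: v_def max_def)
    ultimately show ?thesis unfolding lipschitz_core_def by (auto intro!: exI[of _ 1])
  qed
  moreover have "0 < mass p v"
  proof (rule ccontr)
    assume "\<not> 0 < mass p v"
    have [measurable]: "v \<in> borel_measurable borel" unfolding v_def[abs_def] by measurable
    have "mass p v = 0" using \<open>\<not> 0 < mass p v\<close> by simp
    then have "AE x in lborel. ennreal (\<bar>v x\<bar> powr p) = 0"
      unfolding mass_def by (subst (asm) nn_integral_0_iff_AE) auto
    then have "AE x in lborel. x \<notin> ball x0 r"
      by eventually_elim (auto simp: v_def dist_norm norm_minus_commute)
    then have "emeasure lborel (ball x0 r) = 0"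
      by (subst (asm) AE_iff_measurable[OF _ refl]) (auto simp: ball_def)
    then show False using r unit_ball_vol_pos[of "real DIM('a)"] by (simp add: emeasure_ball_real)
  qed
  ultimately show ?thesis by blast
qed

lemma normalize_lipschitz_core:
  assumes v: "v \<in> lipschitz_core" and m: "0 < mass p v"
  obtains c where "c > 0" "c powr p = 1 / enn2real (mass p v)"
    "\<And>s. 0 < s \<Longrightarrow> s \<le> 1/2 \<Longrightarrow> (\<lambda>x. c * v x) \<in> unit_W0 s"
    "\<And>s. near_energy s (\<lambda>x. c * v x) = ennreal (c powr p) * near_energy s v"
proof -
  define M where "M = enn2real (mass p v)"
  have M: "M > 0" "mass p v = ennreal M"
    using m lipschitz_core_mass[OF v] by (auto simp: M_def enn2real_positive_iff)
  define c where "c = (1 / M) powr (1 / p)"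
  have c: "c > 0" "c powr p = 1 / M" using M p_gt_1 by (auto simp: c_def powr_powr)
  have [measurable]: "v \<in> borel_measurable borel" using v by (rule lipschitz_core_measurable)
  have sc: "near_energy s (\<lambda>x. c * v x) = ennreal (c powr p) * near_energy s v" for s
    unfolding near_energy_def using c by (intro interaction_scale) auto
  have "mass p (\<lambda>x. c * v x) = 1"
    using M c by (subst mass_scale) (auto simp: ennreal_mult'[symmetric])
  then have "(\<lambda>x. c * v x) \<in> unit_W0 s" if "0 < s" "s \<le> 1/2" for s
    using v that near_energy_lipschitz(1)[OF v, of s] sc[of s] unfolding unit_W0_iff[OF that(1)]
    by (auto simp: vanishes_outside_def lipschitz_core_def ennreal_mult_less_top)
  then show thesis using that[of c] c sc by (auto simp: M_def)
qed

lemma unit_W0_nonempty: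
  assumes "0 < s" "s \<le> 1/2" shows "unit_W0 s \<noteq> {}"
  using lipschitz_core_bump normalize_lipschitz_core assms by (metis empty_iff)

lemma lambda_frac_upper:
  assumes v: "v \<in> lipschitz_core" and m: "0 < mass p v"
    and less: "C_log DIM('a) p / 2 * (enn2real (near_energy 0 v) / enn2real (mass p v)) + rho_D < a"
  shows "eventually (\<lambda>s. (lambda_frac s p \<Omega> - 1) / s < a) (at_right 0)"
proof -
  obtain c where c: "c > 0" "c powr p = 1 / enn2real (mass p v)"
    "\<And>s. 0 < s \<Longrightarrow> s \<le> 1/2 \<Longrightarrow> (\<lambda>x. c * v x) \<in> unit_W0 s"
    "\<And>s. near_energy s (\<lambda>x. c * v x) = ennreal (c powr p) * near_energy s v"
    using normalize_lipschitz_core[OF v m] by blast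
  have "((\<lambda>s. enn2real (near_energy s v)) \<longlongrightarrow> enn2real (near_energy 0 v)) (at_right 0)"
    using near_energy_lipschitz[OF v] by (intro tendsto_enn2real) (auto simp: less_top)
  then have "((\<lambda>s. C_frac DIM('a) s p / s / 2 * (c powr p * enn2real (near_energy s v)) + far_rate s)
     \<longlongrightarrow> C_log DIM('a) p / 2 * (c powr p * enn2real (near_energy 0 v)) + rho_D) (at_right 0)"
    using p_gt_1 by (intro tendsto_add tendsto_mult tendsto_const tendsto_divide tendsto_C_frac tendsto_far_rate) auto
  then have "eventually (\<lambda>s. C_frac DIM('a) s p / s / 2 * (c powr p * enn2real (near_energy s v)) + far_rate s < a) (at_right 0)"
    using less by (intro order_tendstoD(2)) (auto simp: c)
  moreover have "eventually (\<lambda>s::real. s \<in> {0<..<1/2}) (at_right 0)"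
    by (rule eventually_at_right_real) simp
  ultimately show ?thesis
  proof eventually_elim
    case (elim s)
    then have s: "0 < s" "s < 1" and u: "(\<lambda>x. c * v x) \<in> unit_W0 s" using c(3)[of s] by auto
    have "(lambda_frac s p \<Omega> - 1) / s \<le> (E_frac s p (\<lambda>x. c * v x) - 1) / s"
      using lambda_frac_le[OF u s] s by (intro divide_right_mono) auto
    also have "\<dots> = C_frac DIM('a) s p / s / 2 * (c powr p * enn2real (near_energy s v)) + far_rate s"
      using s by (subst E_frac_unit[OF u]) (auto simp: c(4) enn2real_mult)
    finally show ?case using elim by simp
  qed
qed

lemma unit_X0_nonempty: "unit_X0 \<noteq> {}"
  using unit_W0_nonempty[of "1/2"] unit_W0_subset[of "1/2"] by auto

text \<open>
  A small loss of mass in the approximation is harmless: the upper bound is a Rayleigh quotient, continuous in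
  the mass near \<open>1\<close>.
\<close>
lemma tendsto_lambda_frac:
  assumes dense: "\<And>u \<delta>. u \<in> unit_X0 \<Longrightarrow> 0 < \<delta> \<Longrightarrow>
    \<exists>v \<in> lipschitz_core. near_energy 0 v \<le> near_energy 0 u + ennreal \<delta> \<and> ennreal (1 - \<delta>) \<le> mass p v"
  shows "((\<lambda>s. (lambda_frac s p \<Omega> - 1) / s) \<longlongrightarrow> lambda_log p \<Omega>) (at_right 0)"
proof (rule order_tendstoI)
  fix a assume a: "a < lambda_log p \<Omega>"
  have "((\<lambda>s. compare s * (lambda_log p \<Omega> - rho_D) + far_rate s) \<longlongrightarrow> 1 * (lambda_log p \<Omega> - rho_D) + rho_D) (at_right 0)"
    by (intro tendsto_intros tendsto_compare tendsto_far_rate)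
  then have "eventually (\<lambda>s. a < compare s * (lambda_log p \<Omega> - rho_D) + far_rate s) (at_right 0)"
    using a by (intro order_tendstoD) auto
  moreover have "eventually (\<lambda>s::real. s \<in> {0<..<1/2}) (at_right 0)"
    by (rule eventually_at_right_real) simp
  ultimately show "eventually (\<lambda>s. a < (lambda_frac s p \<Omega> - 1) / s) (at_right 0)"
  proof eventually_elim
    case (elim s)
    then show ?case using lambda_frac_ge[of s] unit_W0_nonempty[of s] by auto
  qed
next
  fix a assume a: "lambda_log p \<Omega> < a"
  then obtain u where u: "u \<in> unit_X0" and ua: "E_log p u < a"
    unfolding lambda_log_def unit_X0_def[symmetric]
    using cINF_less_iff[OF unit_X0_nonempty bdd_below_E_log] by auto
  define G where "G = enn2real (near_energy 0 u)"
  have "((\<lambda>\<delta>. C_log DIM('a) p / 2 * ((G + \<delta>) / (1 - \<delta>)) + rho_D) \<longlongrightarrow> C_log DIM('a) p / 2 * ((G + 0) / (1 - 0)) + rho_D) (at_right 0)"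
    by (intro tendsto_intros) auto
  then have "eventually (\<lambda>\<delta>. C_log DIM('a) p / 2 * ((G + \<delta>) / (1 - \<delta>)) + rho_D < a) (at_right 0)"
    using ua by (intro order_tendstoD) (auto simp: E_log_unit[OF u] G_def)
  moreover have "eventually (\<lambda>s::real. s \<in> {0<..<1}) (at_right 0)"
    by (rule eventually_at_right_real) simp
  ultimately have "eventually (\<lambda>\<delta>. 0 < \<delta> \<and> \<delta> < 1 \<and> C_log DIM('a) p / 2 * ((G + \<delta>) / (1 - \<delta>)) + rho_D < a) (at_right 0)"
    by eventually_elim auto
  then obtain \<delta> where \<delta>: "0 < \<delta>" "\<delta> < 1" "C_log DIM('a) p / 2 * ((G + \<delta>) / (1 - \<delta>)) + rho_D < a"
    using eventually_happens'[OF trivial_limit_at_right_real] by blast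
  obtain v where v: "v \<in> lipschitz_core" "near_energy 0 v \<le> near_energy 0 u + ennreal \<delta>" "ennreal (1 - \<delta>) \<le> mass p v"
    using dense[OF u \<delta>(1)] by blast
  have fin: "near_energy 0 u < \<infinity>" using u by (simp add: unit_X0_iff)
  have Gv: "enn2real (near_energy 0 v) \<le> G + \<delta>"
    using enn2real_mono[OF v(2)] fin \<delta> by (simp add: G_def enn2real_plus)
  have mv: "1 - \<delta> \<le> enn2real (mass p v)"
    using enn2real_mono[OF v(3)] lipschitz_core_mass[OF v(1)] \<delta> by simp
  have "enn2real (near_energy 0 v) / enn2real (mass p v) \<le> (G + \<delta>) / (1 - \<delta>)"
    using Gv mv \<delta> by (intro frac_le) (auto simp: G_def)
  then have "C_log DIM('a) p / 2 * (enn2real (near_energy 0 v) / enn2real (mass p v)) + rho_D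
     \<le> C_log DIM('a) p / 2 * ((G + \<delta>) / (1 - \<delta>)) + rho_D"
    using C_log_pos[of p "DIM('a)"] p_gt_1 by (intro add_right_mono mult_left_mono) auto
  then have "C_log DIM('a) p / 2 * (enn2real (near_energy 0 v) / enn2real (mass p v)) + rho_D < a"
    using \<delta>(3) by linarith
  moreover have "0 < mass p v" using v(3) \<delta> by (metis diff_gt_0_iff_gt ennreal_less_zero_iff order_less_le_trans)
  ultimately show "eventually (\<lambda>s. (lambda_frac s p \<Omega> - 1) / s < a) (at_right 0)"
    using lambda_frac_upper[OF v(1)] by auto
qed

end

section \<open>Exterior balls and a logarithmic Hardy inequality\<close>

text \<open>
  Below the graph of an \<open>L\<close>-Lipschitz function there is a downward cone of slope \<open>L\<close> at every point that is
  not above the graph, and this cone contains a ball of radius \<open>\<kappa> \<rho>\<close> centred \<open>\<rho> / 2\<close> below the apex.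
\<close>
lemma lipschitz_boundary_exterior_ball:
  fixes z :: "'a::euclidean_space"
  assumes "open \<Omega>" and lip: "lipschitz_boundary \<Omega>" and z: "z \<in> frontier \<Omega>"
  obtains r \<kappa> where "0 < r" "0 < \<kappa>"
    "\<And>z' \<rho>. z' \<in> ball z r \<Longrightarrow> z' \<notin> \<Omega> \<Longrightarrow> 0 < \<rho> \<Longrightarrow> \<rho> \<le> r \<Longrightarrow> \<exists>c. ball c (\<kappa> * \<rho>) \<subseteq> ball z' \<rho> - \<Omega>"
proof -
  obtain R e g L where R: "R > 0" and e: "norm e = 1" and g: "L-lipschitz_on {y. y \<bullet> e = 0} g"
    and graph: "\<Omega> \<inter> ball z R = {x \<in> ball z R. x \<bullet> e > (g (x - (x \<bullet> e) *\<^sub>R e) :: real)}"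
    using lip z unfolding lipschitz_boundary_def by blast
  have L: "L \<ge> 0" using g by (rule lipschitz_on_nonneg)
  have ee: "e \<bullet> e = 1" using e by (simp add: dot_square_norm)
  define \<kappa> where "\<kappa> = 1 / (2 * (1 + 2 * L))"
  have \<kappa>: "0 < \<kappa>" "\<kappa> \<le> 1 / 2" "\<kappa> * (1 + 2 * L) = 1 / 2" using L by (auto simp: \<kappa>_def divide_simps)
  show thesis
  proof (rule that[of "R / 2" \<kappa>])
    fix z' \<rho> assume z': "z' \<in> ball z (R / 2)" "z' \<notin> \<Omega>" and \<rho>: "0 < \<rho>" "\<rho> \<le> R / 2"
    let ?c = "z' - (\<rho> / 2) *\<^sub>R e"
    have "x \<in> ball z' \<rho> - \<Omega>" if x: "x \<in> ball ?c (\<kappa> * \<rho>)" for x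
    proof -
      define w where "w = x - ?c"
      have w: "norm w < \<kappa> * \<rho>" using x by (simp add: w_def dist_norm norm_minus_commute)
      have xeq: "x = z' - (\<rho> / 2) *\<^sub>R e + w" by (simp add: w_def)
      have k2: "\<kappa> * \<rho> \<le> \<rho> / 2" using \<kappa> \<rho> mult_right_mono[of \<kappa> "1/2" \<rho>] by simp
      have "norm (x - z') \<le> \<rho> / 2 + norm w"
        using norm_triangle_ineq[of "- (\<rho> / 2) *\<^sub>R e" w] e \<rho> by (simp add: xeq)
      then have "norm (x - z') < \<rho>" using w k2 by linarith
      then have 1: "x \<in> ball z' \<rho>" by (simp add: dist_norm norm_minus_commute)
      have x_ball: "x \<in> ball z R"
        using 1 z'(1) \<rho> dist_triangle[of z x z'] by simp
      have z_ball: "z' \<in> ball z R" using z'(1) R by simp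
      have gz: "z' \<bullet> e \<le> g (z' - (z' \<bullet> e) *\<^sub>R e)"
        using graph z'(2) z_ball by (metis (no_types, lifting) IntD1 mem_Collect_eq not_le_imp_less)
      have we: "\<bar>w \<bullet> e\<bar> \<le> norm w" using Cauchy_Schwarz_ineq2[of w e] e by simp
      have diff: "(x - (x \<bullet> e) *\<^sub>R e) - (z' - (z' \<bullet> e) *\<^sub>R e) = w - (w \<bullet> e) *\<^sub>R e"
        by (simp add: xeq inner_diff_left inner_add_left ee algebra_simps)
      have "norm (w - (w \<bullet> e) *\<^sub>R e) \<le> 2 * norm w"
        using norm_triangle_ineq4[of w "(w \<bullet> e) *\<^sub>R e"] we e by simp
      moreover have "\<bar>g (x - (x \<bullet> e) *\<^sub>R e) - g (z' - (z' \<bullet> e) *\<^sub>R e)\<bar> \<le> L * norm (w - (w \<bullet> e) *\<^sub>R e)"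
        using lipschitz_onD[OF g, of "x - (x \<bullet> e) *\<^sub>R e" "z' - (z' \<bullet> e) *\<^sub>R e"]
        by (simp add: dist_norm diff inner_diff_left ee)
      ultimately have "\<bar>g (x - (x \<bullet> e) *\<^sub>R e) - g (z' - (z' \<bullet> e) *\<^sub>R e)\<bar> \<le> L * (2 * norm w)"
        using L by (meson mult_left_mono order_trans)
      also have "\<dots> \<le> L * (2 * (\<kappa> * \<rho>))" using w L by (intro mult_left_mono) auto
      finally have "g (x - (x \<bullet> e) *\<^sub>R e) \<ge> g (z' - (z' \<bullet> e) *\<^sub>R e) - 2 * L * \<kappa> * \<rho>" by (simp add: abs_le_iff)
      moreover have "x \<bullet> e \<le> z' \<bullet> e - \<rho> / 2 + \<kappa> * \<rho>"
        using we w by (simp add: xeq inner_diff_left inner_add_left ee)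
      moreover have "\<kappa> * \<rho> + 2 * L * \<kappa> * \<rho> = \<rho> / 2"
        using arg_cong[OF \<kappa>(3), of "\<lambda>t. t * \<rho>"] by (simp add: algebra_simps)
      ultimately have "x \<bullet> e \<le> g (x - (x \<bullet> e) *\<^sub>R e)" using gz by linarith
      then have "x \<notin> \<Omega>" using graph x_ball by (metis (no_types, lifting) IntI mem_Collect_eq not_le)
      then show ?thesis using 1 by simp
    qed
    then show "\<exists>c. ball c (\<kappa> * \<rho>) \<subseteq> ball z' \<rho> - \<Omega>" by blast
  qed (use R \<kappa> in auto)
qed

lemma lipschitz_boundary_uniform_exterior_ball:
  fixes \<Omega> :: "'a::euclidean_space set"
  assumes "open \<Omega>" "bounded \<Omega>" "lipschitz_boundary \<Omega>"
  obtains \<kappa> b where "0 < \<kappa>" "0 < b"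
    "\<And>z \<rho>. z \<in> frontier \<Omega> \<Longrightarrow> 0 < \<rho> \<Longrightarrow> \<rho> \<le> b \<Longrightarrow> \<exists>c. ball c (\<kappa> * \<rho>) \<subseteq> ball z \<rho> - \<Omega>"
proof -
  have "\<forall>z \<in> frontier \<Omega>. \<exists>r \<kappa>. 0 < r \<and> 0 < \<kappa> \<and>
    (\<forall>z' \<rho>. z' \<in> ball z r \<longrightarrow> z' \<notin> \<Omega> \<longrightarrow> 0 < \<rho> \<longrightarrow> \<rho> \<le> r \<longrightarrow> (\<exists>c. ball c (\<kappa> * \<rho>) \<subseteq> ball z' \<rho> - \<Omega>))"
    using lipschitz_boundary_exterior_ball[OF assms(1,3)] by metis
  then obtain r k where rk: "\<And>z. z \<in> frontier \<Omega> \<Longrightarrow> 0 < r z \<and> 0 < k z \<and>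
    (\<forall>z' \<rho>. z' \<in> ball z (r z) \<longrightarrow> z' \<notin> \<Omega> \<longrightarrow> 0 < \<rho> \<longrightarrow> \<rho> \<le> r z \<longrightarrow> (\<exists>c. ball c (k z * \<rho>) \<subseteq> ball z' \<rho> - \<Omega>))"
    by metis
  have "compact (frontier \<Omega>)" using assms by (simp add: compact_frontier_bounded)
  then obtain F where F: "F \<subseteq> frontier \<Omega>" "finite F" "frontier \<Omega> \<subseteq> (\<Union>z\<in>F. ball z (r z))"
    by (rule compactE_image[of "frontier \<Omega>" "frontier \<Omega>" "\<lambda>z. ball z (r z)"]) (use rk in force)+
  define b \<kappa> where "b = Min (insert 1 (r ` F))" and "\<kappa> = Min (insert 1 (k ` F))"
  have b: "0 < b" "\<And>z. z \<in> F \<Longrightarrow> b \<le> r z" and \<kappa>: "0 < \<kappa>" "\<And>z. z \<in> F \<Longrightarrow> \<kappa> \<le> k z"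
    using F rk by (auto simp: b_def \<kappa>_def)
  show thesis
  proof (rule that[OF \<kappa>(1) b(1)])
    fix z \<rho> assume z: "z \<in> frontier \<Omega>" and \<rho>: "0 < \<rho>" "\<rho> \<le> b"
    then obtain a where a: "a \<in> F" "z \<in> ball a (r a)" using F by blast
    have "z \<notin> \<Omega>" using z assms(1) by (simp add: frontier_def interior_open)
    then obtain c where "ball c (k a * \<rho>) \<subseteq> ball z \<rho> - \<Omega>"
      using rk[of a] a F b(2)[of a] \<rho> by (meson order_trans subsetD)
    moreover have "ball c (\<kappa> * \<rho>) \<subseteq> ball c (k a * \<rho>)"
      using \<kappa>(2)[OF a(1)] \<rho> by (intro subset_ball mult_right_mono) auto
    ultimately show "\<exists>c. ball c (\<kappa> * \<rho>) \<subseteq> ball z \<rho> - \<Omega>" by blast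
  qed
qed

lemma nearest_frontier_point:
  fixes y :: "'a::euclidean_space"
  assumes "open \<Omega>" "y \<in> \<Omega>" "- \<Omega> \<noteq> {}"
  obtains w where "w \<in> frontier \<Omega>" "dist y w \<le> infdist y (- \<Omega>)"
proof -
  obtain z where z: "z \<in> - \<Omega>" "infdist y (- \<Omega>) = dist y z"
    using infdist_attains_inf[of "- \<Omega>" y] assms by auto
  have "closed_segment y z \<inter> frontier \<Omega> \<noteq> {}"
    using assms(2) z(1) by (intro connected_Int_frontier) auto
  then obtain w where "w \<in> closed_segment y z" "w \<in> frontier \<Omega>" by auto
  then show thesis using that[of w] z dist_in_closed_segment[of w y z] by (simp add: dist_commute)
qed

context bounded_domain
begin

lemma complement_nonempty: "- \<Omega> \<noteq> {}"
  using domain_bounded not_bounded_UNIV by (metis Compl_empty_eq compl_eq_compl_iff double_complement)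

definition bdist :: "'a \<Rightarrow> real" where
  "bdist x = infdist x (- \<Omega>)"

lemma bdist_pos: "x \<in> \<Omega> \<Longrightarrow> 0 < bdist x"
  unfolding bdist_def using open_domain complement_nonempty by (intro infdist_pos_not_in_closed) auto

lemma bdist_zero: "x \<notin> \<Omega> \<Longrightarrow> bdist x = 0"
  unfolding bdist_def by simp

lemma bdist_lipschitz: "\<bar>bdist x - bdist y\<bar> \<le> norm (x - y)"
  unfolding bdist_def by (metis infdist_triangle_abs dist_norm)

lemma bdist_measurable [measurable]: "bdist \<in> borel_measurable borel"
  unfolding bdist_def[abs_def]
  by (intro borel_measurable_continuous_onI continuous_on_infdist continuous_on_id)

lemma bdist_le: "x \<in> \<Omega> \<Longrightarrow> bdist x \<le> D"
proof -
  assume x: "x \<in> \<Omega>"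
  obtain e :: 'a where e: "norm e = 1" using norm_Basis nonempty_Basis by blast
  have "x + D *\<^sub>R e \<notin> \<Omega>" using diam[of "x + D *\<^sub>R e" x] x e D_ge_1 by auto
  then have "bdist x \<le> dist x (x + D *\<^sub>R e)" unfolding bdist_def by (intro infdist_le) auto
  then show ?thesis using e D_ge_1 by (simp add: dist_norm)
qed

definition exterior_potential :: "'a \<Rightarrow> ennreal" where
  "exterior_potential y = (\<integral>\<^sup>+ x. indicator (- \<Omega>) x * riesz {..<D} 0 (x - y) \<partial>lborel)"

text \<open>
  Around \<open>y\<close> the exterior has density bounded below at all radii between \<open>2 d\<close> and a fixed number, where
  \<open>d\<close> is the distance of \<open>y\<close> to the exterior; the layer cake estimate then yields \<open>ln (1 / d)\<close>.
\<close>
lemma exterior_potential_ge_log: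
  assumes "lipschitz_boundary \<Omega>"
  obtains A B where "0 \<le> A" "0 \<le> B"
    "\<And>y. y \<in> \<Omega> \<Longrightarrow> ennreal (ln (1 / bdist y)) \<le> ennreal A * exterior_potential y + ennreal B"
proof -
  obtain \<kappa> b where \<kappa>: "0 < \<kappa>" and b: "0 < b" and ext:
    "\<And>z \<rho>. z \<in> frontier \<Omega> \<Longrightarrow> 0 < \<rho> \<Longrightarrow> \<rho> \<le> b \<Longrightarrow> \<exists>c. ball c (\<kappa> * \<rho>) \<subseteq> ball z \<rho> - \<Omega>"
    using lipschitz_boundary_uniform_exterior_ball[OF open_domain domain_bounded assms] by blast
  \<comment> \<open>A ball of radius \<open>\<rho>\<close> around \<open>y\<close> contains one of radius \<open>\<rho> / 2\<close> around a boundary point, provided \<open>2 d \<le> \<rho>\<close>.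
  Hence exterior balls are available for radii up to \<open>2 b\<close>.\<close>
  define b2 where "b2 = min (2 * b) D"
  have b2: "0 < b2" "b2 \<le> 2 * b" "b2 \<le> D" using b D_ge_1 by (auto simp: b2_def)
  define c where "c = unit_ball_vol (real DIM('a)) * (\<kappa> / 2) ^ DIM('a)"
  have c: "c > 0" using \<kappa> by (simp add: c_def)
  define q where "q = real DIM('a) * c"
  have q: "q > 0" using c by (simp add: q_def)
  show thesis
  proof (rule that[of "1 / q" "\<bar>ln (2 / b2)\<bar>"])
    fix y assume y: "y \<in> \<Omega>"
    define d where "d = bdist y"
    have d: "0 < d" using bdist_pos[OF y] by (simp add: d_def)
    have ln_eq: "ln (1 / d) = ln (b2 / (2 * d)) + ln (2 / b2)"
      using d b2 by (simp add: ln_div ln_mult)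
    show "ennreal (ln (1 / bdist y)) \<le> ennreal (1 / q) * exterior_potential y + ennreal \<bar>ln (2 / b2)\<bar>"
    proof (cases "2 * d \<le> b2")
      case False
      then have "ln (b2 / (2 * d)) \<le> 0" using d b2 by (simp add: ln_le_zero_iff)
      then have "ln (1 / d) \<le> \<bar>ln (2 / b2)\<bar>" using ln_eq by linarith
      then show ?thesis by (auto simp: d_def intro: ennreal_leI order_trans add_increasing)
    next
      case True
      obtain w where w: "w \<in> frontier \<Omega>" "dist y w \<le> d"
        using nearest_frontier_point[OF open_domain y complement_nonempty] by (auto simp: d_def bdist_def)
      have "ennreal (real DIM('a) * c * ln (b2 / (2 * d)))
        \<le> (\<integral>\<^sup>+ x. indicator (- \<Omega> \<inter> ball y b2) x * ennreal (norm (x - y) powr - real DIM('a)) \<partial>lborel)"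
      proof (rule density_log_lower_bound)
        fix \<rho> assume \<rho>: "2 * d \<le> \<rho>" "\<rho> \<le> b2"
        then obtain a where a: "ball a (\<kappa> * (\<rho> / 2)) \<subseteq> ball w (\<rho> / 2) - \<Omega>"
          using ext[OF w(1), of "\<rho> / 2"] d b2 by auto
        have "ball w (\<rho> / 2) \<subseteq> ball y \<rho>"
        proof
          fix x assume "x \<in> ball w (\<rho> / 2)"
          then show "x \<in> ball y \<rho>" using dist_triangle[of y x w] w(2) \<rho> by simp
        qed
        then have sub: "ball a (\<kappa> * (\<rho> / 2)) \<subseteq> - \<Omega> \<inter> ball y \<rho>" using a by auto
        have "ennreal (c * \<rho> ^ DIM('a)) = emeasure lborel (ball a (\<kappa> * (\<rho> / 2)))"
          using \<kappa> \<rho> d by (subst emeasure_ball_real) (auto simp: c_def power_mult_distrib power_divide)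
        also have "\<dots> \<le> emeasure lborel (- \<Omega> \<inter> ball y \<rho>)"
          by (intro emeasure_mono sub) auto
        finally show "ennreal (c * \<rho> ^ DIM('a)) \<le> emeasure lborel (- \<Omega> \<inter> ball y \<rho>)" .
      qed (use d True c in auto)
      also have "\<dots> \<le> exterior_potential y"
        unfolding exterior_potential_def using b2
        by (intro nn_integral_mono) (auto simp: riesz_def dist_norm norm_minus_commute split: split_indicator)
      finally have "ennreal (q * ln (b2 / (2 * d))) \<le> exterior_potential y" by (simp add: q_def)
      then have "ennreal (1 / q) * ennreal (q * ln (b2 / (2 * d))) \<le> ennreal (1 / q) * exterior_potential y"
        by (rule mult_left_mono) auto
      moreover have "0 \<le> ln (b2 / (2 * d))" using True d by (simp add: ln_ge_zero)
      ultimately have 1: "ennreal (ln (b2 / (2 * d))) \<le> ennreal (1 / q) * exterior_potential y"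
        using q by (simp add: ennreal_mult'[symmetric])
      have "ennreal (ln (1 / d)) \<le> ennreal (ln (b2 / (2 * d)) + \<bar>ln (2 / b2)\<bar>)"
        unfolding ln_eq by (intro ennreal_leI) auto
      also have "\<dots> = ennreal (ln (b2 / (2 * d))) + ennreal \<bar>ln (2 / b2)\<bar>"
        using \<open>0 \<le> ln (b2 / (2 * d))\<close> by (intro ennreal_plus) auto
      also have "\<dots> \<le> ennreal (1 / q) * exterior_potential y + ennreal \<bar>ln (2 / b2)\<bar>"
        by (intro add_right_mono 1)
      finally show ?thesis by (simp add: d_def)
    qed
  qed (use q in auto)
qed

text \<open>
  Inside \<open>\<bar>w\<bar> < d / 4\<close> the truncation compensates the singularity and contributes a constant;
  the annulus from \<open>d / 4\<close> to \<open>D\<close> contributes \<open>ln (4 D / d)\<close>.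
\<close>
lemma truncated_riesz_integral:
  assumes d: "0 < d" "d \<le> D"
  shows "(\<integral>\<^sup>+ (w::'a). riesz {..<D} 0 w * ennreal (min 1 (4 * norm w / d) powr p) \<partial>(lborel::'a measure))
    \<le> ennreal (sphere_area TYPE('a)) * (ennreal (1 / p + ln (4 * D)) + ennreal (ln (1 / d)))"
proof -
  let ?N = "real DIM('a)" and ?S = "sphere_area TYPE('a)"
  have S: "?S > 0" by (rule sphere_area_pos)
  have ineq: "riesz {..<D} 0 w * ennreal (min 1 (4 * norm w / d) powr p)
     \<le> ennreal ((4 / d) powr p) * (ennreal (norm w powr (p - ?N)) * indicator {0<..<d / 4} (norm w))
      + ennreal (norm w powr - ?N) * indicator {d / 4..<D} (norm w)" for w :: 'a
  proof (cases "w = 0 \<or> norm w \<ge> D")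
    case True then show ?thesis by (auto simp: riesz_def)
  next
    case False
    then have w: "0 < norm w" "norm w < D" by auto
    show ?thesis
    proof (cases "norm w < d / 4")
      case True
      then have "min 1 (4 * norm w / d) = 4 / d * norm w" using d by (simp add: min_def field_simps)
      moreover have "norm w powr - ?N * (4 / d * norm w) powr p = (4 / d) powr p * norm w powr (p - ?N)"
        unfolding powr_mult by (simp add: powr_add[symmetric])
      ultimately have eq: "norm w powr - ?N * min 1 (4 * norm w / d) powr p = (4 / d) powr p * norm w powr (p - ?N)"
        by (simp only:)
      have "riesz {..<D} 0 w * ennreal (min 1 (4 * norm w / d) powr p)
        = ennreal (norm w powr - ?N * min 1 (4 * norm w / d) powr p)"
        using w(2) by (simp add: riesz_def ennreal_mult')
      also have "\<dots> = ennreal ((4 / d) powr p) * (ennreal (norm w powr (p - ?N)) * indicator {0<..<d / 4} (norm w))"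
        using w True unfolding eq by (simp add: ennreal_mult')
      finally show ?thesis by (simp add: add_increasing2)
    next
      case False
      have "min 1 (4 * norm w / d) powr p \<le> 1" using d p_gt_1 by (intro powr_le1) auto
      then have "norm w powr - ?N * min 1 (4 * norm w / d) powr p \<le> norm w powr - ?N"
        by (intro mult_left_le) auto
      then show ?thesis using w False by (simp add: riesz_def ennreal_mult'[symmetric] ennreal_leI)
    qed
  qed
  have "(\<integral>\<^sup>+ (w::'a). riesz {..<D} 0 w * ennreal (min 1 (4 * norm w / d) powr p) \<partial>(lborel::'a measure))
    \<le> (\<integral>\<^sup>+ (w::'a). ennreal ((4 / d) powr p) * (ennreal (norm w powr (p - ?N)) * indicator {0<..<d / 4} (norm w))
      + ennreal (norm w powr - ?N) * indicator {d / 4..<D} (norm w) \<partial>lborel)"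
    by (intro nn_integral_mono ineq)
  also have "\<dots> = ennreal ((4 / d) powr p) * ennreal (?S * (d / 4) powr p / p) + ennreal (?S * ln (D / (d / 4)))"
    using d p_gt_1
    by (subst nn_integral_add, measurable, subst nn_integral_cmult, measurable)
       (simp add: nn_integral_radial_ball nn_integral_radial_annulus)
  also have "ennreal ((4 / d) powr p) * ennreal (?S * (d / 4) powr p / p) = ennreal (?S / p)"
    using d p_gt_1 S by (simp add: ennreal_mult'[symmetric] powr_divide)
  also have "ennreal (?S / p) + ennreal (?S * ln (D / (d / 4))) = ennreal (?S * (1 / p + ln (4 * D) + ln (1 / d)))"
  proof (subst ennreal_plus[symmetric])
    show "0 \<le> ?S * ln (D / (d / 4))" using d S by (intro mult_nonneg_nonneg ln_ge_zero) (auto simp: field_simps)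
    show "0 \<le> ?S / p" using S p_gt_1 by simp
    have "ln (D / (d / 4)) = ln (4 * D) + ln (1 / d)" using d by (simp add: ln_div ln_mult)
    then show "ennreal (?S / p + ?S * ln (D / (d / 4))) = ennreal (?S * (1 / p + ln (4 * D) + ln (1 / d)))"
      by (simp add: distrib_left add.assoc)
  qed
  also have "\<dots> \<le> ennreal ?S * (ennreal (1 / p + ln (4 * D)) + ennreal (ln (1 / d)))"
  proof -
    have "ennreal (1 / p + ln (4 * D) + ln (1 / d)) \<le> ennreal ((1 / p + ln (4 * D)) + max 0 (ln (1 / d)))"
      by (intro ennreal_leI) auto
    also have "\<dots> = ennreal (1 / p + ln (4 * D)) + ennreal (max 0 (ln (1 / d)))"
      using p_gt_1 D_ge_1 by (intro ennreal_plus) auto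
    also have "ennreal (max 0 (ln (1 / d))) = ennreal (ln (1 / d))"
      by (auto simp: max_def ennreal_neg)
    finally show ?thesis using S by (simp add: ennreal_mult' mult_left_mono)
  qed
  finally show ?thesis .
qed

text \<open>
  The weight that arises when the cutoff functions below are inserted into the energy.  Integrated over \<open>x\<close> it is
  at most a multiple of \<open>1 + ln (1 / dist(y, \<partial>\<Omega>))\<close>, hence of \<open>1\<close> plus the exterior potential; and the integral of
  the exterior potential against \<open>\<bar>u\<bar>\<^sup>p\<close> is the energy of \<open>u\<close> over pairs with \<open>x \<notin> \<Omega>\<close> and \<open>y \<in> \<Omega>\<close>.
\<close>
lemma log_hardy:
  assumes lip: "lipschitz_boundary \<Omega>"
    and [measurable]: "u \<in> borel_measurable borel" and u0: "\<And>x. x \<notin> \<Omega> \<Longrightarrow> u x = 0"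
    and m: "mass p u < \<infinity>" and fin: "near_energy 0 u < \<infinity>"
  shows "(\<integral>\<^sup>+ x. \<integral>\<^sup>+ y. riesz {..<D} 0 (x - y) * (ennreal (min 1 (4 * norm (x - y) / bdist y) powr p)
    * ennreal (\<bar>u y\<bar> powr p)) \<partial>lborel \<partial>lborel) < \<infinity>"
proof -
  obtain A B where AB: "0 \<le> A" "0 \<le> B"
    "\<And>y. y \<in> \<Omega> \<Longrightarrow> ennreal (ln (1 / bdist y)) \<le> ennreal A * exterior_potential y + ennreal B"
    using exterior_potential_ge_log[OF lip] by blast
  let ?S = "ennreal (sphere_area TYPE('a))" and ?C = "ennreal (1 / p + ln (4 * D))"
  have [measurable]: "exterior_potential \<in> borel_measurable borel"
    unfolding exterior_potential_def[abs_def] by measurable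
  have W: "(\<integral>\<^sup>+ y. exterior_potential y * ennreal (\<bar>u y\<bar> powr p) \<partial>lborel) \<le> near_energy 0 u"
  proof -
    have "(\<integral>\<^sup>+ y. exterior_potential y * ennreal (\<bar>u y\<bar> powr p) \<partial>lborel)
      = (\<integral>\<^sup>+ y. \<integral>\<^sup>+ x. indicator (- \<Omega>) x * riesz {..<D} 0 (x - y) * ennreal (\<bar>u y\<bar> powr p) \<partial>lborel \<partial>lborel)"
      unfolding exterior_potential_def by (intro nn_integral_cong nn_integral_multc[symmetric]) measurable
    also have "\<dots> = (\<integral>\<^sup>+ x. \<integral>\<^sup>+ y. indicator (- \<Omega>) x * riesz {..<D} 0 (x - y) * ennreal (\<bar>u y\<bar> powr p) \<partial>lborel \<partial>lborel)"
      by (rule lborel_pair.Fubini') measurable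
    also have "\<dots> \<le> near_energy 0 u"
      unfolding near_energy_def interaction_def
      by (intro nn_integral_mono) (auto simp: u0 split: split_indicator)
    finally show ?thesis .
  qed
  have "(\<integral>\<^sup>+ x. \<integral>\<^sup>+ y. riesz {..<D} 0 (x - y) * (ennreal (min 1 (4 * norm (x - y) / bdist y) powr p)
    * ennreal (\<bar>u y\<bar> powr p)) \<partial>lborel \<partial>lborel)
    = (\<integral>\<^sup>+ y. \<integral>\<^sup>+ x. riesz {..<D} 0 (x - y) * (ennreal (min 1 (4 * norm (x - y) / bdist y) powr p)
    * ennreal (\<bar>u y\<bar> powr p)) \<partial>lborel \<partial>lborel)"
    by (rule lborel_pair.Fubini') measurable
  also have "\<dots> = (\<integral>\<^sup>+ y. (\<integral>\<^sup>+ (w::'a). riesz {..<D} 0 w * ennreal (min 1 (4 * norm w / bdist y) powr p) \<partial>lborel)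
    * ennreal (\<bar>u y\<bar> powr p) \<partial>lborel)"
  proof (intro nn_integral_cong)
    fix y :: 'a
    have "(\<integral>\<^sup>+ x. riesz {..<D} 0 (x - y) * (ennreal (min 1 (4 * norm (x - y) / bdist y) powr p)
        * ennreal (\<bar>u y\<bar> powr p)) \<partial>lborel)
      = (\<integral>\<^sup>+ x. riesz {..<D} 0 (x - y) * ennreal (min 1 (4 * norm (x - y) / bdist y) powr p) \<partial>lborel)
        * ennreal (\<bar>u y\<bar> powr p)"
      by (subst nn_integral_multc[symmetric]) (auto simp: mult.assoc)
    also have "(\<integral>\<^sup>+ x. riesz {..<D} 0 (x - y) * ennreal (min 1 (4 * norm (x - y) / bdist y) powr p) \<partial>lborel)
      = (\<integral>\<^sup>+ (w::'a). riesz {..<D} 0 w * ennreal (min 1 (4 * norm w / bdist y) powr p) \<partial>lborel)"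
      by (rule nn_integral_translate[of "\<lambda>w. riesz {..<D} 0 w * ennreal (min 1 (4 * norm w / bdist y) powr p)" y]) measurable
    finally show "(\<integral>\<^sup>+ x. riesz {..<D} 0 (x - y) * (ennreal (min 1 (4 * norm (x - y) / bdist y) powr p)
        * ennreal (\<bar>u y\<bar> powr p)) \<partial>lborel) = (\<integral>\<^sup>+ (w::'a). riesz {..<D} 0 w * ennreal (min 1 (4 * norm w / bdist y) powr p) \<partial>lborel)
        * ennreal (\<bar>u y\<bar> powr p)" .
  qed
  also have "\<dots> \<le> (\<integral>\<^sup>+ y. ?S * ((?C + ennreal B) * ennreal (\<bar>u y\<bar> powr p)
      + ennreal A * (exterior_potential y * ennreal (\<bar>u y\<bar> powr p))) \<partial>lborel)"
  proof (intro nn_integral_mono)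
    fix y :: 'a
    show "(\<integral>\<^sup>+ (w::'a). riesz {..<D} 0 w * ennreal (min 1 (4 * norm w / bdist y) powr p) \<partial>lborel) * ennreal (\<bar>u y\<bar> powr p)
      \<le> ?S * ((?C + ennreal B) * ennreal (\<bar>u y\<bar> powr p) + ennreal A * (exterior_potential y * ennreal (\<bar>u y\<bar> powr p)))"
    proof (cases "y \<in> \<Omega>")
      case True
      have "(\<integral>\<^sup>+ (w::'a). riesz {..<D} 0 w * ennreal (min 1 (4 * norm w / bdist y) powr p) \<partial>lborel)
        \<le> ?S * (?C + ennreal (ln (1 / bdist y)))"
        by (intro truncated_riesz_integral bdist_pos bdist_le True)
      also have "\<dots> \<le> ?S * (?C + (ennreal A * exterior_potential y + ennreal B))"
        by (intro mult_left_mono add_left_mono AB(3) True) auto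
      finally have "(\<integral>\<^sup>+ (w::'a). riesz {..<D} 0 w * ennreal (min 1 (4 * norm w / bdist y) powr p) \<partial>lborel) * ennreal (\<bar>u y\<bar> powr p)
        \<le> ?S * (?C + (ennreal A * exterior_potential y + ennreal B)) * ennreal (\<bar>u y\<bar> powr p)"
        by (rule mult_right_mono) auto
      also have "\<dots> = ?S * ((?C + ennreal B) * ennreal (\<bar>u y\<bar> powr p) + ennreal A * (exterior_potential y * ennreal (\<bar>u y\<bar> powr p)))"
        by (simp only: distrib_left distrib_right mult.assoc add_ac)
      finally show ?thesis .
    qed (simp add: u0)
  qed
  also have "\<dots> = ?S * ((?C + ennreal B) * mass p u + ennreal A * (\<integral>\<^sup>+ y. exterior_potential y * ennreal (\<bar>u y\<bar> powr p) \<partial>lborel))"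
    unfolding mass_def by (simp add: nn_integral_cmult nn_integral_add)
  also have "\<dots> \<le> ?S * ((?C + ennreal B) * mass p u + ennreal A * near_energy 0 u)"
    by (intro mult_left_mono add_left_mono W) auto
  also have "\<dots> < \<infinity>" using m fin by (simp add: ennreal_mult_less_top)
  finally show ?thesis .
qed

definition cutoff :: "nat \<Rightarrow> 'a \<Rightarrow> real" where
  "cutoff n x = min 1 (max 0 (real n * bdist x - 1))"

lemma cutoff_measurable [measurable]: "cutoff n \<in> borel_measurable borel"
  unfolding cutoff_def[abs_def] by measurable

lemma cutoff_bounds: "0 \<le> cutoff n x" "cutoff n x \<le> 1"
  by (auto simp: cutoff_def)

text \<open>
  A bound that does not depend on \<open>n\<close>: if \<open>n\<close> is at most \<open>4 / dist(y, \<partial>\<Omega>)\<close>, the Lipschitz constant of the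
  cutoff suffices; otherwise the cutoff is \<open>1\<close> near \<open>y\<close>.
\<close>
lemma cutoff_diff_le:
  assumes "y \<in> \<Omega>"
  shows "\<bar>cutoff n x - cutoff n y\<bar> \<le> min 1 (4 * norm (x - y) / bdist y)"
proof -
  define d where "d = bdist y"
  have d: "0 < d" using bdist_pos assms by (simp add: d_def)
  have 1: "\<bar>cutoff n x - cutoff n y\<bar> \<le> 1" using cutoff_bounds[of n x] cutoff_bounds[of n y] by linarith
  have "\<bar>cutoff n x - cutoff n y\<bar> \<le> 4 * norm (x - y) / d"
  proof (cases "real n \<le> 4 / d")
    case True
    have "\<bar>cutoff n x - cutoff n y\<bar> \<le> \<bar>real n * bdist x - real n * bdist y\<bar>"
      by (auto simp: cutoff_def min_def max_def)
    also have "\<dots> = real n * \<bar>bdist x - bdist y\<bar>" by (simp add: right_diff_distrib[symmetric] abs_mult)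
    also have "\<dots> \<le> 4 / d * norm (x - y)" using True d bdist_lipschitz[of x y] by (intro mult_mono) auto
    finally show ?thesis by simp
  next
    case False
    then have n: "real n * d > 4" using d by (simp add: field_simps)
    show ?thesis
    proof (cases "norm (x - y) < d / 2")
      case True
      then have "bdist x \<ge> d / 2" using bdist_lipschitz[of x y] by (simp add: d_def)
      then have "real n * bdist x \<ge> real n * (d / 2)" by (intro mult_left_mono) auto
      then have "cutoff n x = 1" "cutoff n y = 1" using n by (auto simp: cutoff_def d_def[symmetric])
      then show ?thesis using d by simp
    next
      case False
      then have "1 \<le> 4 * norm (x - y) / d" using d by (simp add: field_simps)
      then show ?thesis using 1 by linarith
    qed
  qed
  then show ?thesis using 1 by (simp add: d_def)
qed

lemma cutoff_eventually: "x \<in> \<Omega> \<Longrightarrow> eventually (\<lambda>n. cutoff n x = 1) sequentially"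
proof -
  assume "x \<in> \<Omega>"
  then have d: "0 < bdist x" by (rule bdist_pos)
  obtain n0 where "2 / bdist x < real n0" using reals_Archimedean2 by blast
  then show ?thesis
  proof (intro eventually_sequentiallyI)
    fix n assume "n0 \<le> n"
    then have "2 / bdist x < real n" using \<open>2 / bdist x < real n0\<close> by linarith
    then have "2 < real n * bdist x" using d by (simp add: field_simps)
    then show "cutoff n x = 1" by (simp add: cutoff_def)
  qed
qed

text \<open>
  Dominated convergence, with the integrand of the logarithmic Hardy inequality in the dominating function.
\<close>
lemma cutoff_approximation:
  assumes lip: "lipschitz_boundary \<Omega>"
    and [measurable]: "u \<in> borel_measurable borel" and u0: "\<And>x. x \<notin> \<Omega> \<Longrightarrow> u x = 0"
    and m: "mass p u < \<infinity>" and fin: "near_energy 0 u < \<infinity>"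
  shows "(\<lambda>n. near_energy 0 (\<lambda>x. u x * cutoff n x)) \<longlonglongrightarrow> near_energy 0 u"
    and "(\<lambda>n. mass p (\<lambda>x. u x * cutoff n x)) \<longlonglongrightarrow> mass p u"
proof -
  let ?P = "lborel \<Otimes>\<^sub>M lborel :: ('a \<times> 'a) measure"
  define h where "h z = ennreal (2 powr p) * (riesz {..<D} 0 (fst z - snd z) * ennreal (\<bar>u (fst z) - u (snd z)\<bar> powr p)
     + riesz {..<D} 0 (fst z - snd z) * (ennreal (min 1 (4 * norm (fst z - snd z) / bdist (snd z)) powr p)
    * ennreal (\<bar>u (snd z)\<bar> powr p)))" for z :: "'a \<times> 'a"
  have [measurable]: "h \<in> borel_measurable ?P" unfolding h_def by measurable
  have lim: "(\<lambda>n. u x * cutoff n x) \<longlonglongrightarrow> u x" for x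
  proof (cases "x \<in> \<Omega>")
    case True
    from cutoff_eventually[OF this] show ?thesis
      by (intro tendsto_eventually) (auto elim: eventually_mono)
  qed (simp add: u0)
  show "(\<lambda>n. mass p (\<lambda>x. u x * cutoff n x)) \<longlonglongrightarrow> mass p u"
    unfolding mass_def
  proof (rule nn_integral_dominated_convergence[where w="\<lambda>x. ennreal (\<bar>u x\<bar> powr p)"])
    have "\<bar>u x * cutoff n x\<bar> powr p \<le> \<bar>u x\<bar> powr p" for n x
      using cutoff_bounds[of n x] p_gt_1 by (intro powr_mono2) (auto simp: abs_mult mult_left_le)
    then show "AE x in lborel. ennreal (\<bar>u x * cutoff n x\<bar> powr p) \<le> ennreal (\<bar>u x\<bar> powr p)" for n
      by (intro AE_I2 ennreal_leI)
    show "AE x in lborel. (\<lambda>n. ennreal (\<bar>u x * cutoff n x\<bar> powr p)) \<longlonglongrightarrow> ennreal (\<bar>u x\<bar> powr p)"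
      using lim p_gt_1 by (intro AE_I2 tendsto_ennrealI tendsto_powr2 tendsto_rabs) auto
  qed (use m in \<open>auto simp: mass_def\<close>)
  show "(\<lambda>n. near_energy 0 (\<lambda>x. u x * cutoff n x)) \<longlonglongrightarrow> near_energy 0 u"
    unfolding near_energy_def
  proof (subst (1 2) interaction_pair; (measurable; fail)?)
    show "(\<lambda>n. \<integral>\<^sup>+ z. riesz {..<D} (0 * p) (fst z - snd z) * ennreal (\<bar>u (fst z) * cutoff n (fst z) - u (snd z) * cutoff n (snd z)\<bar> powr p) \<partial>?P)
      \<longlonglongrightarrow> (\<integral>\<^sup>+ z. riesz {..<D} (0 * p) (fst z - snd z) * ennreal (\<bar>u (fst z) - u (snd z)\<bar> powr p) \<partial>?P)"
    proof (rule nn_integral_dominated_convergence[where w=h])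
      have "(\<integral>\<^sup>+ z. h z \<partial>?P) = ennreal (2 powr p) * (near_energy 0 u + (\<integral>\<^sup>+ x. \<integral>\<^sup>+ y. riesz {..<D} 0 (x - y) * (ennreal (min 1 (4 * norm (x - y) / bdist y) powr p)
          * ennreal (\<bar>u y\<bar> powr p)) \<partial>lborel \<partial>lborel))"
        unfolding near_energy_def interaction_def
        by (subst lborel.nn_integral_fst[symmetric]) (auto simp: h_def nn_integral_cmult nn_integral_add)
      also have "\<dots> < \<infinity>"
        using log_hardy[OF lip _ u0 m fin] fin by (simp add: ennreal_mult_less_top)
      finally show "(\<integral>\<^sup>+ z. h z \<partial>?P) < \<infinity>" .
      show "AE z in ?P. riesz {..<D} (0 * p) (fst z - snd z) * ennreal (\<bar>u (fst z) * cutoff n (fst z) - u (snd z) * cutoff n (snd z)\<bar> powr p) \<le> h z" for n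
      proof (intro AE_I2)
        fix z :: "'a \<times> 'a"
        obtain x y where z: "z = (x, y)" by (cases z)
        let ?t = "min 1 (4 * norm (x - y) / bdist y)"
        have "\<bar>u y\<bar> * \<bar>cutoff n x - cutoff n y\<bar> \<le> \<bar>u y\<bar> * ?t"
          using cutoff_diff_le[of y n x] u0[of y] by (cases "y \<in> \<Omega>") (auto intro!: mult_left_mono)
        moreover have "\<bar>u x - u y\<bar> * cutoff n x \<le> \<bar>u x - u y\<bar>"
          using cutoff_bounds[of n x] by (intro mult_left_le) auto
        moreover have "u x * cutoff n x - u y * cutoff n y = (u x - u y) * cutoff n x + u y * (cutoff n x - cutoff n y)"
          by (simp add: algebra_simps)
        then have "\<bar>u x * cutoff n x - u y * cutoff n y\<bar> \<le> \<bar>(u x - u y) * cutoff n x\<bar> + \<bar>u y * (cutoff n x - cutoff n y)\<bar>"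
          by (metis abs_triangle_ineq)
        then have "\<bar>u x * cutoff n x - u y * cutoff n y\<bar> \<le> \<bar>u x - u y\<bar> * cutoff n x + \<bar>u y\<bar> * \<bar>cutoff n x - cutoff n y\<bar>"
          using cutoff_bounds[of n x] by (simp add: abs_mult)
        ultimately have "\<bar>u x * cutoff n x - u y * cutoff n y\<bar> \<le> \<bar>u x - u y\<bar> - (- (?t * \<bar>u y\<bar>))"
          by (simp only: mult.commute[of ?t] minus_minus diff_minus_eq_add)
        then have "\<bar>u x * cutoff n x - u y * cutoff n y\<bar> \<le> \<bar>\<bar>u x - u y\<bar> - (- (?t * \<bar>u y\<bar>))\<bar>"
          by (rule order_trans[OF _ abs_ge_self])
        then have "\<bar>u x * cutoff n x - u y * cutoff n y\<bar> powr p \<le> \<bar>\<bar>u x - u y\<bar> - (- (?t * \<bar>u y\<bar>))\<bar> powr p"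
          using p_gt_1 by (intro powr_mono2) auto
        also have "\<dots> \<le> 2 powr p * (\<bar>\<bar>u x - u y\<bar>\<bar> powr p + \<bar>- (?t * \<bar>u y\<bar>)\<bar> powr p)"
          using p_gt_1 by (intro powr_abs_diff_le) auto
        also have "\<bar>- (?t * \<bar>u y\<bar>)\<bar> powr p = ?t powr p * \<bar>u y\<bar> powr p"
        proof -
          have "0 \<le> ?t" using infdist_nonneg[of y "- \<Omega>"] by (simp add: bdist_def)
          then show ?thesis by (simp add: abs_mult powr_mult)
        qed
        finally have "ennreal (\<bar>u x * cutoff n x - u y * cutoff n y\<bar> powr p)
          \<le> ennreal (2 powr p) * (ennreal (\<bar>u x - u y\<bar> powr p) + ennreal (?t powr p) * ennreal (\<bar>u y\<bar> powr p))"
          by (simp add: ennreal_mult'[symmetric] ennreal_plus[symmetric] ennreal_leI del: ennreal_plus)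
        then have "riesz {..<D} 0 (x - y) * ennreal (\<bar>u x * cutoff n x - u y * cutoff n y\<bar> powr p)
          \<le> riesz {..<D} 0 (x - y) * (ennreal (2 powr p) * (ennreal (\<bar>u x - u y\<bar> powr p) + ennreal (?t powr p) * ennreal (\<bar>u y\<bar> powr p)))"
          by (rule mult_left_mono) auto
        also have "\<dots> = h z" by (simp only: z h_def fst_conv snd_conv distrib_left mult_ac)
        finally show "riesz {..<D} (0 * p) (fst z - snd z) * ennreal (\<bar>u (fst z) * cutoff n (fst z) - u (snd z) * cutoff n (snd z)\<bar> powr p) \<le> h z"
          by (simp add: z)
      qed
      show "AE z in ?P. (\<lambda>n. riesz {..<D} (0 * p) (fst z - snd z) * ennreal (\<bar>u (fst z) * cutoff n (fst z) - u (snd z) * cutoff n (snd z)\<bar> powr p))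
        \<longlonglongrightarrow> riesz {..<D} (0 * p) (fst z - snd z) * ennreal (\<bar>u (fst z) - u (snd z)\<bar> powr p)"
      proof (intro AE_I2 ennreal_tendsto_cmult)
        fix z :: "'a \<times> 'a"
        show "riesz {..<D} (0 * p) (fst z - snd z) < top" by (simp add: riesz_def ennreal_mult_less_top split: split_indicator)
        show "(\<lambda>n. ennreal (\<bar>u (fst z) * cutoff n (fst z) - u (snd z) * cutoff n (snd z)\<bar> powr p)) \<longlonglongrightarrow> ennreal (\<bar>u (fst z) - u (snd z)\<bar> powr p)"
          using lim p_gt_1 by (intro tendsto_ennrealI tendsto_powr2 tendsto_rabs tendsto_diff) auto
      qed
    qed auto
  qed
qed

end

section \<open>Density of Lipschitz functions\<close>

lemma has_real_derivative_abs_powr: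
  fixes t p :: real
  assumes p: "1 < p"
  shows "((\<lambda>t. \<bar>t\<bar> powr p) has_real_derivative p * sgn t * \<bar>t\<bar> powr (p - 1)) (at t)"
proof (cases t "0::real" rule: linorder_cases)
  case equal
  have "((\<lambda>h. \<bar>h\<bar> powr (p - 1)) \<longlongrightarrow> 0 powr (p - 1)) (at (0::real))"
    using p by (intro tendsto_powr2 tendsto_rabs_zero tendsto_ident_at tendsto_const) auto
  then have "((\<lambda>h. \<bar>h\<bar> powr (p - 1)) \<longlongrightarrow> 0) (at (0::real))" by simp
  then have "((\<lambda>h. (\<bar>h\<bar> powr p - \<bar>0\<bar> powr p) / (h - 0)) \<longlongrightarrow> 0) (at (0::real))"
  proof (rule Lim_null_comparison[rotated])
    show "\<forall>\<^sub>F h in at (0::real). norm ((\<bar>h\<bar> powr p - \<bar>0\<bar> powr p) / (h - 0)) \<le> \<bar>h\<bar> powr (p - 1)"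
      by (auto simp: eventually_at_filter powr_diff)
  qed
  then show ?thesis using equal by (simp add: has_field_derivative_iff)
next
  case less
  have "((\<lambda>t. (- t) powr p) has_real_derivative p * sgn t * \<bar>t\<bar> powr (p - 1)) (at t)"
    using less by (auto intro!: derivative_eq_intros)
  then show ?thesis
    by (rule has_field_derivative_transform_within_open[where S="{..<0}"]) (use less in auto)
next
  case greater
  have "((\<lambda>t. t powr p) has_real_derivative p * sgn t * \<bar>t\<bar> powr (p - 1)) (at t)"
    using greater by (auto intro!: derivative_eq_intros)
  then show ?thesis
    by (rule has_field_derivative_transform_within_open[where S="{0<..}"]) (use greater in auto)
qed

lemma abs_powr_derivative_strict_mono:
  fixes s t p :: real
  assumes "1 < p" "s < t"
  shows "p * sgn s * \<bar>s\<bar> powr (p - 1) < p * sgn t * \<bar>t\<bar> powr (p - 1)"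
proof -
  have "sgn s * \<bar>s\<bar> powr (p - 1) < sgn t * \<bar>t\<bar> powr (p - 1)"
  proof (cases "0 \<le> s \<or> t \<le> 0")
    case True
    then show ?thesis
    proof
      assume "0 \<le> s"
      then have "\<bar>s\<bar> powr (p - 1) < \<bar>t\<bar> powr (p - 1)" using assms by (intro powr_less_mono2) auto
      then show ?thesis using assms \<open>0 \<le> s\<close> by (cases "s = 0") auto
    next
      assume "t \<le> 0"
      then have "\<bar>t\<bar> powr (p - 1) < \<bar>s\<bar> powr (p - 1)" using assms by (intro powr_less_mono2) auto
      then show ?thesis using assms \<open>t \<le> 0\<close> by (cases "t = 0") auto
    qed
  next
    case False
    then have pos: "0 < \<bar>s\<bar> powr (p - 1)" "0 < \<bar>t\<bar> powr (p - 1)" by auto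
    have "sgn s = -1" "sgn t = 1" using False by auto
    then show ?thesis using pos by (simp only: mult_minus1 mult_1)
  qed
  then show ?thesis using assms by (simp add: mult.assoc)
qed

lemma convex_abs_powr:
  assumes "1 < p" shows "convex_on UNIV (\<lambda>t::real. \<bar>t\<bar> powr p)"
proof (rule convex_on_realI[OF connected_UNIV has_real_derivative_abs_powr[OF assms]])
  fix s t :: real assume "s \<le> t"
  then show "p * sgn s * \<bar>s\<bar> powr (p - 1) \<le> p * sgn t * \<bar>t\<bar> powr (p - 1)"
    using abs_powr_derivative_strict_mono[OF assms, of s t] by (cases "s = t") auto
qed

text \<open>
  Convexity at the points \<open>a / (1 - t)\<close> and \<open>b / t\<close>.  It replaces Minkowski's inequality for small
  perturbations \<open>b\<close>: the factor of \<open>\<bar>a\<bar>\<^sup>p\<close> is close to \<open>1\<close> for small \<open>t\<close>.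
\<close>
lemma powr_add_le_weighted:
  fixes a b :: real
  assumes p: "1 < p" and t: "0 < t" "t < 1"
  shows "\<bar>a + b\<bar> powr p \<le> (1 - t) powr (1 - p) * \<bar>a\<bar> powr p + t powr (1 - p) * \<bar>b\<bar> powr p"
proof -
  have "\<bar>(1 - t) *\<^sub>R (a / (1 - t)) + t *\<^sub>R (b / t)\<bar> powr p
     \<le> (1 - t) * \<bar>a / (1 - t)\<bar> powr p + t * \<bar>b / t\<bar> powr p"
    using t by (intro convex_onD[OF convex_abs_powr[OF p]]) auto
  moreover have "r * \<bar>c / r\<bar> powr p = r powr (1 - p) * \<bar>c\<bar> powr p" if "0 < r" for r c :: real
    using that by (simp add: powr_divide powr_diff)
  ultimately show ?thesis using t by simp
qed

lemma (in prob_space) jensen_abs_powr: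
  assumes p: "1 < p" and X: "integrable M X"
  shows "ennreal (\<bar>expectation X\<bar> powr p) \<le> (\<integral>\<^sup>+ z. ennreal (\<bar>X z\<bar> powr p) \<partial>M)"
proof (cases "(\<integral>\<^sup>+ z. ennreal (\<bar>X z\<bar> powr p) \<partial>M) = \<infinity>")
  case False
  have [measurable]: "X \<in> borel_measurable M" using X by auto
  have int: "integrable M (\<lambda>z. \<bar>X z\<bar> powr p)"
    using False by (auto simp: integrable_iff_bounded less_top)
  have "\<bar>expectation X\<bar> powr p \<le> expectation (\<lambda>z. \<bar>X z\<bar> powr p)"
    by (rule jensens_inequality[OF X _ _ int convex_abs_powr[OF p]]) auto
  then show ?thesis by (subst nn_integral_eq_integral[OF int]) (auto intro: ennreal_leI)
qed simp

text \<open>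
  Jensen's inequality for each pair of points, followed by the invariance of the energy under translations.
\<close>
lemma interaction_average_le:
  fixes k :: "'a::euclidean_space \<Rightarrow> ennreal" and M :: "'a measure"
  assumes p: "1 < p" and [measurable]: "k \<in> borel_measurable borel" "v \<in> borel_measurable borel"
    and M: "prob_space M" and sets_M [measurable_cong]: "sets M = sets borel"
    and int: "\<And>x. integrable M (\<lambda>z. v (x - z))"
  shows "interaction k p (\<lambda>x. \<integral>z. v (x - z) \<partial>M) \<le> interaction k p v"
proof -
  interpret M: prob_space M by (rule M)
  interpret LM: pair_sigma_finite lborel M ..
  have "interaction k p (\<lambda>x. \<integral>z. v (x - z) \<partial>M)
     \<le> (\<integral>\<^sup>+ x. \<integral>\<^sup>+ y. \<integral>\<^sup>+ z. k (x - y) * ennreal (\<bar>v (x - z) - v (y - z)\<bar> powr p) \<partial>M \<partial>lborel \<partial>lborel)"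
    unfolding interaction_def
  proof (intro nn_integral_mono)
    fix x y :: 'a
    have "ennreal (\<bar>\<integral>z. v (x - z) - v (y - z) \<partial>M\<bar> powr p) \<le> (\<integral>\<^sup>+ z. ennreal (\<bar>v (x - z) - v (y - z)\<bar> powr p) \<partial>M)"
      using p int by (intro M.jensen_abs_powr) auto
    moreover have "(\<integral>z. v (x - z) - v (y - z) \<partial>M) = (\<integral>z. v (x - z) \<partial>M) - (\<integral>z. v (y - z) \<partial>M)"
      using int by simp
    ultimately have "ennreal (\<bar>(\<integral>z. v (x - z) \<partial>M) - (\<integral>z. v (y - z) \<partial>M)\<bar> powr p) \<le> (\<integral>\<^sup>+ z. ennreal (\<bar>v (x - z) - v (y - z)\<bar> powr p) \<partial>M)"
      by simp
    then have "k (x - y) * ennreal (\<bar>(\<integral>z. v (x - z) \<partial>M) - (\<integral>z. v (y - z) \<partial>M)\<bar> powr p)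
       \<le> k (x - y) * (\<integral>\<^sup>+ z. ennreal (\<bar>v (x - z) - v (y - z)\<bar> powr p) \<partial>M)"
      by (rule mult_left_mono) auto
    also have "\<dots> = (\<integral>\<^sup>+ z. k (x - y) * ennreal (\<bar>v (x - z) - v (y - z)\<bar> powr p) \<partial>M)"
      by (rule nn_integral_cmult[symmetric]) measurable
    finally show "k (x - y) * ennreal (\<bar>(\<integral>z. v (x - z) \<partial>M) - (\<integral>z. v (y - z) \<partial>M)\<bar> powr p)
       \<le> (\<integral>\<^sup>+ z. k (x - y) * ennreal (\<bar>v (x - z) - v (y - z)\<bar> powr p) \<partial>M)" .
  qed
  also have "\<dots> = (\<integral>\<^sup>+ x. \<integral>\<^sup>+ z. \<integral>\<^sup>+ y. k (x - y) * ennreal (\<bar>v (x - z) - v (y - z)\<bar> powr p) \<partial>lborel \<partial>M \<partial>lborel)"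
    by (intro nn_integral_cong LM.Fubini'[symmetric]) measurable
  also have "\<dots> = (\<integral>\<^sup>+ z. \<integral>\<^sup>+ x. \<integral>\<^sup>+ y. k (x - y) * ennreal (\<bar>v (x - z) - v (y - z)\<bar> powr p) \<partial>lborel \<partial>lborel \<partial>M)"
    by (intro LM.Fubini'[symmetric]) measurable
  also have "\<dots> = (\<integral>\<^sup>+ z. interaction k p v \<partial>M)"
  proof (intro nn_integral_cong)
    fix z :: 'a
    have "(\<integral>\<^sup>+ y. k (x - y) * ennreal (\<bar>v (x - z) - v (y - z)\<bar> powr p) \<partial>lborel)
      = (\<integral>\<^sup>+ y. k ((x - z) - y) * ennreal (\<bar>v (x - z) - v y\<bar> powr p) \<partial>lborel)" for x
      using nn_integral_translate[of "\<lambda>y. k ((x - z) - y) * ennreal (\<bar>v (x - z) - v y\<bar> powr p)" z] by simp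
    then have "(\<integral>\<^sup>+ x. \<integral>\<^sup>+ y. k (x - y) * ennreal (\<bar>v (x - z) - v (y - z)\<bar> powr p) \<partial>lborel \<partial>lborel)
       = (\<integral>\<^sup>+ x. \<integral>\<^sup>+ y. k ((x - z) - y) * ennreal (\<bar>v (x - z) - v y\<bar> powr p) \<partial>lborel \<partial>lborel)" by simp
    also have "\<dots> = interaction k p v"
      unfolding interaction_def
      using nn_integral_translate[of "\<lambda>x. \<integral>\<^sup>+ y. k (x - y) * ennreal (\<bar>v x - v y\<bar> powr p) \<partial>lborel" z] by simp
    finally show "(\<integral>\<^sup>+ x. \<integral>\<^sup>+ y. k (x - y) * ennreal (\<bar>v (x - z) - v (y - z)\<bar> powr p) \<partial>lborel \<partial>lborel) = interaction k p v" .
  qed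
  also have "\<dots> = interaction k p v" using M.emeasure_space_1 by simp
  finally show ?thesis .
qed

definition tent :: "real \<Rightarrow> 'a::euclidean_space \<Rightarrow> real" where
  "tent \<epsilon> z = max 0 (1 - norm z / \<epsilon>)"

definition tent_mass :: "real \<Rightarrow> 'a::euclidean_space itself \<Rightarrow> real" where
  "tent_mass \<epsilon> _ = (\<integral>z. tent \<epsilon> (z::'a) \<partial>lborel)"

definition mollifier :: "real \<Rightarrow> 'a::euclidean_space \<Rightarrow> real" where
  "mollifier \<epsilon> z = tent \<epsilon> z / tent_mass \<epsilon> TYPE('a)"

lemma tent_measurable [measurable]: "tent \<epsilon> \<in> borel_measurable borel"
  unfolding tent_def[abs_def] by measurable

lemma mollifier_measurable [measurable]: "mollifier \<epsilon> \<in> borel_measurable borel"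
  unfolding mollifier_def[abs_def] by measurable

lemma tent_integrable:
  assumes "0 < \<epsilon>" shows "integrable lborel (tent \<epsilon> :: 'a::euclidean_space \<Rightarrow> real)"
proof (rule Bochner_Integration.integrable_bound)
  show "integrable lborel (\<lambda>z::'a. indicator (ball 0 \<epsilon>) z :: real)"
    using emeasure_lborel_ball_finite[of "0::'a" \<epsilon>] by (intro integrable_real_indicator) auto
  show "AE z in lborel. norm (tent \<epsilon> (z::'a)) \<le> norm (indicator (ball 0 \<epsilon>) z :: real)"
    using assms by (auto simp: tent_def split: split_indicator)
qed auto

lemma tent_mass_ge:
  assumes "0 < \<epsilon>"
  shows "unit_ball_vol (real DIM('a::euclidean_space)) * (\<epsilon> / 2) ^ DIM('a) / 2 \<le> tent_mass \<epsilon> TYPE('a)"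
proof -
  have "(\<integral>z. indicator (ball 0 (\<epsilon> / 2)) (z::'a) / 2 \<partial>lborel) \<le> tent_mass \<epsilon> TYPE('a)"
    unfolding tent_mass_def
  proof (rule integral_mono[OF _ tent_integrable[OF assms]])
    show "integrable lborel (\<lambda>z::'a. indicator (ball 0 (\<epsilon> / 2)) z / 2 :: real)"
      using emeasure_lborel_ball_finite[of "0::'a" "\<epsilon> / 2"] by (intro integrable_divide_zero integrable_real_indicator) auto
    show "indicator (ball 0 (\<epsilon> / 2)) z / 2 \<le> tent \<epsilon> z" for z :: 'a
      using assms by (auto simp: tent_def field_simps split: split_indicator)
  qed
  also have "(\<integral>z. indicator (ball 0 (\<epsilon> / 2)) (z::'a) / 2 \<partial>lborel) = unit_ball_vol (real DIM('a)) * (\<epsilon> / 2) ^ DIM('a) / 2"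
    using emeasure_ball_real[of "\<epsilon> / 2" "0::'a"] assms by (simp add: measure_def)
  finally show ?thesis .
qed

lemma tent_mass_pos: "0 < \<epsilon> \<Longrightarrow> 0 < tent_mass \<epsilon> TYPE('a::euclidean_space)"
  by (rule less_le_trans[OF _ tent_mass_ge]) auto

lemma mollifier_nonneg: "0 < \<epsilon> \<Longrightarrow> 0 \<le> mollifier \<epsilon> (z::'a::euclidean_space)"
  using tent_mass_pos[of \<epsilon>, where 'a='a] by (simp add: mollifier_def tent_def)

lemma prob_space_mollifier:
  assumes "0 < \<epsilon>" shows "prob_space (density lborel (\<lambda>z::'a::euclidean_space. ennreal (mollifier \<epsilon> z)))"
proof (rule prob_spaceI)
  have "integrable lborel (mollifier \<epsilon> :: 'a \<Rightarrow> real)"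
    unfolding mollifier_def[abs_def] using tent_integrable[OF assms, where 'a='a] by simp
  moreover have "(\<integral>z. mollifier \<epsilon> (z::'a) \<partial>lborel) = 1"
    using tent_mass_pos[OF assms, where 'a='a] by (simp add: mollifier_def tent_mass_def)
  ultimately have "(\<integral>\<^sup>+ (z::'a). ennreal (mollifier \<epsilon> z) \<partial>lborel) = 1"
    using mollifier_nonneg[OF assms] by (subst nn_integral_eq_integral) auto
  then show "emeasure (density lborel (\<lambda>z::'a. ennreal (mollifier \<epsilon> z))) (space (density lborel (\<lambda>z::'a. ennreal (mollifier \<epsilon> z)))) = 1"
    by (simp add: emeasure_density cong: nn_integral_cong)
qed

text \<open>
  On its support, the ball of radius \<open>\<epsilon>\<close>, the mollifier is at most a multiple of \<open>\<epsilon>\<^bsup>-N\<^esup> \<le> \<bar>z\<bar>\<^bsup>-N\<^esup>\<close>.  This is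
  why the \<open>L\<^sup>p\<close> distance to a mollification is bounded by the energy at distances below \<open>\<epsilon>\<close>.
\<close>
lemma mollifier_le_riesz:
  assumes "0 < \<epsilon>" "z \<noteq> 0"
  shows "ennreal (mollifier \<epsilon> z) \<le> ennreal (2 ^ (DIM('a) + 1) / unit_ball_vol (real DIM('a))) * riesz {..<\<epsilon>} 0 (z::'a::euclidean_space)"
proof (cases "norm z < \<epsilon>")
  case False
  then have "mollifier \<epsilon> z = 0" using assms by (simp add: mollifier_def tent_def)
  then show ?thesis by simp
next
  case True
  let ?w = "unit_ball_vol (real DIM('a))"
  have w: "?w > 0" by simp
  have "tent \<epsilon> z \<le> 1" using assms by (simp add: tent_def)
  then have "mollifier \<epsilon> z \<le> 1 / tent_mass \<epsilon> TYPE('a)"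
    unfolding mollifier_def using tent_mass_pos[OF assms(1), where 'a='a] by (intro divide_right_mono) auto
  also have "\<dots> \<le> 1 / (?w * (\<epsilon> / 2) ^ DIM('a) / 2)"
    using assms w by (intro divide_left_mono tent_mass_ge mult_pos_pos tent_mass_pos) auto
  also have "\<dots> = 2 ^ (DIM('a) + 1) / ?w * (1 / \<epsilon> ^ DIM('a))"
    by (simp add: power_divide field_simps)
  also have "\<dots> \<le> 2 ^ (DIM('a) + 1) / ?w * (norm z powr - real DIM('a))"
  proof (rule mult_left_mono)
    have "norm z ^ DIM('a) \<le> \<epsilon> ^ DIM('a)" using True by (intro power_mono) auto
    then show "1 / \<epsilon> ^ DIM('a) \<le> norm z powr - real DIM('a)"
      using assms by (simp add: powr_minus powr_realpow field_simps)
  qed (use w in auto)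
  finally show ?thesis using True w by (simp add: riesz_def ennreal_mult'[symmetric] ennreal_leI)
qed

lemma tent_lipschitz:
  assumes "0 < \<epsilon>" shows "\<bar>tent \<epsilon> a - tent \<epsilon> b\<bar> \<le> norm (a - b) / \<epsilon>"
proof -
  have "\<bar>tent \<epsilon> a - tent \<epsilon> b\<bar> \<le> \<bar>norm a / \<epsilon> - norm b / \<epsilon>\<bar>"
    by (auto simp: tent_def max_def)
  also have "\<dots> = \<bar>norm a - norm b\<bar> / \<epsilon>" using assms by (simp add: diff_divide_distrib[symmetric])
  also have "\<dots> \<le> norm (a - b) / \<epsilon>" using assms norm_triangle_ineq3[of a b] by (intro divide_right_mono) auto
  finally show ?thesis .
qed

context bounded_domain
begin

lemma Lp_imp_integrable:
  assumes [measurable]: "v \<in> borel_measurable borel" and v0: "\<And>x. x \<notin> \<Omega> \<Longrightarrow> v x = 0" and m: "mass p v < \<infinity>"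
  shows "integrable lborel v"
proof (rule Bochner_Integration.integrable_bound)
  have "integrable lborel (\<lambda>x. \<bar>v x\<bar> powr p)"
    using m by (simp add: integrable_iff_bounded mass_def)
  then show "integrable lborel (\<lambda>x. indicator \<Omega> x + \<bar>v x\<bar> powr p)"
    using emeasure_domain by (intro Bochner_Integration.integrable_add integrable_real_indicator) auto
  show "AE x in lborel. norm (v x) \<le> norm (indicator \<Omega> x + \<bar>v x\<bar> powr p)"
  proof (intro AE_I2)
    fix x :: 'a
    have "\<bar>v x\<bar> \<le> 1 + \<bar>v x\<bar> powr p"
    proof (cases "\<bar>v x\<bar> \<le> 1")
      case False
      then have "\<bar>v x\<bar> powr 1 \<le> \<bar>v x\<bar> powr p" using p_gt_1 by (intro powr_mono) auto
      then show ?thesis using False by simp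
    qed (simp add: add_increasing2)
    then show "norm (v x) \<le> norm (indicator \<Omega> x + \<bar>v x\<bar> powr p)"
      using v0[of x] by (auto split: split_indicator)
  qed
qed auto

lemma mollify_in_core:
  assumes [measurable]: "v \<in> borel_measurable borel" and m: "mass p v < \<infinity>"
    and \<epsilon>: "0 < \<epsilon>" and inner: "\<And>x. bdist x < \<epsilon> \<Longrightarrow> v x = 0"
  shows "(\<lambda>x. \<integral>z. v (x - z) \<partial>density lborel (\<lambda>z. ennreal (mollifier \<epsilon> z))) \<in> lipschitz_core"
    and "\<And>x. integrable (density lborel (\<lambda>z. ennreal (mollifier \<epsilon> z))) (\<lambda>z. v (x - z))"
proof -
  have v0: "v x = 0" if "x \<notin> \<Omega>" for x using inner[of x] bdist_zero[OF that] \<epsilon> by simp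
  have int_v: "integrable lborel v" by (rule Lp_imp_integrable[OF assms(1) v0 m])
  let ?c = "tent_mass \<epsilon> TYPE('a)"
  have c: "0 < ?c" by (rule tent_mass_pos[OF \<epsilon>])
  have nn: "0 \<le> mollifier \<epsilon> z" "mollifier \<epsilon> z \<le> 1 / ?c" for z :: 'a
    using mollifier_nonneg[OF \<epsilon>, of z] c \<epsilon> by (auto simp: mollifier_def tent_def field_simps)
  have int_prod: "integrable lborel (\<lambda>z. mollifier \<epsilon> z * v (x - z))" for x
  proof (rule Bochner_Integration.integrable_bound)
    show "integrable lborel (\<lambda>z. 1 / ?c * v (x - z))" by (intro integrable_mult_right integrable_reflect_translate int_v)
    show "AE z in lborel. norm (mollifier \<epsilon> z * v (x - z)) \<le> norm (1 / ?c * v (x - z))"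
    proof (intro AE_I2)
      fix z
      have "\<bar>mollifier \<epsilon> z\<bar> * \<bar>v (x - z)\<bar> \<le> \<bar>1 / ?c\<bar> * \<bar>v (x - z)\<bar>"
        using nn[of z] c by (intro mult_right_mono) auto
      then show "norm (mollifier \<epsilon> z * v (x - z)) \<le> norm (1 / ?c * v (x - z))"
        by (simp only: real_norm_def abs_mult)
    qed
  qed auto
  show int: "integrable (density lborel (\<lambda>z. ennreal (mollifier \<epsilon> z))) (\<lambda>z. v (x - z))" for x
    using int_prod[of x] nn by (subst integrable_density) auto
  define w where "w x = (\<integral>z. v (x - z) \<partial>density lborel (\<lambda>z. ennreal (mollifier \<epsilon> z)))" for x
  have w_eq: "w x = (\<integral>z. mollifier \<epsilon> z * v (x - z) \<partial>lborel)" for x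
    unfolding w_def using nn by (subst integral_density) auto
  have w_eq2: "w x = (\<integral>z. mollifier \<epsilon> (x - z) * v z \<partial>lborel)" for x
    unfolding w_eq using integral_reflect_translate[of "\<lambda>z. mollifier \<epsilon> z * v (x - z)" x] by simp
  have int2: "integrable lborel (\<lambda>z. mollifier \<epsilon> (x - z) * v z)" for x
    using integrable_reflect_translate[OF int_prod[of x], of x] by simp
  have "w x = 0" if x: "x \<notin> \<Omega>" for x
  proof -
    have "mollifier \<epsilon> z * v (x - z) = 0" for z
    proof (cases "norm z < \<epsilon>")
      case True
      then have "bdist (x - z) < \<epsilon>" using bdist_lipschitz[of "x - z" x] bdist_zero[OF x] by simp
      then show ?thesis by (simp add: inner)
    qed (use \<epsilon> in \<open>simp add: mollifier_def tent_def\<close>)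
    then show ?thesis unfolding w_eq by (simp only: Bochner_Integration.integral_zero)
  qed
  moreover have "\<bar>w x - w y\<bar> \<le> (1 / (\<epsilon> * ?c) * (\<integral>z. \<bar>v z\<bar> \<partial>lborel)) * norm (x - y)" for x y
  proof -
    have "\<bar>w x - w y\<bar> = \<bar>\<integral>z. mollifier \<epsilon> (x - z) * v z - mollifier \<epsilon> (y - z) * v z \<partial>lborel\<bar>"
      unfolding w_eq2 using int2 by simp
    also have "\<dots> \<le> (\<integral>z. norm (mollifier \<epsilon> (x - z) * v z - mollifier \<epsilon> (y - z) * v z) \<partial>lborel)"
      using integral_norm_bound[of lborel "\<lambda>z. mollifier \<epsilon> (x - z) * v z - mollifier \<epsilon> (y - z) * v z"] by simp
    also have "\<dots> \<le> (\<integral>z. (norm (x - y) / (\<epsilon> * ?c)) * \<bar>v z\<bar> \<partial>lborel)"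
    proof (rule integral_mono)
      show "integrable lborel (\<lambda>z. norm (mollifier \<epsilon> (x - z) * v z - mollifier \<epsilon> (y - z) * v z))"
        using int2 by auto
      show "integrable lborel (\<lambda>z. (norm (x - y) / (\<epsilon> * ?c)) * \<bar>v z\<bar>)" using int_v by auto
      fix z
      have "\<bar>mollifier \<epsilon> (x - z) - mollifier \<epsilon> (y - z)\<bar> = \<bar>tent \<epsilon> (x - z) - tent \<epsilon> (y - z)\<bar> / ?c"
        using c by (simp add: mollifier_def diff_divide_distrib[symmetric])
      also have "\<dots> \<le> norm (x - y) / \<epsilon> / ?c"
        using tent_lipschitz[OF \<epsilon>, of "x - z" "y - z"] c by (intro divide_right_mono) auto
      finally have "\<bar>mollifier \<epsilon> (x - z) - mollifier \<epsilon> (y - z)\<bar> * \<bar>v z\<bar> \<le> norm (x - y) / (\<epsilon> * ?c) * \<bar>v z\<bar>"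
        by (intro mult_right_mono) auto
      then show "norm (mollifier \<epsilon> (x - z) * v z - mollifier \<epsilon> (y - z) * v z) \<le> (norm (x - y) / (\<epsilon> * ?c)) * \<bar>v z\<bar>"
        by (simp add: left_diff_distrib[symmetric] abs_mult)
    qed
    finally show ?thesis by (simp add: field_simps)
  qed
  moreover have "0 \<le> 1 / (\<epsilon> * ?c) * (\<integral>z. \<bar>v z\<bar> \<partial>lborel)"
    using \<epsilon> c by (intro mult_nonneg_nonneg integral_nonneg) auto
  ultimately have "w \<in> lipschitz_core" unfolding lipschitz_core_def by blast
  then show "(\<lambda>x. \<integral>z. v (x - z) \<partial>density lborel (\<lambda>z. ennreal (mollifier \<epsilon> z))) \<in> lipschitz_core"
    by (simp add: w_def[abs_def])
qed

text \<open>
  By Jensen's inequality the left-hand side is at most the average of \<open>\<bar>v x - v (x - z)\<bar>\<^sup>p\<close> with respect to the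
  mollifier, which is dominated by the kernel.  Hence finite energy makes mollifications converge in \<open>L\<^sup>p\<close>.
\<close>
lemma mass_mollify_diff_le:
  assumes [measurable]: "v \<in> borel_measurable borel" and m: "mass p v < \<infinity>"
    and \<epsilon>: "0 < \<epsilon>" and inner: "\<And>x. bdist x < \<epsilon> \<Longrightarrow> v x = 0"
  shows "mass p (\<lambda>x. v x - (\<integral>z. v (x - z) \<partial>density lborel (\<lambda>z. ennreal (mollifier \<epsilon> z))))
    \<le> ennreal (2 ^ (DIM('a) + 1) / unit_ball_vol (real DIM('a))) * interaction (riesz {..<\<epsilon>} 0) p v"
proof -
  let ?M = "density lborel (\<lambda>z::'a. ennreal (mollifier \<epsilon> z))" and ?C = "ennreal (2 ^ (DIM('a) + 1) / unit_ball_vol (real DIM('a)))"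
  interpret M: prob_space ?M by (rule prob_space_mollifier[OF \<epsilon>])
  have int: "\<And>x. integrable ?M (\<lambda>z. v (x - z))" by (rule mollify_in_core(2)[OF assms(1) m \<epsilon> inner])
  have "mass p (\<lambda>x. v x - (\<integral>z. v (x - z) \<partial>?M)) \<le> (\<integral>\<^sup>+ x. \<integral>\<^sup>+ y. ?C * (riesz {..<\<epsilon>} 0 (x - y) * ennreal (\<bar>v x - v y\<bar> powr p)) \<partial>lborel \<partial>lborel)"
    unfolding mass_def
  proof (intro nn_integral_mono)
    fix x :: 'a
    have "M.prob UNIV = 1" using M.prob_space by simp
    then have eq: "(\<integral>z. v x - v (x - z) \<partial>?M) = v x - (\<integral>z. v (x - z) \<partial>?M)"
      using int[of x] by (subst Bochner_Integration.integral_diff) auto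
    have "integrable ?M (\<lambda>z. v x - v (x - z))"
      using int[of x] by (intro Bochner_Integration.integrable_diff M.integrable_const) auto
    from M.jensen_abs_powr[OF p_gt_1 this]
    have "ennreal (\<bar>v x - (\<integral>z. v (x - z) \<partial>?M)\<bar> powr p) \<le> (\<integral>\<^sup>+ z. ennreal (\<bar>v x - v (x - z)\<bar> powr p) \<partial>?M)"
      unfolding eq .
    also have "\<dots> = (\<integral>\<^sup>+ z. ennreal (mollifier \<epsilon> z) * ennreal (\<bar>v x - v (x - z)\<bar> powr p) \<partial>lborel)"
      by (subst nn_integral_density) auto
    also have "\<dots> \<le> (\<integral>\<^sup>+ z. ?C * (riesz {..<\<epsilon>} 0 z * ennreal (\<bar>v x - v (x - z)\<bar> powr p)) \<partial>lborel)"
    proof (intro nn_integral_mono_AE, use AE_lborel_singleton[of 0] in eventually_elim)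
      fix z :: 'a assume "z \<noteq> 0"
      from mult_right_mono[OF mollifier_le_riesz[OF \<epsilon> this], of "ennreal (\<bar>v x - v (x - z)\<bar> powr p)"]
      show "ennreal (mollifier \<epsilon> z) * ennreal (\<bar>v x - v (x - z)\<bar> powr p)
        \<le> ?C * (riesz {..<\<epsilon>} 0 z * ennreal (\<bar>v x - v (x - z)\<bar> powr p))" by (simp add: mult.assoc)
    qed
    also have "\<dots> = (\<integral>\<^sup>+ y. ?C * (riesz {..<\<epsilon>} 0 (x - y) * ennreal (\<bar>v x - v y\<bar> powr p)) \<partial>lborel)"
      using nn_integral_reflect_translate[of "\<lambda>z. ?C * (riesz {..<\<epsilon>} 0 z * ennreal (\<bar>v x - v (x - z)\<bar> powr p))" x] by simp
    finally show "ennreal (\<bar>v x - (\<integral>z. v (x - z) \<partial>?M)\<bar> powr p) \<le> (\<integral>\<^sup>+ y. ?C * (riesz {..<\<epsilon>} 0 (x - y) * ennreal (\<bar>v x - v y\<bar> powr p)) \<partial>lborel)" .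
  qed
  also have "\<dots> = ?C * interaction (riesz {..<\<epsilon>} 0) p v"
    unfolding interaction_def by (simp add: nn_integral_cmult)
  finally show ?thesis .
qed

lemma tendsto_interaction_shrinking:
  assumes [measurable]: "v \<in> borel_measurable borel" and fin: "near_energy 0 v < \<infinity>"
  shows "(\<lambda>n. interaction (riesz {..<1 / real (Suc n)} 0) p v) \<longlonglongrightarrow> 0"
proof -
  let ?P = "lborel \<Otimes>\<^sub>M lborel :: ('a \<times> 'a) measure"
  have "(\<lambda>n. \<integral>\<^sup>+ z. riesz {..<1 / real (Suc n)} 0 (fst z - snd z) * ennreal (\<bar>v (fst z) - v (snd z)\<bar> powr p) \<partial>?P)
     \<longlonglongrightarrow> (\<integral>\<^sup>+ z. 0 \<partial>?P)"
  proof (rule nn_integral_dominated_convergence[where w="\<lambda>z. riesz {..<D} 0 (fst z - snd z) * ennreal (\<bar>v (fst z) - v (snd z)\<bar> powr p)"])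
    have "1 / real (Suc n) \<le> D" for n
    proof -
      have "1 / real (Suc n) \<le> 1" by simp
      then show ?thesis using D_ge_1 by linarith
    qed
    then show "AE z in ?P. riesz {..<1 / real (Suc n)} 0 (fst z - snd z) * ennreal (\<bar>v (fst z) - v (snd z)\<bar> powr p)
       \<le> riesz {..<D} 0 (fst z - snd z) * ennreal (\<bar>v (fst z) - v (snd z)\<bar> powr p)" for n
      by (intro AE_I2 mult_right_mono) (auto simp: riesz_def split: split_indicator dest: less_le_trans)
    show "(\<integral>\<^sup>+ z. riesz {..<D} 0 (fst z - snd z) * ennreal (\<bar>v (fst z) - v (snd z)\<bar> powr p) \<partial>?P) < \<infinity>"
      using fin unfolding near_energy_def by (subst (asm) interaction_pair) auto
    show "AE z in ?P. (\<lambda>n. riesz {..<1 / real (Suc n)} 0 (fst z - snd z) * ennreal (\<bar>v (fst z) - v (snd z)\<bar> powr p)) \<longlonglongrightarrow> 0"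
    proof (intro AE_I2)
      fix z :: "'a \<times> 'a"
      show "(\<lambda>n. riesz {..<1 / real (Suc n)} 0 (fst z - snd z) * ennreal (\<bar>v (fst z) - v (snd z)\<bar> powr p)) \<longlonglongrightarrow> 0"
      proof (cases "fst z = snd z")
        case False
        then have "0 < norm (fst z - snd z)" by simp
        then have "eventually (\<lambda>n. 1 / real (Suc n) < norm (fst z - snd z)) sequentially"
          using order_tendstoD(2)[OF LIMSEQ_Suc[OF lim_1_over_n[where 'a=real]]] by simp
        then show ?thesis
          by (intro tendsto_eventually) (auto elim!: eventually_mono simp: riesz_def)
      qed (simp add: riesz_def)
    qed
  qed auto
  then show ?thesis by (subst interaction_pair) auto
qed

text \<open>
  First cut off near the boundary, at the cost of \<open>\<delta>\<close> in energy and \<open>\<delta> / 2\<close> in mass; then mollify, at no cost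
  in energy and with a second loss of at most \<open>\<delta> / 2\<close> in mass.
\<close>
lemma lipschitz_core_dense:
  assumes lip: "lipschitz_boundary \<Omega>" and u: "u \<in> unit_X0" and \<delta>: "0 < \<delta>"
  shows "\<exists>v \<in> lipschitz_core. near_energy 0 v \<le> near_energy 0 u + ennreal \<delta> \<and> ennreal (1 - \<delta>) \<le> mass p v"
proof -
  have [measurable]: "u \<in> borel_measurable borel" and van: "vanishes_outside \<Omega> u"
    and mu: "mass p u = 1" and fu: "near_energy 0 u < \<infinity>" using u by (auto simp: unit_X0_iff)
  \<comment> \<open>A representative that vanishes at every point outside \<open>\<Omega>\<close>.\<close>
  define u' where "u' x = indicator \<Omega> x * u x" for x
  have [measurable]: "u' \<in> borel_measurable borel" unfolding u'_def[abs_def] by measurable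
  have u'0: "u' x = 0" if "x \<notin> \<Omega>" for x using that by (simp add: u'_def)
  have ae: "AE x in lborel. u' x = u x"
    using van unfolding vanishes_outside_def by eventually_elim (auto simp: u'_def split: split_indicator)
  have mu': "mass p u' = 1"
    unfolding mu[symmetric] mass_def by (intro nn_integral_cong_AE, use ae in eventually_elim) simp
  have fu': "near_energy 0 u' = near_energy 0 u"
    unfolding near_energy_def interaction_def
    by (intro nn_integral_cong_AE, use ae in eventually_elim, intro nn_integral_cong_AE, use ae in eventually_elim) simp
  have cut: "(\<lambda>n. near_energy 0 (\<lambda>x. u' x * cutoff n x)) \<longlonglongrightarrow> near_energy 0 u"
    "(\<lambda>n. mass p (\<lambda>x. u' x * cutoff n x)) \<longlonglongrightarrow> 1"
    using cutoff_approximation[OF lip, of u'] u'0 mu' fu fu' by auto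
  have "near_energy 0 u < near_energy 0 u + ennreal \<delta>"
    using fu \<delta> by (cases "near_energy 0 u") (auto simp: ennreal_plus[symmetric] ennreal_less_iff simp del: ennreal_plus)
  then have 1: "eventually (\<lambda>n. near_energy 0 (\<lambda>x. u' x * cutoff n x) < near_energy 0 u + ennreal \<delta>) sequentially"
    by (rule order_tendstoD(2)[OF cut(1)])
  have "ennreal (1 - \<delta> / 2) < 1" using \<delta> ennreal_lessI[of 1 "1 - \<delta> / 2"] by simp
  then have 2: "eventually (\<lambda>n. ennreal (1 - \<delta> / 2) < mass p (\<lambda>x. u' x * cutoff n x)) sequentially"
    by (rule order_tendstoD(1)[OF cut(2)])
  obtain n where n: "n > 0" "near_energy 0 (\<lambda>x. u' x * cutoff n x) < near_energy 0 u + ennreal \<delta>"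
    "ennreal (1 - \<delta> / 2) < mass p (\<lambda>x. u' x * cutoff n x)"
    using eventually_happens'[OF sequentially_bot eventually_conj[OF eventually_gt_at_top[of 0] eventually_conj[OF 1 2]]] by auto
  define v where "v x = u' x * cutoff n x" for x
  have [measurable]: "v \<in> borel_measurable borel" unfolding v_def[abs_def] by measurable
  have fv: "near_energy 0 v < near_energy 0 u + ennreal \<delta>" and mv: "ennreal (1 - \<delta> / 2) < mass p v"
    using n by (auto simp: v_def[abs_def])
  have fv': "near_energy 0 v < \<infinity>" using fv by (auto intro: less_le_trans)
  have "\<bar>v x\<bar> powr p \<le> \<bar>u' x\<bar> powr p" for x
    unfolding v_def using cutoff_bounds[of n x] p_gt_1 by (intro powr_mono2) (auto simp: abs_mult mult_left_le)
  then have mv1: "mass p v \<le> 1"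
    unfolding mu'[symmetric] mass_def by (intro nn_integral_mono ennreal_leI)
  define V where "V = enn2real (mass p v)"
  have "mass p v < top" using mv1 by (rule le_less_trans) simp
  then have V: "mass p v = ennreal V" "0 \<le> V" by (auto simp: V_def)
  have V2: "1 - \<delta> / 2 < V" using mv V by (cases "1 - \<delta> / 2 \<ge> 0") (auto simp: ennreal_less_iff)
  have inner: "v x = 0" if "bdist x < 1 / real (Suc m)" "m \<ge> n" for x m
  proof -
    have "1 / real (Suc m) \<le> 1 / real n" using that n(1) by (intro divide_left_mono) auto
    then have "bdist x < 1 / real n" using that by linarith
    then have "real n * bdist x < 1" using n(1) by (simp add: field_simps)
    then show ?thesis by (simp add: v_def cutoff_def)
  qed
  have "((\<lambda>t. (1 - t) powr (p - 1) * V) \<longlongrightarrow> (1 - 0) powr (p - 1) * V) (at_right 0)"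
    by (intro tendsto_intros) auto
  then have "eventually (\<lambda>t. 1 - \<delta> / 2 < (1 - t) powr (p - 1) * V) (at_right 0)"
    using V2 by (intro order_tendstoD) auto
  moreover have "eventually (\<lambda>s::real. s \<in> {0<..<1}) (at_right 0)"
    by (rule eventually_at_right_real) simp
  ultimately have "eventually (\<lambda>t. 0 < t \<and> t < 1 \<and> 1 - \<delta> / 2 < (1 - t) powr (p - 1) * V) (at_right 0)"
    by eventually_elim auto
  then obtain t where t: "0 < t" "t < 1" "1 - \<delta> / 2 < (1 - t) powr (p - 1) * V"
    using eventually_happens'[OF trivial_limit_at_right_real] by blast
  let ?C = "2 ^ (DIM('a) + 1) / unit_ball_vol (real DIM('a))"
  \<comment> \<open>The factor of the mollification error once the weighted inequality is solved for the mass of \<open>w\<close>.\<close>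
  define K where "K = (1 - t) powr (p - 1) * t powr (1 - p)"
  have K: "K > 0" using t by (simp add: K_def)
  have "(\<lambda>m. ennreal ?C * interaction (riesz {..<1 / real (Suc m)} 0) p v) \<longlonglongrightarrow> ennreal ?C * 0"
    by (intro ennreal_tendsto_cmult tendsto_interaction_shrinking fv') auto
  then have "eventually (\<lambda>m. ennreal ?C * interaction (riesz {..<1 / real (Suc m)} 0) p v < ennreal (\<delta> / 2 / K)) sequentially"
    using \<delta> K by (intro order_tendstoD(2)) auto
  then have "eventually (\<lambda>m. m \<ge> n \<and> ennreal ?C * interaction (riesz {..<1 / real (Suc m)} 0) p v < ennreal (\<delta> / 2 / K)) sequentially"
    using eventually_ge_at_top[of n] by eventually_elim auto
  then obtain j where j: "j \<ge> n" "ennreal ?C * interaction (riesz {..<1 / real (Suc j)} 0) p v < ennreal (\<delta> / 2 / K)"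
    using eventually_happens'[OF sequentially_bot] by blast
  define \<epsilon> where "\<epsilon> = 1 / real (Suc j)"
  have \<epsilon>: "0 < \<epsilon>" by (simp add: \<epsilon>_def)
  have mvf: "mass p v < \<infinity>" using V by simp
  have inner': "\<And>x. bdist x < \<epsilon> \<Longrightarrow> v x = 0" using inner j(1) by (simp add: \<epsilon>_def)
  define w where "w x = (\<integral>z. v (x - z) \<partial>density lborel (\<lambda>z. ennreal (mollifier \<epsilon> z)))" for x
  have w_core: "w \<in> lipschitz_core"
    unfolding w_def[abs_def] using \<epsilon> mvf inner' by (intro mollify_in_core) auto
  have [measurable]: "w \<in> borel_measurable borel" using w_core by (rule lipschitz_core_measurable)
  have "near_energy 0 w \<le> near_energy 0 v"
    unfolding w_def[abs_def] near_energy_def using \<epsilon> mvf inner' p_gt_1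
    by (intro interaction_average_le prob_space_mollifier mollify_in_core(2)) auto
  then have fw: "near_energy 0 w \<le> near_energy 0 u + ennreal \<delta>" using fv by auto
  have dw: "mass p (\<lambda>x. v x - w x) \<le> ennreal (\<delta> / 2 / K)"
    using mass_mollify_diff_le[of v \<epsilon>] \<epsilon> mvf inner' j(2) unfolding w_def[abs_def] \<epsilon>_def by fastforce
  define W where "W = enn2real (mass p w)"
  have W: "mass p w = ennreal W" "0 \<le> W" using lipschitz_core_mass[OF w_core] by (auto simp: W_def)
  have "mass p v \<le> (\<integral>\<^sup>+ x. ennreal ((1 - t) powr (1 - p)) * ennreal (\<bar>w x\<bar> powr p) + ennreal (t powr (1 - p)) * ennreal (\<bar>v x - w x\<bar> powr p) \<partial>lborel)"
    unfolding mass_def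
  proof (intro nn_integral_mono)
    fix x
    have "\<bar>w x + (v x - w x)\<bar> powr p \<le> (1 - t) powr (1 - p) * \<bar>w x\<bar> powr p + t powr (1 - p) * \<bar>v x - w x\<bar> powr p"
      using p_gt_1 t by (intro powr_add_le_weighted) auto
    then show "ennreal (\<bar>v x\<bar> powr p) \<le> ennreal ((1 - t) powr (1 - p)) * ennreal (\<bar>w x\<bar> powr p) + ennreal (t powr (1 - p)) * ennreal (\<bar>v x - w x\<bar> powr p)"
      by (simp add: ennreal_mult'[symmetric] ennreal_plus[symmetric] ennreal_leI del: ennreal_plus)
  qed
  also have "\<dots> = ennreal ((1 - t) powr (1 - p)) * mass p w + ennreal (t powr (1 - p)) * mass p (\<lambda>x. v x - w x)"
    unfolding mass_def by (simp add: nn_integral_add nn_integral_cmult)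
  also have "\<dots> \<le> ennreal ((1 - t) powr (1 - p)) * ennreal W + ennreal (t powr (1 - p)) * ennreal (\<delta> / 2 / K)"
    unfolding W(1) by (intro add_left_mono mult_left_mono dw) auto
  finally have "ennreal V \<le> ennreal ((1 - t) powr (1 - p) * W + t powr (1 - p) * (\<delta> / 2 / K))"
    using W \<delta> K V by (simp add: ennreal_mult'[symmetric] ennreal_plus[symmetric] del: ennreal_plus)
  then have "V \<le> (1 - t) powr (1 - p) * W + t powr (1 - p) * (\<delta> / 2 / K)"
    using W \<delta> K by (subst (asm) ennreal_le_iff) auto
  then have "(1 - t) powr (p - 1) * V \<le> (1 - t) powr (p - 1) * ((1 - t) powr (1 - p) * W + t powr (1 - p) * (\<delta> / 2 / K))"
    by (intro mult_left_mono) auto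
  also have "\<dots> = ((1 - t) powr (p - 1) * (1 - t) powr (1 - p)) * W + K * (\<delta> / 2 / K)"
    by (simp add: K_def algebra_simps)
  also have "(1 - t) powr (p - 1) * (1 - t) powr (1 - p) = 1"
    using t by (simp add: powr_add[symmetric])
  finally have "1 - \<delta> \<le> W" using t(3) K by simp
  then have "ennreal (1 - \<delta>) \<le> mass p w" unfolding W by (rule ennreal_leI)
  then show ?thesis using w_core fw by blast
qed

theorem derivative_lambda_frac:
  assumes "lipschitz_boundary \<Omega>"
  shows "((\<lambda>s. (lambda_frac s p \<Omega> - 1) / s) \<longlongrightarrow> lambda_log p \<Omega>) (at_right 0)"
  by (rule tendsto_lambda_frac) (rule lipschitz_core_dense[OF assms])

end

section \<open>Stability of positive minimizers\<close>

lemma abs_powr_increment_strict_mono: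
  fixes s t c p :: real
  assumes p: "1 < p" and c: "0 < c" and "s < t"
  shows "\<bar>s + c\<bar> powr p - \<bar>s\<bar> powr p < \<bar>t + c\<bar> powr p - \<bar>t\<bar> powr p"
proof (rule DERIV_pos_imp_increasing[OF \<open>s < t\<close>])
  fix x :: real
  let ?f' = "\<lambda>t. p * sgn t * \<bar>t\<bar> powr (p - 1)"
  have "((\<lambda>t. \<bar>t + c\<bar> powr p) has_real_derivative ?f' (x + c) * 1) (at x)"
    by (rule DERIV_chain2[OF has_real_derivative_abs_powr[OF p]]) (auto intro!: derivative_eq_intros)
  then have "((\<lambda>t. \<bar>t + c\<bar> powr p - \<bar>t\<bar> powr p) has_real_derivative ?f' (x + c) * 1 - ?f' x) (at x)"
    by (intro DERIV_diff has_real_derivative_abs_powr[OF p])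
  moreover have "0 < ?f' (x + c) * 1 - ?f' x"
    using abs_powr_derivative_strict_mono[OF p, of x "x + c"] c by simp
  ultimately show "\<exists>y. ((\<lambda>t. \<bar>t + c\<bar> powr p - \<bar>t\<bar> powr p) has_real_derivative y) (at x) \<and> 0 < y" by blast
qed

text \<open>
  Through its positivity this quantity measures the strict convexity of \<open>t \<mapsto> \<bar>t\<bar>\<^sup>p\<close>.
\<close>
definition second_difference :: "real \<Rightarrow> real \<Rightarrow> real \<Rightarrow> real" where
  "second_difference p \<epsilon> w = \<bar>w + \<epsilon> + \<epsilon>\<bar> powr p - 2 * \<bar>w + \<epsilon>\<bar> powr p + \<bar>w\<bar> powr p"

lemma second_difference_pos: "1 < p \<Longrightarrow> 0 < \<epsilon> \<Longrightarrow> 0 < second_difference p \<epsilon> w"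
  using abs_powr_increment_strict_mono[of p \<epsilon> w "w + \<epsilon>"] by (simp add: second_difference_def)

lemma second_difference_measurable [measurable]: "second_difference p \<epsilon> \<in> borel_measurable borel"
  unfolding second_difference_def[abs_def] by measurable

text \<open>
  The first pair is \<open>a - b = w + \<alpha> + \<beta>\<close> and \<open>c - e = w\<close>, the second \<open>w + \<beta>\<close> and \<open>w + \<alpha>\<close>, where
  \<open>\<alpha>, \<beta> \<ge> \<epsilon>\<close>.  The mixed difference of a convex function is monotone in \<open>\<alpha>\<close> and in \<open>\<beta>\<close>, so both may
  be lowered to \<open>\<epsilon>\<close>; the bound no longer depends on the possibly large values \<open>a\<close> and \<open>b\<close>.
\<close>
lemma crossing_deficit:
  fixes a b c e \<epsilon> p :: real
  assumes p: "1 < p" and "0 < \<epsilon>" "c + \<epsilon> \<le> a" "b \<le> e - \<epsilon>"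
  shows "\<bar>c - b\<bar> powr p + \<bar>a - e\<bar> powr p + second_difference p \<epsilon> (c - e) \<le> \<bar>a - b\<bar> powr p + \<bar>c - e\<bar> powr p"
proof -
  define w \<alpha> \<beta> where "w = c - e" and "\<alpha> = a - c" and "\<beta> = e - b"
  have \<alpha>\<beta>: "\<epsilon> \<le> \<alpha>" "\<epsilon> \<le> \<beta>" using assms by (auto simp: \<alpha>_def \<beta>_def)
  have "\<bar>w + \<epsilon> + \<alpha>\<bar> powr p - \<bar>w + \<epsilon>\<bar> powr p \<le> \<bar>w + \<beta> + \<alpha>\<bar> powr p - \<bar>w + \<beta>\<bar> powr p"
    using abs_powr_increment_strict_mono[OF p, of \<alpha> "w + \<epsilon>" "w + \<beta>"] \<alpha>\<beta> assms(2) by (cases "\<epsilon> = \<beta>") auto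
  moreover have "\<bar>w + \<epsilon> + \<epsilon>\<bar> powr p - \<bar>w + \<epsilon>\<bar> powr p \<le> \<bar>w + \<alpha> + \<epsilon>\<bar> powr p - \<bar>w + \<alpha>\<bar> powr p"
    using abs_powr_increment_strict_mono[OF p assms(2), of "w + \<epsilon>" "w + \<alpha>"] \<alpha>\<beta> by (cases "\<epsilon> = \<alpha>") auto
  moreover have "w + \<alpha> + \<epsilon> = w + \<epsilon> + \<alpha>" by simp
  moreover have eqs: "a - b = w + \<beta> + \<alpha>" "c - b = w + \<beta>" "a - e = w + \<alpha>" "c - e = w"
    by (auto simp: w_def \<alpha>_def \<beta>_def)
  ultimately show ?thesis unfolding second_difference_def eqs by (simp only:)
qed

lemma crossing_nonneg:
  fixes a b c e p :: real
  assumes p: "1 < p" and "c \<le> a" "b \<le> e"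
  shows "\<bar>c - b\<bar> powr p + \<bar>a - e\<bar> powr p \<le> \<bar>a - b\<bar> powr p + \<bar>c - e\<bar> powr p"
proof (cases "c = a \<or> b = e")
  case False
  then have "0 < min (a - c) (e - b)" using assms by auto
  moreover have "c + min (a - c) (e - b) \<le> a" "b \<le> e - min (a - c) (e - b)" by auto
  ultimately show ?thesis
    using crossing_deficit[OF p, of "min (a - c) (e - b)" c a b e]
      second_difference_pos[OF p, of "min (a - c) (e - b)" "c - e"] by linarith
qed (auto simp: add.commute)

lemma min_max_submodular:
  fixes a b c e p :: real
  assumes p: "1 < p"
  shows "\<bar>min a c - min b e\<bar> powr p + \<bar>max a c - max b e\<bar> powr p \<le> \<bar>a - b\<bar> powr p + \<bar>c - e\<bar> powr p"
  using crossing_nonneg[OF p, of c a b e] crossing_nonneg[OF p, of a c e b]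
  by (cases "c \<le> a"; cases "b \<le> e") (auto simp: min_def max_def)

lemma min_max_deficit:
  fixes a b c e \<epsilon> p :: real
  assumes p: "1 < p" and "0 < \<epsilon>" "c + \<epsilon> \<le> a" "b \<le> e - \<epsilon>"
  shows "\<bar>min a c - min b e\<bar> powr p + \<bar>max a c - max b e\<bar> powr p + second_difference p \<epsilon> (c - e)
     \<le> \<bar>a - b\<bar> powr p + \<bar>c - e\<bar> powr p"
  using crossing_deficit[OF assms] assms by (simp add: min_def max_def)

lemma powr_diff_superadditive:
  fixes a b p :: real
  assumes "1 < p" "0 \<le> a" "0 \<le> b"
  shows "\<bar>a - b\<bar> powr p \<le> \<bar>a powr p - b powr p\<bar>"
proof -
  have *: "\<bar>x - y\<bar> powr p \<le> \<bar>x powr p - y powr p\<bar>" if "0 \<le> y" "y \<le> x" for x y :: real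
  proof (cases "0 < y \<and> y < x")
    case True
    have "\<bar>0 + (x - y)\<bar> powr p - \<bar>0\<bar> powr p < \<bar>y + (x - y)\<bar> powr p - \<bar>y\<bar> powr p"
      using True assms(1) by (intro abs_powr_increment_strict_mono) auto
    then show ?thesis using that by simp
  qed (use that in auto)
  show ?thesis using *[of a b] *[of b a] assms by (cases "a \<le> b") (auto simp: abs_minus_commute)
qed

context bounded_domain
begin

text \<open>
  Where \<open>\<bar>v\<bar> > 2 M\<close>, the difference to any point of \<open>{\<bar>v\<bar> \<le> M}\<close> is at least \<open>\<bar>v\<bar> / 2\<close>.  By Chebyshev's inequality
  the complement of this set has measure at most \<open>M\<^bsup>-p\<^esup>\<close>, so the set has density bounded below at all
  radii down to order \<open>M\<^bsup>-p/N\<^esup>\<close>.  The energy is then at least a multiple of \<open>ln M\<close> times the mass of the tail.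
\<close>
lemma tail_mass_small:
  assumes \<eta>: "0 < \<eta>" and B: "0 \<le> B"
  obtains M where "0 < M"
    "\<And>v. v \<in> borel_measurable borel \<Longrightarrow> mass p v \<le> 1 \<Longrightarrow> near_energy 0 v \<le> ennreal B \<Longrightarrow>
       (\<integral>\<^sup>+ x. indicator {x. 2 * M < \<bar>v x\<bar>} x * ennreal (\<bar>v x\<bar> powr p) \<partial>lborel) \<le> ennreal \<eta>"
proof -
  let ?w = "unit_ball_vol (real DIM('a))"
  have w: "0 < ?w" by simp
  define q where "q = real DIM('a) * ?w * \<eta>"
  have q: "0 < q" using w \<eta> by (simp add: q_def)
  define l where "l = 2 * 2 powr p * B / q + 1"
  have l: "0 < l" "2 powr p * B \<le> real DIM('a) * (?w / 2) * l * \<eta>"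
  proof -
    show "0 < l" unfolding l_def using B q by (intro add_nonneg_pos divide_nonneg_pos) auto
    have "real DIM('a) * (?w / 2) * l * \<eta> = q * l / 2" by (simp add: q_def)
    also have "\<dots> = (2 * 2 powr p * B + q) / 2"
      unfolding l_def distrib_left using q by simp
    finally show "2 powr p * B \<le> real DIM('a) * (?w / 2) * l * \<eta>" using q by simp
  qed
  \<comment> \<open>The density estimate is used for radii in \<open>[a, D]\<close>, so that it gains the factor \<open>ln (D / a) = l\<close>.\<close>
  define a where "a = D * exp (- l)"
  have a: "0 < a" "a \<le> D" "ln (D / a) = l"
    using D_ge_1 l by (auto simp: a_def exp_minus field_simps)
  \<comment> \<open>A function of mass at most \<open>1\<close> exceeds this height at most on half the volume of a ball of radius \<open>a\<close>.\<close>
  define M where "M = (2 / (?w * a ^ DIM('a))) powr (1 / p)"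
  have M: "0 < M" "M powr p = 2 / (?w * a ^ DIM('a))"
    using a less_imp_neq[OF w] p_gt_1 by (auto simp: M_def powr_powr)
  show thesis
  proof (rule that[OF M(1)])
    fix v :: "'a \<Rightarrow> real" assume [measurable]: "v \<in> borel_measurable borel"
      and mv: "mass p v \<le> 1" and fv: "near_energy 0 v \<le> ennreal B"
    define E where "E = {y. \<bar>v y\<bar> \<le> M}"
    have [measurable]: "E \<in> sets borel" unfolding E_def by measurable
    have "ennreal (M powr p) * emeasure lborel (- E) = (\<integral>\<^sup>+ x. ennreal (M powr p) * indicator (- E) x \<partial>lborel)"
      by (simp add: nn_integral_cmult)
    also have "\<dots> \<le> mass p v"
      unfolding mass_def
    proof (intro nn_integral_mono)
      fix x :: 'a
      have "M powr p \<le> \<bar>v x\<bar> powr p" if "x \<notin> E"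
        using that M p_gt_1 by (intro powr_mono2) (auto simp: E_def)
      then show "ennreal (M powr p) * indicator (- E) x \<le> ennreal (\<bar>v x\<bar> powr p)"
        by (auto simp: ennreal_leI split: split_indicator)
    qed
    finally have "ennreal (M powr p) * emeasure lborel (- E) \<le> 1" using mv by (rule order_trans)
    then have "ennreal (1 / M powr p) * (ennreal (M powr p) * emeasure lborel (- E)) \<le> ennreal (1 / M powr p) * 1"
      by (rule mult_left_mono) auto
    then have E_compl: "emeasure lborel (- E) \<le> ennreal (?w / 2 * a ^ DIM('a))"
    proof -
      have "ennreal (1 / M powr p) * (ennreal (M powr p) * emeasure lborel (- E)) = emeasure lborel (- E)"
        using M(1) by (simp add: mult.assoc[symmetric] ennreal_mult'[symmetric])
      moreover have "1 / M powr p = ?w / 2 * a ^ DIM('a)" using M(2) by simp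
      ultimately show ?thesis using \<open>ennreal (1 / M powr p) * _ \<le> ennreal (1 / M powr p) * 1\<close>
        by (simp only: mult_1_right)
    qed
    have inner: "ennreal (real DIM('a) * (?w / 2) * l) \<le> (\<integral>\<^sup>+ y. indicator E y * riesz {..<D} 0 (x - y) \<partial>lborel)" for x
    proof -
      have "ennreal (real DIM('a) * (?w / 2) * ln (D / a))
         \<le> (\<integral>\<^sup>+ y. indicator (E \<inter> ball x D) y * ennreal (norm (y - x) powr - real DIM('a)) \<partial>lborel)"
      proof (rule density_log_lower_bound)
        fix r assume r: "a \<le> r" "r \<le> D"
        have "ennreal (?w * r ^ DIM('a)) = emeasure lborel (ball x r)"
          using r a by (subst emeasure_ball_real) auto
        also have "\<dots> \<le> emeasure lborel ((E \<inter> ball x r) \<union> (- E))" by (intro emeasure_mono) auto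
        also have "\<dots> \<le> emeasure lborel (E \<inter> ball x r) + emeasure lborel (- E)"
          by (intro emeasure_subadditive) auto
        also have "\<dots> \<le> emeasure lborel (E \<inter> ball x r) + ennreal (?w / 2 * r ^ DIM('a))"
        proof (intro add_left_mono order_trans[OF E_compl] ennreal_leI mult_left_mono power_mono)
        qed (use a r w in auto)
        finally have "ennreal (?w / 2 * r ^ DIM('a) + ?w / 2 * r ^ DIM('a)) \<le> ennreal (?w / 2 * r ^ DIM('a)) + emeasure lborel (E \<inter> ball x r)"
          by (simp add: add.commute)
        then have "ennreal (?w / 2 * r ^ DIM('a)) + ennreal (?w / 2 * r ^ DIM('a)) \<le> ennreal (?w / 2 * r ^ DIM('a)) + emeasure lborel (E \<inter> ball x r)"
          using a r w by (subst (asm) ennreal_plus) auto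
        then show "ennreal (?w / 2 * r ^ DIM('a)) \<le> emeasure lborel (E \<inter> ball x r)"
          unfolding ennreal_add_left_cancel_le by simp
      qed (use a w in auto)
      also have "\<dots> \<le> (\<integral>\<^sup>+ y. indicator E y * riesz {..<D} 0 (x - y) \<partial>lborel)"
        by (intro nn_integral_mono) (auto simp: riesz_def dist_norm norm_minus_commute split: split_indicator)
      finally show ?thesis by (simp add: a)
    qed
    define T where "T = (\<integral>\<^sup>+ x. indicator {x. 2 * M < \<bar>v x\<bar>} x * ennreal (\<bar>v x\<bar> powr p) \<partial>lborel)"
    have "ennreal (real DIM('a) * (?w / 2) * l) * T
      = (\<integral>\<^sup>+ x. ennreal (real DIM('a) * (?w / 2) * l) * (indicator {x. 2 * M < \<bar>v x\<bar>} x * ennreal (\<bar>v x\<bar> powr p)) \<partial>lborel)"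
      unfolding T_def by (rule nn_integral_cmult[symmetric]) measurable
    also have "\<dots> \<le> (\<integral>\<^sup>+ x. \<integral>\<^sup>+ y. ennreal (2 powr p) * (riesz {..<D} 0 (x - y) * ennreal (\<bar>v x - v y\<bar> powr p)) \<partial>lborel \<partial>lborel)"
    proof (intro nn_integral_mono)
      fix x :: 'a
      show "ennreal (real DIM('a) * (?w / 2) * l) * (indicator {x. 2 * M < \<bar>v x\<bar>} x * ennreal (\<bar>v x\<bar> powr p))
        \<le> (\<integral>\<^sup>+ y. ennreal (2 powr p) * (riesz {..<D} 0 (x - y) * ennreal (\<bar>v x - v y\<bar> powr p)) \<partial>lborel)"
      proof (cases "2 * M < \<bar>v x\<bar>")
        case True
        have "ennreal (real DIM('a) * (?w / 2) * l) * ennreal (\<bar>v x\<bar> powr p)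
          \<le> (\<integral>\<^sup>+ y. indicator E y * riesz {..<D} 0 (x - y) \<partial>lborel) * ennreal (\<bar>v x\<bar> powr p)"
          by (intro mult_right_mono inner) auto
        also have "\<dots> = (\<integral>\<^sup>+ y. indicator E y * riesz {..<D} 0 (x - y) * ennreal (\<bar>v x\<bar> powr p) \<partial>lborel)"
          by (rule nn_integral_multc[symmetric]) measurable
        also have "\<dots> \<le> (\<integral>\<^sup>+ y. ennreal (2 powr p) * (riesz {..<D} 0 (x - y) * ennreal (\<bar>v x - v y\<bar> powr p)) \<partial>lborel)"
        proof (intro nn_integral_mono)
          fix y :: 'a
          show "indicator E y * riesz {..<D} 0 (x - y) * ennreal (\<bar>v x\<bar> powr p)
            \<le> ennreal (2 powr p) * (riesz {..<D} 0 (x - y) * ennreal (\<bar>v x - v y\<bar> powr p))"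
          proof (cases "y \<in> E")
            case yE: True
            then have "\<bar>v y\<bar> \<le> M" by (simp add: E_def)
            then have "\<bar>v x\<bar> \<le> 2 * \<bar>v x - v y\<bar>"
              using True abs_triangle_ineq2[of "v x" "v y"] by argo
            then have "\<bar>v x\<bar> powr p \<le> (2 * \<bar>v x - v y\<bar>) powr p" using p_gt_1 by (intro powr_mono2) auto
            then have "\<bar>v x\<bar> powr p \<le> 2 powr p * \<bar>v x - v y\<bar> powr p" by (simp add: powr_mult)
            then have "ennreal (\<bar>v x\<bar> powr p) \<le> ennreal (2 powr p) * ennreal (\<bar>v x - v y\<bar> powr p)"
              by (simp add: ennreal_mult'[symmetric] ennreal_leI)
            from mult_left_mono[OF this, of "riesz {..<D} 0 (x - y)"] yE
            show ?thesis by (simp add: mult.left_commute)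
          qed simp
        qed
        finally show ?thesis using True by simp
      qed simp
    qed
    also have "\<dots> = ennreal (2 powr p) * near_energy 0 v"
      unfolding near_energy_def interaction_def by (simp add: nn_integral_cmult)
    also have "\<dots> \<le> ennreal (2 powr p) * ennreal B" by (intro mult_left_mono fv) auto
    also have "\<dots> \<le> ennreal (real DIM('a) * (?w / 2) * l) * ennreal \<eta>"
      using l(2) B \<eta> w l(1) by (simp add: ennreal_mult'[symmetric] ennreal_leI)
    finally have le: "ennreal (real DIM('a) * (?w / 2) * l) * T \<le> ennreal (real DIM('a) * (?w / 2) * l) * ennreal \<eta>" .
    have q: "0 < real DIM('a) * (?w / 2) * l" using w l by simp
    then have "T \<le> ennreal \<eta>"
      using le by (subst (asm) ennreal_mult_le_mult_iff) auto
    then show "(\<integral>\<^sup>+ x. indicator {x. 2 * M < \<bar>v x\<bar>} x * ennreal (\<bar>v x\<bar> powr p) \<partial>lborel) \<le> ennreal \<eta>"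
      by (simp add: T_def)
  qed
qed

lemma uniformly_integrable:
  assumes \<eta>: "0 < \<eta>" and B: "0 \<le> B"
  obtains \<tau> where "0 < \<tau>"
    "\<And>v S. v \<in> borel_measurable borel \<Longrightarrow> mass p v \<le> 1 \<Longrightarrow> near_energy 0 v \<le> ennreal B \<Longrightarrow>
       S \<in> sets borel \<Longrightarrow> emeasure lborel S \<le> ennreal \<tau> \<Longrightarrow>
       (\<integral>\<^sup>+ x. indicator S x * ennreal (\<bar>v x\<bar> powr p) \<partial>lborel) \<le> ennreal \<eta>"
proof -
  have "0 < \<eta> / 2" using \<eta> by simp
  then obtain M where M: "0 < M"
    "\<And>v. v \<in> borel_measurable borel \<Longrightarrow> mass p v \<le> 1 \<Longrightarrow> near_energy 0 v \<le> ennreal B \<Longrightarrow>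
       (\<integral>\<^sup>+ x. indicator {x. 2 * M < \<bar>v x\<bar>} x * ennreal (\<bar>v x\<bar> powr p) \<partial>lborel) \<le> ennreal (\<eta> / 2)"
    using tail_mass_small[OF _ B, of "\<eta> / 2"] by blast
  define K where "K = (2 * M) powr p"
  have K: "0 < K" using M by (simp add: K_def)
  show thesis
  proof (rule that[of "\<eta> / 2 / K"])
    fix v :: "'a \<Rightarrow> real" and S :: "'a set" assume v [measurable]: "v \<in> borel_measurable borel"
      and mv: "mass p v \<le> 1" and fv: "near_energy 0 v \<le> ennreal B"
      and S [measurable]: "S \<in> sets borel" and le: "emeasure lborel S \<le> ennreal (\<eta> / 2 / K)"
    have "(\<integral>\<^sup>+ x. indicator S x * ennreal (\<bar>v x\<bar> powr p) \<partial>lborel)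
      \<le> (\<integral>\<^sup>+ x. indicator {x. 2 * M < \<bar>v x\<bar>} x * ennreal (\<bar>v x\<bar> powr p) + ennreal K * indicator S x \<partial>lborel)"
    proof (intro nn_integral_mono)
      fix x :: 'a
      have "\<bar>v x\<bar> powr p \<le> K" if "\<not> 2 * M < \<bar>v x\<bar>"
        using that p_gt_1 unfolding K_def by (intro powr_mono2) auto
      then show "indicator S x * ennreal (\<bar>v x\<bar> powr p)
        \<le> indicator {x. 2 * M < \<bar>v x\<bar>} x * ennreal (\<bar>v x\<bar> powr p) + ennreal K * indicator S x"
        by (auto simp: ennreal_leI split: split_indicator)
    qed
    also have "\<dots> = (\<integral>\<^sup>+ x. indicator {x. 2 * M < \<bar>v x\<bar>} x * ennreal (\<bar>v x\<bar> powr p) \<partial>lborel) + ennreal K * emeasure lborel S"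
      by (simp add: nn_integral_add nn_integral_cmult)
    also have "\<dots> \<le> ennreal (\<eta> / 2) + ennreal K * ennreal (\<eta> / 2 / K)"
      by (intro add_mono mult_left_mono M(2) mv fv le) auto
    also have "\<dots> = ennreal \<eta>"
      using \<eta> K by (simp add: ennreal_mult'[symmetric] ennreal_plus[symmetric] del: ennreal_plus)
    finally show "(\<integral>\<^sup>+ x. indicator S x * ennreal (\<bar>v x\<bar> powr p) \<partial>lborel) \<le> ennreal \<eta>" .
  qed (use \<eta> K in auto)
qed

text \<open>
  Both sides scale like \<open>\<bar>v\<bar>\<^sup>p\<close>; the case of mass \<open>0\<close> holds because the energy is nonnegative.
\<close>
lemma lambda_log_homogeneous:
  assumes [measurable]: "v \<in> borel_measurable borel" and van: "vanishes_outside \<Omega> v"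
    and m: "mass p v < \<infinity>" and fin: "near_energy 0 v < \<infinity>"
  shows "(lambda_log p \<Omega> - rho_D) * enn2real (mass p v) \<le> C_log DIM('a) p / 2 * enn2real (near_energy 0 v)"
proof (cases "mass p v = 0")
  case True
  then show ?thesis using C_log_pos[of p "DIM('a)"] p_gt_1 by simp
next
  case False
  define V where "V = enn2real (mass p v)"
  have V: "0 < V" "mass p v = ennreal V"
    using False m by (auto simp: V_def enn2real_positive_iff zero_less_iff_neq_zero)
  define c where "c = (1 / V) powr (1 / p)"
  have c: "c > 0" "c powr p = 1 / V" using V p_gt_1 by (auto simp: c_def powr_powr)
  have sc: "near_energy 0 (\<lambda>x. c * v x) = ennreal (1 / V) * near_energy 0 v"
    unfolding near_energy_def c(2)[symmetric] using c by (intro interaction_scale) auto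
  have "mass p (\<lambda>x. c * v x) = 1"
    using V c by (subst mass_scale) (auto simp: ennreal_mult'[symmetric])
  then have u: "(\<lambda>x. c * v x) \<in> unit_X0"
    using van fin sc by (auto simp: unit_X0_iff vanishes_outside_def ennreal_mult_less_top)
  have "lambda_log p \<Omega> \<le> C_log DIM('a) p / 2 * (1 / V * enn2real (near_energy 0 v)) + rho_D"
    using lambda_log_le[OF u] V by (simp add: E_log_unit[OF u] sc enn2real_mult)
  then have "(lambda_log p \<Omega> - rho_D) * V \<le> C_log DIM('a) p / 2 * (1 / V * enn2real (near_energy 0 v)) * V"
    using V by (intro mult_right_mono) auto
  then show ?thesis using V(1) by (simp add: V_def[symmetric])
qed

text \<open>
  The minimum and the maximum of \<open>\<phi>\<close> and \<open>u\<close> have total mass \<open>2\<close>, so their total energy is at least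
  \<open>2 lambda_log\<close>; pointwise submodularity with deficit bounds it from above.  In the kernel \<open>\<bar>x - y\<bar> < D\<close> on
  \<open>\<Omega> \<times> \<Omega>\<close> gives the factor \<open>D\<^sup>N\<close>.
\<close>
lemma crossing_energy_le:
  assumes \<phi>: "\<phi> \<in> unit_X0" and u: "u \<in> unit_X0" and \<epsilon>: "0 < \<epsilon>"
  defines "P \<equiv> {x \<in> \<Omega>. u x + \<epsilon> \<le> \<phi> x}" and "Q \<equiv> {x \<in> \<Omega>. \<phi> x \<le> u x - \<epsilon>}"
  shows "(\<integral>\<^sup>+ z. indicator (P \<times> Q) z * ennreal (second_difference p \<epsilon> (u (fst z) - u (snd z))) \<partial>(lborel \<Otimes>\<^sub>M lborel))
    \<le> ennreal (D powr real DIM('a) * (2 / C_log DIM('a) p) * (E_log p \<phi> + E_log p u - 2 * lambda_log p \<Omega>))"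
proof -
  let ?P = "lborel \<Otimes>\<^sub>M lborel :: ('a \<times> 'a) measure" and ?C = "C_log DIM('a) p"
  have C: "?C > 0" using C_log_pos[of p "DIM('a)"] p_gt_1 by simp
  have [measurable]: "\<phi> \<in> borel_measurable borel" "u \<in> borel_measurable borel" using \<phi> u by (auto simp: unit_X0_iff)
  have [measurable]: "P \<in> sets borel" "Q \<in> sets borel" unfolding P_def Q_def by measurable
  define mn mx where "mn x = min (\<phi> x) (u x)" and "mx x = max (\<phi> x) (u x)" for x
  have [measurable]: "mn \<in> borel_measurable borel" "mx \<in> borel_measurable borel"
    unfolding mn_def[abs_def] mx_def[abs_def] by measurable
  have van: "vanishes_outside \<Omega> mn" "vanishes_outside \<Omega> mx"
    using \<phi> u unfolding unit_X0_iff vanishes_outside_def by (auto simp: mn_def mx_def)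
  have "mass p mn + mass p mx = mass p \<phi> + mass p u"
    unfolding mass_def by (subst (1 2) nn_integral_add[symmetric]) (auto simp: mn_def mx_def min_def max_def add.commute intro!: nn_integral_cong)
  then have mass_sum: "mass p mn + mass p mx = 2" using \<phi> u by (simp add: unit_X0_iff)
  have "mass p mn + mass p mx < \<infinity>" unfolding mass_sum by simp
  then have mfin: "mass p mn < \<infinity>" "mass p mx < \<infinity>" by simp_all
  have m2: "enn2real (mass p mn) + enn2real (mass p mx) = 2"
    using enn2real_plus[of "mass p mn" "mass p mx"] mfin unfolding mass_sum by simp
  \<comment> \<open>A lower bound for the energy lost when \<open>(\<phi>, u)\<close> is replaced by the minimum and the maximum.\<close>
  define def where "def = (\<integral>\<^sup>+ z. riesz {..<D} 0 (fst z - snd z) * (indicator (P \<times> Q) z * ennreal (second_difference p \<epsilon> (u (fst z) - u (snd z)))) \<partial>?P)"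
  have sum_le: "near_energy 0 mn + near_energy 0 mx + def \<le> near_energy 0 \<phi> + near_energy 0 u"
  proof -
    have "near_energy 0 mn + near_energy 0 mx + def =
      (\<integral>\<^sup>+ z. riesz {..<D} 0 (fst z - snd z) * ennreal (\<bar>mn (fst z) - mn (snd z)\<bar> powr p)
        + riesz {..<D} 0 (fst z - snd z) * ennreal (\<bar>mx (fst z) - mx (snd z)\<bar> powr p)
        + riesz {..<D} 0 (fst z - snd z) * (indicator (P \<times> Q) z * ennreal (second_difference p \<epsilon> (u (fst z) - u (snd z)))) \<partial>?P)"
      unfolding near_energy_def def_def by (subst (1 2) interaction_pair) (auto simp: nn_integral_add)
    also have "\<dots> \<le> (\<integral>\<^sup>+ z. riesz {..<D} 0 (fst z - snd z) * ennreal (\<bar>\<phi> (fst z) - \<phi> (snd z)\<bar> powr p)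
        + riesz {..<D} 0 (fst z - snd z) * ennreal (\<bar>u (fst z) - u (snd z)\<bar> powr p) \<partial>?P)"
    proof (intro nn_integral_mono)
      fix z :: "'a \<times> 'a"
      obtain x y where z: "z = (x, y)" by (cases z)
      let ?g = "second_difference p \<epsilon> (u x - u y)"
      have g: "0 \<le> ?g" using second_difference_pos[OF p_gt_1 \<epsilon>] by (intro less_imp_le)
      have "\<bar>mn x - mn y\<bar> powr p + \<bar>mx x - mx y\<bar> powr p + indicator (P \<times> Q) z * ?g
        \<le> \<bar>\<phi> x - \<phi> y\<bar> powr p + \<bar>u x - u y\<bar> powr p"
      proof (cases "z \<in> P \<times> Q")
        case True
        then have "u x + \<epsilon> \<le> \<phi> x" "\<phi> y \<le> u y - \<epsilon>" by (auto simp: z P_def Q_def)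
        then show ?thesis using True min_max_deficit[OF p_gt_1 \<epsilon>, of "u x" "\<phi> x" "\<phi> y" "u y"] by (simp add: mn_def mx_def)
      next
        case False
        then show ?thesis using min_max_submodular[OF p_gt_1, of "\<phi> x" "u x" "\<phi> y" "u y"] by (simp add: mn_def mx_def)
      qed
      then have "ennreal (\<bar>mn x - mn y\<bar> powr p) + ennreal (\<bar>mx x - mx y\<bar> powr p) + indicator (P \<times> Q) z * ennreal ?g
        \<le> ennreal (\<bar>\<phi> x - \<phi> y\<bar> powr p) + ennreal (\<bar>u x - u y\<bar> powr p)"
        using g by (auto simp: ennreal_plus[symmetric] ennreal_leI simp del: ennreal_plus split: split_indicator split_indicator_asm)
      from mult_left_mono[OF this, of "riesz {..<D} 0 (x - y)"]
      show "riesz {..<D} 0 (fst z - snd z) * ennreal (\<bar>mn (fst z) - mn (snd z)\<bar> powr p)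
        + riesz {..<D} 0 (fst z - snd z) * ennreal (\<bar>mx (fst z) - mx (snd z)\<bar> powr p)
        + riesz {..<D} 0 (fst z - snd z) * (indicator (P \<times> Q) z * ennreal (second_difference p \<epsilon> (u (fst z) - u (snd z))))
        \<le> riesz {..<D} 0 (fst z - snd z) * ennreal (\<bar>\<phi> (fst z) - \<phi> (snd z)\<bar> powr p)
        + riesz {..<D} 0 (fst z - snd z) * ennreal (\<bar>u (fst z) - u (snd z)\<bar> powr p)"
        by (simp add: z distrib_left)
    qed
    also have "\<dots> = near_energy 0 \<phi> + near_energy 0 u"
      unfolding near_energy_def by (subst (1 2) interaction_pair) (auto simp: nn_integral_add)
    finally show ?thesis .
  qed
  have fin: "near_energy 0 \<phi> + near_energy 0 u < \<infinity>" using \<phi> u by (simp add: unit_X0_iff)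
  then have fins: "near_energy 0 mn < \<infinity>" "near_energy 0 mx < \<infinity>" "def < \<infinity>"
    using le_less_trans[OF sum_le fin] by auto
  define d where "d = enn2real def"
  have d: "def = ennreal d" "0 \<le> d" using fins by (auto simp: d_def)
  have "enn2real (near_energy 0 mn) + enn2real (near_energy 0 mx) + d \<le> enn2real (near_energy 0 \<phi>) + enn2real (near_energy 0 u)"
    using enn2real_mono[OF sum_le] fin fins by (simp add: enn2real_plus d_def)
  then have "?C / 2 * (enn2real (near_energy 0 mn) + enn2real (near_energy 0 mx) + d)
     \<le> ?C / 2 * (enn2real (near_energy 0 \<phi>) + enn2real (near_energy 0 u))"
    using C by (intro mult_left_mono) auto
  moreover have "(lambda_log p \<Omega> - rho_D) * enn2real (mass p mn) \<le> ?C / 2 * enn2real (near_energy 0 mn)"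
    "(lambda_log p \<Omega> - rho_D) * enn2real (mass p mx) \<le> ?C / 2 * enn2real (near_energy 0 mx)"
    by (intro lambda_log_homogeneous van mfin fins; measurable)+
  moreover have "(lambda_log p \<Omega> - rho_D) * enn2real (mass p mn) + (lambda_log p \<Omega> - rho_D) * enn2real (mass p mx)
      = 2 * (lambda_log p \<Omega> - rho_D)" using m2 by (simp add: distrib_left[symmetric])
  moreover have "x + y + z \<le> f + g \<Longrightarrow> a \<le> x \<Longrightarrow> b \<le> y \<Longrightarrow> a + b = 2 * t \<Longrightarrow> z \<le> f + g - 2 * t"
    for a b f g t x y z :: real by linarith
  ultimately have "?C / 2 * d \<le> ?C / 2 * enn2real (near_energy 0 \<phi>) + ?C / 2 * enn2real (near_energy 0 u)
      - 2 * (lambda_log p \<Omega> - rho_D)"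
    unfolding distrib_left by blast
  then have "?C / 2 * d \<le> E_log p \<phi> + E_log p u - 2 * lambda_log p \<Omega>"
    unfolding E_log_unit[OF \<phi>] E_log_unit[OF u] by (simp add: algebra_simps)
  then have "2 / ?C * (?C / 2 * d) \<le> 2 / ?C * (E_log p \<phi> + E_log p u - 2 * lambda_log p \<Omega>)"
    using C by (intro mult_left_mono) auto
  then have d_le: "d \<le> 2 / ?C * (E_log p \<phi> + E_log p u - 2 * lambda_log p \<Omega>)" using C by simp
  have "ennreal (D powr - real DIM('a)) * (\<integral>\<^sup>+ z. indicator (P \<times> Q) z * ennreal (second_difference p \<epsilon> (u (fst z) - u (snd z))) \<partial>?P)
     = (\<integral>\<^sup>+ z. ennreal (D powr - real DIM('a)) * (indicator (P \<times> Q) z * ennreal (second_difference p \<epsilon> (u (fst z) - u (snd z)))) \<partial>?P)"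
    by (rule nn_integral_cmult[symmetric]) measurable
  also have "\<dots> \<le> def"
    unfolding def_def
  proof (intro nn_integral_mono)
    fix z :: "'a \<times> 'a"
    show "ennreal (D powr - real DIM('a)) * (indicator (P \<times> Q) z * ennreal (second_difference p \<epsilon> (u (fst z) - u (snd z))))
      \<le> riesz {..<D} 0 (fst z - snd z) * (indicator (P \<times> Q) z * ennreal (second_difference p \<epsilon> (u (fst z) - u (snd z))))"
    proof (cases "z \<in> P \<times> Q")
      case True
      then have xy: "fst z \<in> \<Omega>" "snd z \<in> \<Omega>" "fst z \<noteq> snd z" using \<epsilon> by (auto simp: P_def Q_def)
      then have r: "0 < norm (fst z - snd z)" "norm (fst z - snd z) < D" using diam by auto
      have "D powr - real DIM('a) \<le> norm (fst z - snd z) powr - real DIM('a)"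
        using r by (intro powr_mono2') auto
      then have "ennreal (D powr - real DIM('a)) \<le> riesz {..<D} 0 (fst z - snd z)"
        using r by (simp add: riesz_def ennreal_leI)
      then show ?thesis by (rule mult_right_mono) auto
    qed simp
  qed
  finally have "ennreal (D powr real DIM('a)) * (ennreal (D powr - real DIM('a)) * (\<integral>\<^sup>+ z. indicator (P \<times> Q) z * ennreal (second_difference p \<epsilon> (u (fst z) - u (snd z))) \<partial>?P))
    \<le> ennreal (D powr real DIM('a)) * ennreal (2 / ?C * (E_log p \<phi> + E_log p u - 2 * lambda_log p \<Omega>))"
    unfolding d using d_le by (intro mult_left_mono order_trans[OF _ ennreal_leI[OF d_le]]) auto
  moreover have "ennreal (D powr real DIM('a)) * ennreal (D powr - real DIM('a)) = 1"
    using D_ge_1 by (simp add: ennreal_mult'[symmetric] powr_add[symmetric])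
  moreover have "ennreal (D powr real DIM('a)) * ennreal t = ennreal (D powr real DIM('a) * t)" for t
    by (rule ennreal_mult'[symmetric]) simp
  ultimately show ?thesis by (simp only: mult.assoc[symmetric] mult_1_left)
qed

text \<open>
  The second difference is positive everywhere and \<open>\<Omega> \<times> \<Omega>\<close> has finite measure, so its sublevel sets
  shrink to a null set.
\<close>
lemma small_second_difference:
  assumes [measurable]: "u \<in> borel_measurable borel" and \<epsilon>: "0 < \<epsilon>" and \<tau>: "0 < \<tau>"
  obtains \<theta> where "0 < \<theta>"
    "emeasure (lborel \<Otimes>\<^sub>M lborel) {z \<in> \<Omega> \<times> \<Omega>. second_difference p \<epsilon> (u (fst z) - u (snd z)) \<le> \<theta>} < ennreal \<tau>"
proof -
  let ?P = "lborel \<Otimes>\<^sub>M lborel :: ('a \<times> 'a) measure"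
  define A where "A n = {z \<in> \<Omega> \<times> \<Omega>. second_difference p \<epsilon> (u (fst z) - u (snd z)) \<le> 1 / real (Suc n)}" for n
  have A [measurable]: "A n \<in> sets ?P" for n
  proof -
    have "A n = (\<Omega> \<times> \<Omega>) \<inter> {z \<in> space ?P. second_difference p \<epsilon> (u (fst z) - u (snd z)) \<le> 1 / real (Suc n)}"
      by (auto simp: A_def space_pair_measure)
    also have "\<dots> \<in> sets ?P" by measurable
    finally show ?thesis .
  qed
  have "(\<lambda>n. emeasure ?P (A n)) \<longlonglongrightarrow> emeasure ?P (\<Inter>n. A n)"
  proof (rule Lim_emeasure_decseq)
    show "decseq A"
    proof (rule decseq_SucI)
      fix n
      have "1 / real (Suc (Suc n)) \<le> 1 / real (Suc n)" by (simp add: field_simps)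
      then show "A (Suc n) \<subseteq> A n" unfolding A_def by (auto intro: order_trans)
    qed
    show "emeasure ?P (A n) \<noteq> \<infinity>" for n
    proof -
      have "emeasure ?P (A n) \<le> emeasure ?P (\<Omega> \<times> \<Omega>)" by (intro emeasure_mono) (auto simp: A_def)
      also have "\<dots> = emeasure lborel \<Omega> * emeasure lborel \<Omega>" by (rule lborel.emeasure_pair_measure_Times) auto
      also have "\<dots> < \<infinity>" using emeasure_domain by (simp add: ennreal_mult_less_top)
      finally show ?thesis by simp
    qed
  qed (use A in auto)
  moreover have "(\<Inter>n. A n) = {}"
  proof (rule equals0I)
    fix z assume z: "z \<in> (\<Inter>n. A n)"
    have "0 < second_difference p \<epsilon> (u (fst z) - u (snd z))" by (rule second_difference_pos[OF p_gt_1 \<epsilon>])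
    then obtain n where "1 / real (Suc n) < second_difference p \<epsilon> (u (fst z) - u (snd z))"
      using reals_Archimedean by (metis inverse_eq_divide)
    then show False using z by (auto simp: A_def not_le[symmetric])
  qed
  ultimately have "(\<lambda>n. emeasure ?P (A n)) \<longlonglongrightarrow> 0" by simp
  then have "eventually (\<lambda>n. emeasure ?P (A n) < ennreal \<tau>) sequentially"
    using \<tau> by (intro order_tendstoD(2)) auto
  then obtain n where "emeasure ?P (A n) < ennreal \<tau>"
    using eventually_happens'[OF sequentially_bot] by blast
  then show thesis by (intro that[of "1 / real (Suc n)"]) (auto simp: A_def)
qed

lemma small_shift:
  assumes [measurable]: "u \<in> borel_measurable borel" and m: "mass p u < \<infinity>" and \<eta>: "0 < \<eta>"
  obtains \<epsilon> where "0 < \<epsilon>"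
    "(\<integral>\<^sup>+ x. indicator \<Omega> x * ennreal ((\<bar>u x\<bar> + \<epsilon>) powr p - (max (\<bar>u x\<bar> - \<epsilon>) 0) powr p) \<partial>lborel) \<le> ennreal \<eta>"
proof -
  define e where "e n = 1 / real (Suc n)" for n
  have e: "0 < e n" "e n \<le> 1" for n by (auto simp: e_def)
  have e_lim: "e \<longlonglongrightarrow> 0" unfolding e_def[abs_def] by (rule LIMSEQ_Suc[OF lim_1_over_n[where 'a=real]])
  have "(\<lambda>n. \<integral>\<^sup>+ x. indicator \<Omega> x * ennreal ((\<bar>u x\<bar> + e n) powr p - (max (\<bar>u x\<bar> - e n) 0) powr p) \<partial>lborel) \<longlonglongrightarrow> (\<integral>\<^sup>+ (x::'a). 0 \<partial>lborel)"
  proof (rule nn_integral_dominated_convergence[where w="\<lambda>x. indicator \<Omega> x * ennreal (2 powr p * (\<bar>u x\<bar> powr p + 1))"])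
    show "AE x in lborel. indicator \<Omega> x * ennreal ((\<bar>u x\<bar> + e n) powr p - (max (\<bar>u x\<bar> - e n) 0) powr p)
       \<le> indicator \<Omega> x * ennreal (2 powr p * (\<bar>u x\<bar> powr p + 1))" for n
    proof (intro AE_I2 mult_left_mono ennreal_leI)
      fix x :: 'a
      have "(\<bar>u x\<bar> + e n) powr p \<le> (\<bar>u x\<bar> + 1) powr p" using e[of n] p_gt_1 by (intro powr_mono2) auto
      also have "\<dots> \<le> 2 powr p * (\<bar>u x\<bar> powr p + 1)"
        using powr_abs_diff_le[of p "\<bar>u x\<bar>" "-1"] p_gt_1 by simp
      finally show "(\<bar>u x\<bar> + e n) powr p - (max (\<bar>u x\<bar> - e n) 0) powr p \<le> 2 powr p * (\<bar>u x\<bar> powr p + 1)"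
        by (rule order_trans[rotated]) simp
    qed auto
    have "(\<integral>\<^sup>+ x. indicator \<Omega> x * ennreal (2 powr p * (\<bar>u x\<bar> powr p + 1)) \<partial>lborel)
       \<le> (\<integral>\<^sup>+ x. ennreal (2 powr p) * ennreal (\<bar>u x\<bar> powr p) + ennreal (2 powr p) * indicator \<Omega> x \<partial>lborel)"
      by (intro nn_integral_mono) (auto simp: ennreal_mult'[symmetric] ennreal_plus[symmetric] distrib_left simp del: ennreal_plus split: split_indicator)
    also have "\<dots> = ennreal (2 powr p) * mass p u + ennreal (2 powr p) * emeasure lborel \<Omega>"
      unfolding mass_def by (simp add: nn_integral_add nn_integral_cmult)
    also have "\<dots> < \<infinity>" using m emeasure_domain by (simp add: ennreal_mult_less_top)
    finally show "(\<integral>\<^sup>+ x. indicator \<Omega> x * ennreal (2 powr p * (\<bar>u x\<bar> powr p + 1)) \<partial>lborel) < \<infinity>" .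
    show "AE x in lborel. (\<lambda>n. indicator \<Omega> x * ennreal ((\<bar>u x\<bar> + e n) powr p - (max (\<bar>u x\<bar> - e n) 0) powr p)) \<longlonglongrightarrow> 0"
    proof (intro AE_I2)
      fix x :: 'a
      have "(\<lambda>n. (\<bar>u x\<bar> + e n) powr p - (max (\<bar>u x\<bar> - e n) 0) powr p) \<longlonglongrightarrow> (\<bar>u x\<bar> + 0) powr p - (max (\<bar>u x\<bar> - 0) 0) powr p"
        using p_gt_1 e by (intro tendsto_diff tendsto_powr2 tendsto_add tendsto_max tendsto_const e_lim) (auto simp: add_nonneg_pos less_imp_le)
      then have "(\<lambda>n. ennreal ((\<bar>u x\<bar> + e n) powr p - (max (\<bar>u x\<bar> - e n) 0) powr p)) \<longlonglongrightarrow> ennreal 0"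
        by (intro tendsto_ennrealI) simp
      then show "(\<lambda>n. indicator \<Omega> x * ennreal ((\<bar>u x\<bar> + e n) powr p - (max (\<bar>u x\<bar> - e n) 0) powr p)) \<longlonglongrightarrow> 0"
        by (cases "x \<in> \<Omega>") auto
    qed
  qed auto
  then have "eventually (\<lambda>n. (\<integral>\<^sup>+ x. indicator \<Omega> x * ennreal ((\<bar>u x\<bar> + e n) powr p - (max (\<bar>u x\<bar> - e n) 0) powr p) \<partial>lborel) < ennreal \<eta>) sequentially"
    using \<eta> by (intro order_tendstoD(2)) auto
  then obtain n where "(\<integral>\<^sup>+ x. indicator \<Omega> x * ennreal ((\<bar>u x\<bar> + e n) powr p - (max (\<bar>u x\<bar> - e n) 0) powr p) \<partial>lborel) < ennreal \<eta>"
    using eventually_happens'[OF sequentially_bot] by blast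
  then show thesis using that[of "e n"] e by auto
qed

text \<open>
  If \<open>\<phi>\<close> is almost minimal, then one of the sets where \<open>\<phi> \<ge> u + \<epsilon>\<close> and where \<open>\<phi> \<le> u - \<epsilon>\<close> is small, since
  their product is.  By uniform integrability this controls one of the positive and the negative part of \<open>\<phi>\<^sup>p - u\<^sup>p\<close>; equality of the norms transfers the bound to the
  other part, and \<open>\<bar>\<phi> - u\<bar>\<^sup>p \<le> \<bar>\<phi>\<^sup>p - u\<^sup>p\<bar>\<close>.
\<close>
lemma minimizer_stability:
  assumes u: "u \<in> unit_X0" and u_pos: "positive_in \<Omega> u" and min: "E_log p u = lambda_log p \<Omega>" and \<eta>: "0 < \<eta>"
  obtains \<delta> where "0 < \<delta>"
    "\<And>\<phi>. \<phi> \<in> unit_X0 \<Longrightarrow> positive_in \<Omega> \<phi> \<Longrightarrow> E_log p \<phi> \<le> lambda_log p \<Omega> + \<delta> \<Longrightarrow>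
      mass p (\<lambda>x. \<phi> x - u x) \<le> ennreal \<eta>"
proof -
  let ?P = "lborel \<Otimes>\<^sub>M lborel :: ('a \<times> 'a) measure" and ?C = "C_log DIM('a) p"
  have C: "?C > 0" using C_log_pos[of p "DIM('a)"] p_gt_1 by simp
  have [measurable]: "u \<in> borel_measurable borel" and mu: "mass p u = 1" using u by (auto simp: unit_X0_iff)
  define B where "B = 2 / ?C * (lambda_log p \<Omega> + 1 - rho_D)"
  have energy_le: "near_energy 0 \<phi> \<le> ennreal B" if "\<phi> \<in> unit_X0" "E_log p \<phi> \<le> lambda_log p \<Omega> + 1" for \<phi>
  proof -
    have "?C / 2 * enn2real (near_energy 0 \<phi>) \<le> lambda_log p \<Omega> + 1 - rho_D"
      using that E_log_unit[OF that(1)] by simp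
    then have "2 / ?C * (?C / 2 * enn2real (near_energy 0 \<phi>)) \<le> B"
      unfolding B_def using C by (intro mult_left_mono) auto
    then have "enn2real (near_energy 0 \<phi>) \<le> B" using C by simp
    then have "ennreal (enn2real (near_energy 0 \<phi>)) \<le> ennreal B" by (rule ennreal_leI)
    then show ?thesis using that(1) by (simp add: unit_X0_iff)
  qed
  have "near_energy 0 u \<le> ennreal B" using energy_le[OF u] min by simp
  have B0: "0 \<le> B"
  proof -
    have "0 \<le> ?C / 2 * enn2real (near_energy 0 u)" using C by simp
    then have "0 \<le> lambda_log p \<Omega> - rho_D" using E_log_unit[OF u] min by simp
    then show ?thesis unfolding B_def using C by (intro mult_nonneg_nonneg) auto
  qed
  define \<eta>' where "\<eta>' = \<eta> / 4"
  have \<eta>': "0 < \<eta>'" using \<eta> by (simp add: \<eta>'_def)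
  obtain \<epsilon> where \<epsilon>: "0 < \<epsilon>" and shift:
    "(\<integral>\<^sup>+ x. indicator \<Omega> x * ennreal ((\<bar>u x\<bar> + \<epsilon>) powr p - (max (\<bar>u x\<bar> - \<epsilon>) 0) powr p) \<partial>lborel) \<le> ennreal \<eta>'"
    using small_shift[of u \<eta>'] mu \<eta>' by auto
  obtain \<tau> where \<tau>: "0 < \<tau>" and ui:
    "\<And>v S. v \<in> borel_measurable borel \<Longrightarrow> mass p v \<le> 1 \<Longrightarrow> near_energy 0 v \<le> ennreal B \<Longrightarrow>
       S \<in> sets borel \<Longrightarrow> emeasure lborel S \<le> ennreal \<tau> \<Longrightarrow>
       (\<integral>\<^sup>+ x. indicator S x * ennreal (\<bar>v x\<bar> powr p) \<partial>lborel) \<le> ennreal \<eta>'"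
    using uniformly_integrable[OF \<eta>' B0] by blast
  have "0 < \<tau>\<^sup>2 / 2" using \<tau> by simp
  then obtain \<theta> where \<theta>: "0 < \<theta>"
    "emeasure ?P {z \<in> \<Omega> \<times> \<Omega>. second_difference p \<epsilon> (u (fst z) - u (snd z)) \<le> \<theta>} < ennreal (\<tau>\<^sup>2 / 2)"
    using small_second_difference[of u \<epsilon> "\<tau>\<^sup>2 / 2"] \<epsilon> by auto
  define K where "K = D powr real DIM('a) * (2 / ?C)"
  have K: "0 < K" using C D_ge_1 by (simp add: K_def)
  define \<delta> where "\<delta> = Min {1, \<theta> * (\<tau>\<^sup>2 / 2) / K}"
  have \<delta>: "0 < \<delta>" "\<delta> \<le> 1" "\<delta> \<le> \<theta> * (\<tau>\<^sup>2 / 2) / K" using \<theta> \<tau> K by (auto simp: \<delta>_def)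
  have \<delta>K: "K * \<delta> / \<theta> \<le> \<tau>\<^sup>2 / 2" using \<delta>(3) K \<theta>(1) by (simp add: field_simps)
  show thesis
  proof (rule that[OF \<delta>(1)])
    fix \<phi> assume \<phi>: "\<phi> \<in> unit_X0" and \<phi>_pos: "positive_in \<Omega> \<phi>" and E\<phi>: "E_log p \<phi> \<le> lambda_log p \<Omega> + \<delta>"
    have [measurable]: "\<phi> \<in> borel_measurable borel" and m\<phi>: "mass p \<phi> = 1" using \<phi> by (auto simp: unit_X0_iff)
    define P Q where "P = {x \<in> \<Omega>. u x + \<epsilon> \<le> \<phi> x}" and "Q = {x \<in> \<Omega>. \<phi> x \<le> u x - \<epsilon>}"
    have [measurable]: "P \<in> sets borel" "Q \<in> sets borel" unfolding P_def Q_def by measurable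
    let ?g = "\<lambda>z. second_difference p \<epsilon> (u (fst z) - u (snd z))"
    have g: "0 < ?g z" for z by (rule second_difference_pos[OF p_gt_1 \<epsilon>])
    have "(\<integral>\<^sup>+ z. indicator (P \<times> Q) z * ennreal (?g z) \<partial>?P) \<le> ennreal (K * (E_log p \<phi> + E_log p u - 2 * lambda_log p \<Omega>))"
      using crossing_energy_le[OF \<phi> u \<epsilon>] by (simp add: P_def Q_def K_def)
    also have "\<dots> \<le> ennreal (K * \<delta>)" using E\<phi> min K by (intro ennreal_leI mult_left_mono) auto
    finally have gPQ: "(\<integral>\<^sup>+ z. indicator (P \<times> Q) z * ennreal (?g z) \<partial>?P) \<le> ennreal (K * \<delta>)" .
    define A where "A = {z \<in> \<Omega> \<times> \<Omega>. ?g z \<le> \<theta>}"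
    have [measurable]: "A \<in> sets ?P"
    proof -
      have "A = (\<Omega> \<times> \<Omega>) \<inter> {z \<in> space ?P. ?g z \<le> \<theta>}" by (auto simp: A_def space_pair_measure)
      also have "\<dots> \<in> sets ?P" by measurable
      finally show ?thesis .
    qed
    have "emeasure lborel P * emeasure lborel Q = emeasure ?P (P \<times> Q)"
      by (rule lborel.emeasure_pair_measure_Times[symmetric]) auto
    also have "\<dots> = (\<integral>\<^sup>+ z. indicator (P \<times> Q) z \<partial>?P)" by (subst nn_integral_indicator) auto
    also have "\<dots> \<le> (\<integral>\<^sup>+ z. indicator A z + ennreal (1 / \<theta>) * (indicator (P \<times> Q) z * ennreal (?g z)) \<partial>?P)"
    proof (intro nn_integral_mono)
      fix z :: "'a \<times> 'a"
      show "indicator (P \<times> Q) z \<le> indicator A z + ennreal (1 / \<theta>) * (indicator (P \<times> Q) z * ennreal (?g z))"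
      proof (cases "z \<in> P \<times> Q \<and> z \<notin> A")
        case True
        then have "\<theta> < ?g z" by (auto simp: A_def P_def Q_def)
        then have "1 \<le> 1 / \<theta> * ?g z" using \<theta> by (simp add: field_simps)
        then have "ennreal 1 \<le> ennreal (1 / \<theta>) * ennreal (?g z)"
          using \<theta> g[of z] by (subst ennreal_mult[symmetric]) (auto intro: ennreal_leI)
        then show ?thesis using True by simp
      qed (auto split: split_indicator)
    qed
    also have "\<dots> = emeasure ?P A + ennreal (1 / \<theta>) * (\<integral>\<^sup>+ z. indicator (P \<times> Q) z * ennreal (?g z) \<partial>?P)"
    proof -
      have "(\<integral>\<^sup>+ z. indicator A z \<partial>?P) = emeasure ?P A" by (rule nn_integral_indicator) measurable
      then show ?thesis by (simp add: nn_integral_add nn_integral_cmult)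
    qed
    also have "\<dots> \<le> ennreal (\<tau>\<^sup>2 / 2) + ennreal (1 / \<theta>) * ennreal (K * \<delta>)"
      by (intro add_mono mult_left_mono gPQ less_imp_le[OF \<theta>(2)[folded A_def]]) auto
    also have "\<dots> \<le> ennreal (\<tau>\<^sup>2 / 2) + ennreal (\<tau>\<^sup>2 / 2)"
      using \<theta> K \<delta> \<delta>K by (intro add_left_mono) (auto simp: ennreal_mult'[symmetric] intro!: ennreal_leI)
    also have "\<dots> = ennreal \<tau> * ennreal \<tau>"
      using \<tau> by (simp add: ennreal_mult'[symmetric] ennreal_plus[symmetric] power2_eq_square del: ennreal_plus)
    finally have PQ: "emeasure lborel P * emeasure lborel Q \<le> ennreal \<tau> * ennreal \<tau>" .
    have small: "emeasure lborel P \<le> ennreal \<tau> \<or> emeasure lborel Q \<le> ennreal \<tau>"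
    proof (rule ccontr)
      assume "\<not> ?thesis"
      moreover have "emeasure lborel P \<le> emeasure lborel \<Omega>" "emeasure lborel Q \<le> emeasure lborel \<Omega>"
        by (auto simp: P_def Q_def intro!: emeasure_mono)
      then have "emeasure lborel P < top" "emeasure lborel Q < top"
        using emeasure_domain by (auto dest: le_less_trans)
      then obtain a b where ab: "0 \<le> a" "emeasure lborel P = ennreal a" "0 \<le> b" "emeasure lborel Q = ennreal b"
        by (auto simp: less_top_ennreal)
      ultimately have "\<tau> < a" "\<tau> < b" using \<tau> by (auto simp: not_le ennreal_less_iff)
      then have "\<tau> * \<tau> < a * b" using \<tau> by (intro mult_strict_mono) auto
      then show False using PQ ab \<tau> by (auto simp: ennreal_mult[symmetric] ennreal_le_iff)
    qed
    have pos: "AE x in lborel. 0 \<le> u x \<and> 0 \<le> \<phi> x \<and> (x \<notin> \<Omega> \<longrightarrow> u x = 0 \<and> \<phi> x = 0)"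
    proof -
      have "AE x in lborel. x \<notin> \<Omega> \<longrightarrow> u x = 0" "AE x in lborel. x \<notin> \<Omega> \<longrightarrow> \<phi> x = 0"
        using u \<phi> by (auto simp: unit_X0_iff vanishes_outside_def)
      with u_pos[unfolded positive_in_def] \<phi>_pos[unfolded positive_in_def] show ?thesis
        by eventually_elim (metis less_imp_le order_refl)
    qed
    \<comment> \<open>The positive and the negative part of \<open>\<phi>\<^sup>p - u\<^sup>p\<close>; they have equal integrals.\<close>
    define F G where "F x = max (\<bar>\<phi> x\<bar> powr p - \<bar>u x\<bar> powr p) 0" and "G x = max (\<bar>u x\<bar> powr p - \<bar>\<phi> x\<bar> powr p) 0" for x
    have [measurable]: "F \<in> borel_measurable borel" "G \<in> borel_measurable borel"
      unfolding F_def[abs_def] G_def[abs_def] by measurable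
    have "(\<integral>\<^sup>+ x. ennreal (F x) \<partial>lborel) + mass p u = (\<integral>\<^sup>+ x. ennreal (G x) \<partial>lborel) + mass p \<phi>"
      unfolding mass_def
      by (subst (1 2) nn_integral_add[symmetric])
         (auto simp: F_def G_def max_def ennreal_plus[symmetric] simp del: ennreal_plus intro!: nn_integral_cong)
    then have FG: "(\<integral>\<^sup>+ x. ennreal (F x) \<partial>lborel) = (\<integral>\<^sup>+ x. ennreal (G x) \<partial>lborel)"
      by (simp add: mu m\<phi>)
    have E1: "E_log p \<phi> \<le> lambda_log p \<Omega> + 1" using E\<phi> \<delta> by simp
    have shift_x: "\<bar>u x\<bar> powr p \<le> (\<bar>u x\<bar> + \<epsilon>) powr p" "max (\<bar>u x\<bar> - \<epsilon>) 0 powr p \<le> \<bar>u x\<bar> powr p" for x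
      using \<epsilon> p_gt_1 by (auto intro!: powr_mono2)
    have FG_small: "(\<integral>\<^sup>+ x. ennreal (F x) \<partial>lborel) \<le> ennreal (2 * \<eta>')"
    proof -
      have "\<exists>v S. v \<in> {u, \<phi>} \<and> S \<in> sets borel \<and> emeasure lborel S \<le> ennreal \<tau> \<and>
        (\<integral>\<^sup>+ x. ennreal (F x) \<partial>lborel) \<le> (\<integral>\<^sup>+ x. indicator S x * ennreal (\<bar>v x\<bar> powr p)
          + indicator \<Omega> x * ennreal ((\<bar>u x\<bar> + \<epsilon>) powr p - (max (\<bar>u x\<bar> - \<epsilon>) 0) powr p) \<partial>lborel)"
        using small
      proof
        assume le: "emeasure lborel P \<le> ennreal \<tau>"
        have "(\<integral>\<^sup>+ x. ennreal (F x) \<partial>lborel) \<le> (\<integral>\<^sup>+ x. indicator P x * ennreal (\<bar>\<phi> x\<bar> powr p)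
          + indicator \<Omega> x * ennreal ((\<bar>u x\<bar> + \<epsilon>) powr p - (max (\<bar>u x\<bar> - \<epsilon>) 0) powr p) \<partial>lborel)"
        proof (intro nn_integral_mono_AE, use pos in eventually_elim)
          fix x assume x: "0 \<le> u x \<and> 0 \<le> \<phi> x \<and> (x \<notin> \<Omega> \<longrightarrow> u x = 0 \<and> \<phi> x = 0)"
          show "ennreal (F x) \<le> indicator P x * ennreal (\<bar>\<phi> x\<bar> powr p)
            + indicator \<Omega> x * ennreal ((\<bar>u x\<bar> + \<epsilon>) powr p - (max (\<bar>u x\<bar> - \<epsilon>) 0) powr p)"
          proof (cases "x \<in> \<Omega>")
            case False then show ?thesis using x by (simp add: F_def)
          next
            case True
            show ?thesis
            proof (cases "x \<in> P")
              case True
              have "F x \<le> \<bar>\<phi> x\<bar> powr p" by (simp add: F_def)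
              then show ?thesis using True by (simp add: ennreal_leI add_increasing2)
            next
              case False
              then have "\<bar>\<phi> x\<bar> powr p \<le> (\<bar>u x\<bar> + \<epsilon>) powr p"
                using True x p_gt_1 by (intro powr_mono2) (auto simp: P_def)
              then have "F x \<le> (\<bar>u x\<bar> + \<epsilon>) powr p - (max (\<bar>u x\<bar> - \<epsilon>) 0) powr p"
                using shift_x[of x] unfolding F_def by (intro max.boundedI) linarith+
              then show ?thesis using True False by (simp add: ennreal_leI)
            qed
          qed
        qed
        then show ?thesis using le by (intro exI[of _ \<phi>] exI[of _ P]) auto
      next
        assume le: "emeasure lborel Q \<le> ennreal \<tau>"
        have "(\<integral>\<^sup>+ x. ennreal (G x) \<partial>lborel) \<le> (\<integral>\<^sup>+ x. indicator Q x * ennreal (\<bar>u x\<bar> powr p)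
          + indicator \<Omega> x * ennreal ((\<bar>u x\<bar> + \<epsilon>) powr p - (max (\<bar>u x\<bar> - \<epsilon>) 0) powr p) \<partial>lborel)"
        proof (intro nn_integral_mono_AE, use pos in eventually_elim)
          fix x assume x: "0 \<le> u x \<and> 0 \<le> \<phi> x \<and> (x \<notin> \<Omega> \<longrightarrow> u x = 0 \<and> \<phi> x = 0)"
          show "ennreal (G x) \<le> indicator Q x * ennreal (\<bar>u x\<bar> powr p)
            + indicator \<Omega> x * ennreal ((\<bar>u x\<bar> + \<epsilon>) powr p - (max (\<bar>u x\<bar> - \<epsilon>) 0) powr p)"
          proof (cases "x \<in> \<Omega>")
            case False then show ?thesis using x by (simp add: G_def)
          next
            case True
            show ?thesis
            proof (cases "x \<in> Q")
              case True
              have "G x \<le> \<bar>u x\<bar> powr p" by (simp add: G_def)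
              then show ?thesis using True by (simp add: ennreal_leI add_increasing2)
            next
              case False
              then have "max (\<bar>u x\<bar> - \<epsilon>) 0 powr p \<le> \<bar>\<phi> x\<bar> powr p"
                using True x p_gt_1 by (intro powr_mono2) (auto simp: Q_def)
              then have "G x \<le> (\<bar>u x\<bar> + \<epsilon>) powr p - (max (\<bar>u x\<bar> - \<epsilon>) 0) powr p"
                using shift_x[of x] unfolding G_def by (intro max.boundedI) linarith+
              then show ?thesis using True False by (simp add: ennreal_leI)
            qed
          qed
        qed
        then show ?thesis using le unfolding FG by (intro exI[of _ u] exI[of _ Q]) auto
      qed
      then obtain v S where v: "v \<in> {u, \<phi>}" and S [measurable]: "S \<in> sets borel" and S_le: "emeasure lborel S \<le> ennreal \<tau>"
        and le: "(\<integral>\<^sup>+ x. ennreal (F x) \<partial>lborel) \<le> (\<integral>\<^sup>+ x. indicator S x * ennreal (\<bar>v x\<bar> powr p)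
          + indicator \<Omega> x * ennreal ((\<bar>u x\<bar> + \<epsilon>) powr p - (max (\<bar>u x\<bar> - \<epsilon>) 0) powr p) \<partial>lborel)" by blast
      have v_meas [measurable]: "v \<in> borel_measurable borel" using v by auto
      have "mass p v \<le> 1" "near_energy 0 v \<le> ennreal B"
        using v mu m\<phi> energy_le[OF u] energy_le[OF \<phi> E1] min by auto
      then have "(\<integral>\<^sup>+ x. indicator S x * ennreal (\<bar>v x\<bar> powr p) \<partial>lborel) \<le> ennreal \<eta>'"
        by (intro ui v_meas S S_le)
      then have "(\<integral>\<^sup>+ x. indicator S x * ennreal (\<bar>v x\<bar> powr p) \<partial>lborel)
         + (\<integral>\<^sup>+ x. indicator \<Omega> x * ennreal ((\<bar>u x\<bar> + \<epsilon>) powr p - (max (\<bar>u x\<bar> - \<epsilon>) 0) powr p) \<partial>lborel) \<le> ennreal \<eta>' + ennreal \<eta>'"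
        using shift by (rule add_mono)
      also have "\<dots> = ennreal (2 * \<eta>')" using \<eta>' by (simp add: ennreal_plus[symmetric] del: ennreal_plus)
      finally show ?thesis using le by (subst (asm) nn_integral_add) auto
    qed
    have "mass p (\<lambda>x. \<phi> x - u x) \<le> (\<integral>\<^sup>+ x. ennreal (F x) + ennreal (G x) \<partial>lborel)"
      unfolding mass_def
    proof (intro nn_integral_mono_AE, use pos in eventually_elim)
      fix x assume x: "0 \<le> u x \<and> 0 \<le> \<phi> x \<and> (x \<notin> \<Omega> \<longrightarrow> u x = 0 \<and> \<phi> x = 0)"
      then have "\<bar>\<phi> x - u x\<bar> powr p \<le> \<bar>\<phi> x powr p - u x powr p\<bar>" by (intro powr_diff_superadditive p_gt_1) auto
      also have "\<dots> = F x + G x" using x by (auto simp: F_def G_def max_def)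
      finally have le: "\<bar>\<phi> x - u x\<bar> powr p \<le> F x + G x" .
      have "0 \<le> F x" "0 \<le> G x" by (auto simp: F_def G_def)
      then have "ennreal (F x) + ennreal (G x) = ennreal (F x + G x)" by simp
      with le show "ennreal (\<bar>\<phi> x - u x\<bar> powr p) \<le> ennreal (F x) + ennreal (G x)"
        by (simp only: ennreal_leI)
    qed
    also have "\<dots> = (\<integral>\<^sup>+ x. ennreal (F x) \<partial>lborel) + (\<integral>\<^sup>+ x. ennreal (G x) \<partial>lborel)"
      by (rule nn_integral_add) auto
    also have "\<dots> \<le> ennreal (2 * \<eta>') + ennreal (2 * \<eta>')"
      using FG_small FG by (intro add_mono) auto
    also have "\<dots> = ennreal \<eta>" using \<eta> by (simp add: \<eta>'_def ennreal_plus[symmetric] del: ennreal_plus)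
    finally show "mass p (\<lambda>x. \<phi> x - u x) \<le> ennreal \<eta>" .
  qed
qed

text \<open>
  Since \<open>E_frac s p (\<phi> s) = lambda_frac s p \<Omega>\<close>, the uniform comparison bounds \<open>E_log p (\<phi> s)\<close> by a quantity
  that tends to \<open>lambda_log p \<Omega>\<close>.
\<close>
lemma extremals_converge:
  assumes lip: "lipschitz_boundary \<Omega>"
    and \<phi>: "\<And>s. 0 < s \<Longrightarrow> s < 1 \<Longrightarrow> extremal_frac s p \<Omega> (\<phi> s) \<and> positive_in \<Omega> (\<phi> s)"
    and u: "extremal_log p \<Omega> u" and u_pos: "positive_in \<Omega> u"
  shows "((\<lambda>s. Lp_norm p \<Omega> (\<lambda>x. \<phi> s x - u x)) \<longlongrightarrow> 0) (at_right 0)"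
proof -
  have uX: "u \<in> unit_X0" and min: "E_log p u = lambda_log p \<Omega>" using u by (auto simp: extremal_log_def unit_X0_def)
  have ev01: "eventually (\<lambda>s::real. s \<in> {0<..<1}) (at_right 0)"
    by (rule eventually_at_right_real) simp
  have \<phi>W: "\<phi> s \<in> unit_W0 s" "E_frac s p (\<phi> s) = lambda_frac s p \<Omega>" if "0 < s" "s < 1" for s
    using \<phi>[OF that] by (auto simp: extremal_frac_def unit_W0_def)
  have \<phi>X: "\<phi> s \<in> unit_X0" if "0 < s" "s < 1" for s
    using \<phi>W[OF that] unit_W0_subset that by auto
  have "((\<lambda>s. ((lambda_frac s p \<Omega> - 1) / s - far_rate s) / compare s + rho_D) \<longlongrightarrow> (lambda_log p \<Omega> - rho_D) / 1 + rho_D) (at_right 0)"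
    by (intro tendsto_add tendsto_divide tendsto_diff derivative_lambda_frac[OF lip] tendsto_far_rate tendsto_compare tendsto_const) auto
  then have lim: "((\<lambda>s. ((lambda_frac s p \<Omega> - 1) / s - far_rate s) / compare s + rho_D) \<longlongrightarrow> lambda_log p \<Omega>) (at_right 0)" by simp
  have compare_pos: "eventually (\<lambda>s. 0 < compare s) (at_right 0)"
    by (rule order_tendstoD(1)[OF tendsto_compare]) simp
  have mass_lim: "((\<lambda>s. mass p (\<lambda>x. \<phi> s x - u x)) \<longlongrightarrow> 0) (at_right 0)"
  proof (rule order_tendstoI)
    fix a :: ennreal assume "0 < a"
    then obtain \<eta> where \<eta>: "0 < \<eta>" "ennreal \<eta> < a"
    proof (cases a)
      case (real r)
      then show ?thesis using that[of "r / 2"] \<open>0 < a\<close> by (auto simp: ennreal_less_iff)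
    next
      case top
      then show ?thesis using that[of 1] by simp
    qed
    obtain \<delta> where \<delta>: "0 < \<delta>" and st: "\<And>\<phi>. \<phi> \<in> unit_X0 \<Longrightarrow> positive_in \<Omega> \<phi> \<Longrightarrow> E_log p \<phi> \<le> lambda_log p \<Omega> + \<delta> \<Longrightarrow>
      mass p (\<lambda>x. \<phi> x - u x) \<le> ennreal \<eta>"
      using minimizer_stability[OF uX u_pos min \<eta>(1)] by blast
    have "eventually (\<lambda>s. ((lambda_frac s p \<Omega> - 1) / s - far_rate s) / compare s + rho_D < lambda_log p \<Omega> + \<delta>) (at_right 0)"
      using \<delta> by (intro order_tendstoD(2)[OF lim]) simp
    then show "eventually (\<lambda>s. mass p (\<lambda>x. \<phi> s x - u x) < a) (at_right 0)"
      using ev01 compare_pos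
    proof eventually_elim
      case (elim s)
      then have s: "0 < s" "s < 1" by auto
      have "compare s * (E_log p (\<phi> s) - rho_D) + far_rate s \<le> (lambda_frac s p \<Omega> - 1) / s"
        using E_frac_ge_E_log[OF s \<phi>W(1)[OF s]] \<phi>W(2)[OF s] by simp
      then have "compare s * (E_log p (\<phi> s) - rho_D) \<le> (lambda_frac s p \<Omega> - 1) / s - far_rate s" by linarith
      then have "E_log p (\<phi> s) - rho_D \<le> ((lambda_frac s p \<Omega> - 1) / s - far_rate s) / compare s"
        using elim(3) by (simp add: pos_le_divide_eq mult.commute)
      then have "E_log p (\<phi> s) \<le> lambda_log p \<Omega> + \<delta>" using elim(1) by linarith
      then show ?case using st[OF \<phi>X[OF s]] \<phi>[OF s] \<eta>(2) by (auto intro: le_less_trans)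
    qed
  qed simp
  have "((\<lambda>s. enn2real (mass p (\<lambda>x. \<phi> s x - u x))) \<longlongrightarrow> 0) (at_right 0)"
    by (rule tendsto_enn2real) (use mass_lim in simp_all)
  then have "((\<lambda>s. enn2real (mass p (\<lambda>x. \<phi> s x - u x)) powr (1 / p)) \<longlongrightarrow> 0 powr (1 / p)) (at_right 0)"
    using p_gt_1 by (intro tendsto_powr2 tendsto_const) (auto simp: enn2real_nonneg)
  moreover have "eventually (\<lambda>s. enn2real (mass p (\<lambda>x. \<phi> s x - u x)) powr (1 / p) = Lp_norm p \<Omega> (\<lambda>x. \<phi> s x - u x)) (at_right 0)"
    using ev01
  proof eventually_elim
    case (elim s)
    then have \<phi>s: "\<phi> s \<in> unit_X0" using \<phi>X by simp
    have [measurable]: "\<phi> s \<in> borel_measurable borel" "u \<in> borel_measurable borel" using \<phi>s uX by (auto simp: unit_X0_iff)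
    have van: "vanishes_outside \<Omega> (\<lambda>x. \<phi> s x - u x)"
      using \<phi>s uX unfolding unit_X0_iff vanishes_outside_def by auto
    have "mass p (\<lambda>x. \<phi> s x - u x) \<le> (\<integral>\<^sup>+ x. ennreal (2 powr p) * (ennreal (\<bar>\<phi> s x\<bar> powr p) + ennreal (\<bar>u x\<bar> powr p)) \<partial>lborel)"
      unfolding mass_def using powr_abs_diff_le[of p] p_gt_1
      by (intro nn_integral_mono) (simp add: ennreal_mult'[symmetric] ennreal_plus[symmetric] ennreal_leI del: ennreal_plus)
    also have "\<dots> = ennreal (2 powr p) * (mass p (\<phi> s) + mass p u)"
      unfolding mass_def by (simp add: nn_integral_cmult nn_integral_add)
    also have "\<dots> < \<infinity>" using \<phi>s uX by (simp add: unit_X0_iff ennreal_mult_less_top)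
    finally have "Lp_fun p (\<lambda>x. \<phi> s x - u x)" by (simp add: Lp_fun_iff)
    then show ?case using van by (simp add: Lp_norm_eq)
  qed
  ultimately have "((\<lambda>s. Lp_norm p \<Omega> (\<lambda>x. \<phi> s x - u x)) \<longlongrightarrow> 0 powr (1 / p)) (at_right 0)"
    by (rule Lim_transform_eventually)
  then show ?thesis by simp
qed

end

section \<open>The derivative of the eigenvalue at zero\<close>

theorem theorem1p3:
  fixes \<Omega> :: "'a::euclidean_space set" and p :: real
  assumes "open \<Omega>" and "bounded \<Omega>" and "\<Omega> \<noteq> {}" and "lipschitz_boundary \<Omega>"
    and "1 < p"
  shows "((\<lambda>s. (lambda_frac s p \<Omega> - 1) / s) \<longlongrightarrow> lambda_log p \<Omega>) (at_right 0)
    \<and> (\<forall>\<phi> u\<^sub>1.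
         (\<forall>s \<in> {0<..<1}. extremal_frac s p \<Omega> (\<phi> s) \<and> positive_in \<Omega> (\<phi> s)) \<longrightarrow>
         extremal_log p \<Omega> u\<^sub>1 \<and> positive_in \<Omega> u\<^sub>1 \<longrightarrow>
         ((\<lambda>s. Lp_norm p \<Omega> (\<lambda>x. \<phi> s x - u\<^sub>1 x)) \<longlongrightarrow> 0) (at_right 0))"
proof -
  obtain e where e: "\<And>x y. x \<in> \<Omega> \<Longrightarrow> y \<in> \<Omega> \<Longrightarrow> dist x y \<le> e"
    using \<open>bounded \<Omega>\<close> unfolding bounded_two_points by blast
  interpret bounded_domain \<Omega> p "max 1 (e + 1)"
  proof
    show "norm (x - y) < max 1 (e + 1)" if "x \<in> \<Omega>" "y \<in> \<Omega>" for x y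
      using e[OF that] by (simp add: dist_norm less_max_iff_disj)
  qed (use assms in auto)
  show ?thesis
    using derivative_lambda_frac[OF assms(4)] extremals_converge[OF assms(4)] by auto
qed

end
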